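(* Let $A$ be a noetherian (locally finite) $\mathbb{N}$-graded algebra over a field $k$. For every $0\neq X\in\mathbf{D}^b(\mathrm{gr}\,A)$, $$\mathrm{Extreg}(X)\geqslant -\mathrm{inf.deg}(R\underline{\mathrm{Hom}}_A(X,A)).$$ If, further, $A_0$ is semisimple and $\mathrm{pdim}\,X<\infty$, then $$\mathrm{Extreg}(X)=-\mathrm{inf.deg}(R\underline{\mathrm{Hom}}_A(X,A)).$$
   Context: $k$ is a field. An $\mathbb{N}$-graded algebra $A=\bigoplus_{i\geqslant 0}A_i$ is always a $k$-algebra that is locally finite: $\dim_k A_i<\infty$ for all $i$. Noetherian means left and right noetherian. Modules are graded left modules. $\mathrm{Gr}\,A$ is the category of graded $A$-modules with degree-zero morphisms, $\mathrm{gr}\,A$ its full subcategory of finitely generated modules; $\mathbf{D}^b(\mathrm{gr}\,A)$ is the bounded derived category. $J$ is the graded Jacobson radical of $A$ and $S=A/J$ (so $S=A_0$ when $A_0$ is semisimple). Shift: $M(j)_m=M_{m+j}$. $\underline{\mathrm{Hom}}_A(M,N)=\bigoplus_j\mathrm{Hom}_{\mathrm{Gr}\,A}(M,N(j))$, with derived functor $R\underline{\mathrm{Hom}}_A$ and cohomologies $\underline{\mathrm{Ext}}^i_A$. $\mathrm{pdim}(X)=\sup\{i\in\mathbb{Z}\mid \underline{\mathrm{Ext}}^i_A(X,Y)\neq 0\text{ for some }Y\in\mathrm{Gr}\,A\}$. For a complex $X$ of graded modules or graded vector spaces, $\mathrm{inf.deg}(X)=\inf\{i+j\mid H^i(X)_j\neq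 0\}\in\mathbb{Z}\cup\{\pm\infty\}$ ($\inf\emptyset=+\infty$). For $X\in\mathbf{D}^-(\mathrm{Gr}\,A)$, $\mathrm{Extreg}(X)=-\mathrm{inf.deg}(R\underline{\mathrm{Hom}}_A(X,S))$. *)

theory Defs
  imports "HOL-Algebra.Module" "HOL-Algebra.AbelCoset" "HOL-Library.Extended_Real" "HOL-Library.FuncSet"
begin

section \<open>Graded algebras\<close>

text \<open>
  The algebra \<open>A\<close> is a type of sort \<open>{ring, monoid_mult}\<close>, i.e. an arbitrary unital associative ring;
  unlike \<open>ring_1\<close> this sort does not exclude the zero ring.  \<open>G i\<close> is the homogeneous component \<open>A\<^sub>i\<close>.
\<close>

locale graded_algebra = vector_space scale
  for scale :: "'k::field \<Rightarrow> 'a::{ring,monoid_mult} \<Rightarrow> 'a" +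
  fixes G :: "nat \<Rightarrow> 'a set"
  assumes scale_mult_left: "scale c x * y = scale c (x * y)"
    and scale_mult_right: "x * scale c y = scale c (x * y)"
    and subspace_component: "subspace (G i)"
    and direct_sum: "\<exists>!f. (\<forall>i. f i \<in> G i) \<and> finite {i. f i \<noteq> 0} \<and> x = (\<Sum>i | f i \<noteq> 0. f i)"
    and one_component: "1 \<in> G 0"
    and mult_component: "x \<in> G i \<Longrightarrow> y \<in> G j \<Longrightarrow> x * y \<in> G (i + j)"
    and locally_finite: "\<exists>B. finite B \<and> G i = span B"

text \<open>One-sided ideals of a subring \<open>R\<close> (given as a subset of the type), needed for \<open>R = A\<close> and
  \<open>R = A\<^sub>0\<close>.\<close>

definition left_ideal :: "'a::{ring,monoid_mult} set \<Rightarrow> 'a set \<Rightarrow> bool" where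
  "left_ideal R L \<longleftrightarrow> L \<subseteq> R \<and> 0 \<in> L \<and> (\<forall>x\<in>L. \<forall>y\<in>L. x + y \<in> L) \<and> (\<forall>r\<in>R. \<forall>x\<in>L. r * x \<in> L)"

definition right_ideal :: "'a::{ring,monoid_mult} set \<Rightarrow> 'a set \<Rightarrow> bool" where
  "right_ideal R L \<longleftrightarrow> L \<subseteq> R \<and> 0 \<in> L \<and> (\<forall>x\<in>L. \<forall>y\<in>L. x + y \<in> L) \<and> (\<forall>r\<in>R. \<forall>x\<in>L. x * r \<in> L)"

definition noetherian :: "'a::{ring,monoid_mult} set \<Rightarrow> bool" where
  "noetherian R \<longleftrightarrow>
     (\<forall>L. left_ideal R L \<longrightarrow> (\<exists>F. finite F \<and> left_ideal R hull F = L)) \<and>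
     (\<forall>L. right_ideal R L \<longrightarrow> (\<exists>F. finite F \<and> right_ideal R hull F = L))"

text \<open>A ring is semisimple if its left regular module is semisimple: every left ideal has a
  complementary left ideal.\<close>

definition semisimple :: "'a::{ring,monoid_mult} set \<Rightarrow> bool" where
  "semisimple R \<longleftrightarrow> (\<forall>L. left_ideal R L \<longrightarrow>
     (\<exists>L'. left_ideal R L' \<and> L \<inter> L' = {0} \<and> {x + y | x y. x \<in> L \<and> y \<in> L'} = R))"


section \<open>Graded modules\<close>

text \<open>
  The additive structure is that of HOL-Algebra; the ring fields \<open>mult\<close> and \<open>one\<close> inherited from
  its module record play no role.  The library's module locale is for commutative scalars only.
  The same record, with scalars in \<open>k\<close>, is used for graded vector spaces.
\<close>

record ('r, 'm) gmod = "('r, 'm) module" +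
  gr :: "int \<Rightarrow> 'm set"

locale graded_module = abelian_group M
  for G :: "nat \<Rightarrow> 'a::{ring,monoid_mult} set" and M :: "('a, 'm) gmod" (structure) +
  assumes smult_closed: "x \<in> carrier M \<Longrightarrow> a \<odot> x \<in> carrier M"
    and smult_l_distr: "x \<in> carrier M \<Longrightarrow> (a + b) \<odot> x = a \<odot> x \<oplus> b \<odot> x"
    and smult_r_distr: "x \<in> carrier M \<Longrightarrow> y \<in> carrier M \<Longrightarrow> a \<odot> (x \<oplus> y) = a \<odot> x \<oplus> a \<odot> y"
    and smult_assoc: "x \<in> carrier M \<Longrightarrow> (a * b) \<odot> x = a \<odot> (b \<odot> x)"
    and smult_one: "x \<in> carrier M \<Longrightarrow> 1 \<odot> x = x"
    and additive_subgroup_gr: "additive_subgroup (gr M i) M"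
    and direct_sum: "x \<in> carrier M \<Longrightarrow>
      \<exists>!f. (\<forall>i. f i \<in> gr M i) \<and> finite {i. f i \<noteq> \<zero>} \<and> x = (\<Oplus>i\<in>{i. f i \<noteq> \<zero>}. f i)"
    and smult_gr: "a \<in> G n \<Longrightarrow> x \<in> gr M i \<Longrightarrow> a \<odot> x \<in> gr M (int n + i)"

definition regular :: "(nat \<Rightarrow> 'a::{ring,monoid_mult} set) \<Rightarrow> ('a, 'a) gmod" where
  "regular G = \<lparr>carrier = UNIV, mult = undefined, one = undefined, zero = 0, add = (+), smult = (*),
     gr = (\<lambda>i. if i \<ge> 0 then G (nat i) else {0})\<rparr>"

definition shift :: "('r, 'm) gmod \<Rightarrow> int \<Rightarrow> ('r, 'm) gmod" where
  "shift M j = M\<lparr>gr := \<lambda>m. gr M (m + j)\<rparr>"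

definition left_submodule :: "('r, 'm) gmod \<Rightarrow> 'm set \<Rightarrow> bool" where
  "left_submodule M N \<longleftrightarrow> additive_subgroup N M \<and> (\<forall>a. \<forall>x\<in>N. a \<odot>\<^bsub>M\<^esub> x \<in> N)"

definition fin_gen :: "('r, 'm) gmod \<Rightarrow> bool" where
  "fin_gen M \<longleftrightarrow> (\<exists>F \<subseteq> carrier M. finite F \<and> left_submodule M hull F = carrier M)"

text \<open>Graded submodule: a submodule generated by its homogeneous elements.\<close>

definition graded_submodule :: "('r, 'm) gmod \<Rightarrow> 'm set \<Rightarrow> bool" where
  "graded_submodule M N \<longleftrightarrow>
     left_submodule M N \<and> left_submodule M hull (N \<inter> (\<Union>i. gr M i)) = N"

definition maximal_graded_submodule :: "('r, 'm) gmod \<Rightarrow> 'm set \<Rightarrow> bool" where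
  "maximal_graded_submodule M N \<longleftrightarrow> graded_submodule M N \<and> N \<noteq> carrier M \<and>
     (\<forall>N'. graded_submodule M N' \<and> N \<subseteq> N' \<longrightarrow> N' = N \<or> N' = carrier M)"

definition sub_gmod :: "('r, 'm) gmod \<Rightarrow> 'm set \<Rightarrow> ('r, 'm) gmod" where
  "sub_gmod M N = M\<lparr>carrier := N, gr := \<lambda>i. gr M i \<inter> N\<rparr>"

definition quot_gmod :: "('r, 'm) gmod \<Rightarrow> 'm set \<Rightarrow> ('r, 'm set) gmod" where
  "quot_gmod M N = \<lparr>carrier = a_rcosets\<^bsub>M\<^esub> N, mult = undefined, one = undefined, zero = N,
     add = set_add M, smult = (\<lambda>a C. N <+>\<^bsub>M\<^esub> (\<lambda>x. a \<odot>\<^bsub>M\<^esub> x) ` C),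
     gr = (\<lambda>i. (\<lambda>x. N +>\<^bsub>M\<^esub> x) ` gr M i)\<rparr>"

text \<open>The graded Jacobson radical \<open>J\<close> is the intersection of the maximal graded left ideals.\<close>

definition graded_jacobson :: "(nat \<Rightarrow> 'a::{ring,monoid_mult} set) \<Rightarrow> 'a set" where
  "graded_jacobson G = \<Inter>{N. maximal_graded_submodule (regular G) N}"

definition mod_jacobson :: "(nat \<Rightarrow> 'a::{ring,monoid_mult} set) \<Rightarrow> ('a, 'a set) gmod" where
  "mod_jacobson G = quot_gmod (regular G) (graded_jacobson G)"

definition gr_hom :: "('r, 'm) gmod \<Rightarrow> ('r, 'n) gmod \<Rightarrow> ('m \<Rightarrow> 'n) set" where
  "gr_hom M N = {f \<in> carrier M \<rightarrow> carrier N.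
     (\<forall>x\<in>carrier M. \<forall>y\<in>carrier M. f (x \<oplus>\<^bsub>M\<^esub> y) = f x \<oplus>\<^bsub>N\<^esub> f y) \<and>
     (\<forall>a. \<forall>x\<in>carrier M. f (a \<odot>\<^bsub>M\<^esub> x) = a \<odot>\<^bsub>N\<^esub> f x) \<and>
     (\<forall>i. f ` gr M i \<subseteq> gr N i)}"

text \<open>
  The graded \<open>k\<close>-vector space \<open>\<Oplus>\<^sub>j Hom\<^bsub>Gr A\<^esub>(M, N(j))\<close>.  Maps are extensional, so that equal maps on
  \<open>carrier M\<close> are equal elements; \<open>c \<in> k\<close> acts through its image \<open>scale c 1\<close> in \<open>A\<close>.
\<close>

definition Hom_gmod ::
  "('k \<Rightarrow> 'a::{ring,monoid_mult} \<Rightarrow> 'a) \<Rightarrow> ('a, 'm) gmod \<Rightarrow> ('a, 'n) gmod \<Rightarrow> ('k, 'm \<Rightarrow> 'n) gmod"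
where
  "Hom_gmod scale M N =
     \<lparr>carrier = {\<lambda>x\<in>carrier M. \<Oplus>\<^bsub>N\<^esub>j\<in>F. g j x | F g.
         finite F \<and> (\<forall>j\<in>F. g j \<in> gr_hom M (shift N j))},
      mult = undefined, one = undefined,
      zero = (\<lambda>x\<in>carrier M. \<zero>\<^bsub>N\<^esub>),
      add = (\<lambda>f g. \<lambda>x\<in>carrier M. f x \<oplus>\<^bsub>N\<^esub> g x),
      smult = (\<lambda>c f. \<lambda>x\<in>carrier M. scale c 1 \<odot>\<^bsub>N\<^esub> f x),
      gr = (\<lambda>j. gr_hom M (shift N j) \<inter> extensional (carrier M))\<rparr>"


section \<open>Complexes\<close>

text \<open>Cochain complexes: \<open>df X n\<close> maps \<open>ob X n\<close> to \<open>ob X (n + 1)\<close>.\<close>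

record ('r, 'm) cpx =
  ob :: "int \<Rightarrow> ('r, 'm) gmod"
  df :: "int \<Rightarrow> 'm \<Rightarrow> 'm"

definition complex_Gr :: "(nat \<Rightarrow> 'a::{ring,monoid_mult} set) \<Rightarrow> ('a, 'm) cpx \<Rightarrow> bool" where
  "complex_Gr G X \<longleftrightarrow> (\<forall>n. graded_module G (ob X n) \<and>
     df X n \<in> gr_hom (ob X n) (ob X (n + 1)) \<and>
     (\<forall>x\<in>carrier (ob X n). df X (n + 1) (df X n x) = \<zero>\<^bsub>ob X (n + 2)\<^esub>))"

definition cocycles :: "('r, 'm) cpx \<Rightarrow> int \<Rightarrow> 'm set" where
  "cocycles X n = {x \<in> carrier (ob X n). df X n x = \<zero>\<^bsub>ob X (n + 1)\<^esub>}"

definition coboundaries :: "('r, 'm) cpx \<Rightarrow> int \<Rightarrow> 'm set" where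
  "coboundaries X n = df X (n - 1) ` carrier (ob X (n - 1))"

definition cohomology :: "('r, 'm) cpx \<Rightarrow> int \<Rightarrow> ('r, 'm set) gmod" where
  "cohomology X n = quot_gmod (sub_gmod (ob X n) (cocycles X n)) (coboundaries X n)"

definition inf_deg :: "('r, 'm) cpx \<Rightarrow> ereal" where
  "inf_deg X = Inf {ereal (real_of_int (i + j)) | i j.
     gr (cohomology X i) j \<noteq> {\<zero>\<^bsub>cohomology X i\<^esub>}}"

definition acyclic_cpx :: "('r, 'm) cpx \<Rightarrow> bool" where
  "acyclic_cpx X \<longleftrightarrow> (\<forall>n. carrier (cohomology X n) = {\<zero>\<^bsub>cohomology X n\<^esub>})"

text \<open>
  Objects of \<open>D\<^sup>b(gr A)\<close> are the bounded complexes of finitely generated graded modules; such an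
  object is zero in \<open>D\<^sup>b(gr A)\<close> iff it is acyclic.
\<close>

definition Db_gr :: "(nat \<Rightarrow> 'a::{ring,monoid_mult} set) \<Rightarrow> ('a, 'm) cpx set" where
  "Db_gr G = {X. complex_Gr G X \<and> (\<forall>n. fin_gen (ob X n)) \<and>
     (\<exists>a b. \<forall>n. n \<notin> {a..b} \<longrightarrow> carrier (ob X n) = {\<zero>\<^bsub>ob X n\<^esub>})}"

text \<open>
  A chain map, and the condition that it induces bijections in cohomology.  The induced map sends
  a class \<open>C = B + x\<close> to \<open>B' + f x\<close>, which is the set sum \<open>B' + f(C)\<close>.
\<close>

definition chain_map :: "('r, 'm) cpx \<Rightarrow> ('r, 'n) cpx \<Rightarrow> (int \<Rightarrow> 'm \<Rightarrow> 'n) \<Rightarrow> bool" where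
  "chain_map X Y f \<longleftrightarrow> (\<forall>n. f n \<in> gr_hom (ob X n) (ob Y n) \<and>
     (\<forall>x\<in>carrier (ob X n). f (n + 1) (df X n x) = df Y n (f n x)))"

definition quasi_iso :: "('r, 'm) cpx \<Rightarrow> ('r, 'n) cpx \<Rightarrow> (int \<Rightarrow> 'm \<Rightarrow> 'n) \<Rightarrow> bool" where
  "quasi_iso X Y f \<longleftrightarrow> chain_map X Y f \<and>
     (\<forall>n. bij_betw (\<lambda>C. coboundaries Y n <+>\<^bsub>ob Y n\<^esub> f n ` C)
        (carrier (cohomology X n)) (carrier (cohomology Y n)))"


section \<open>Derived Hom\<close>

text \<open>Graded free of finite rank: there is a finite basis of homogeneous elements.\<close>

definition fin_graded_free :: "('a, 'm) gmod \<Rightarrow> bool" where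
  "fin_graded_free M \<longleftrightarrow> (\<exists>B. finite B \<and> B \<subseteq> (\<Union>i. gr M i) \<and>
     bij_betw (\<lambda>c. \<Oplus>\<^bsub>M\<^esub>b\<in>B. c b \<odot>\<^bsub>M\<^esub> b) (B \<rightarrow>\<^sub>E UNIV) (carrier M))"

definition free_resolution ::
  "(nat \<Rightarrow> 'a::{ring,monoid_mult} set) \<Rightarrow> ('a, 'm) cpx \<Rightarrow> ('a, 'p) cpx \<Rightarrow> bool" where
  "free_resolution G X P \<longleftrightarrow> complex_Gr G P \<and> (\<forall>n. fin_graded_free (ob P n)) \<and>
     (\<exists>b. \<forall>n>b. carrier (ob P n) = {\<zero>\<^bsub>ob P n\<^esub>}) \<and> (\<exists>f. quasi_iso P X f)"

text \<open>
  For noetherian \<open>A\<close>, every \<open>X\<close> in \<open>D\<^sup>b(gr A)\<close> has a free resolution in this sense, unique up to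
  homotopy equivalence, and each module \<open>A(-d\<^sub>1) \<oplus> \<dots> \<oplus> A(-d\<^sub>n)\<close> has a copy carried by the type
  \<open>nat \<Rightarrow> 'a\<close>.  We fix a choice.
\<close>

definition resolution ::
  "(nat \<Rightarrow> 'a::{ring,monoid_mult} set) \<Rightarrow> ('a, 'm) cpx \<Rightarrow> ('a, nat \<Rightarrow> 'a) cpx" where
  "resolution G X = (SOME P. free_resolution G X P)"

text \<open>
  The complex of graded vector spaces \<open>Hom\<^sub>A(P, Y)\<close> for a graded module \<open>Y\<close>, with
  \<open>Hom\<^sub>A(P\<^bsup>-n\<^esup>, Y)\<close> in cohomological degree \<open>n\<close>.  The conventional sign of the differential is
  omitted; it affects neither kernels nor images.
\<close>

definition Hom_cpx ::
  "('k \<Rightarrow> 'a::{ring,monoid_mult} \<Rightarrow> 'a) \<Rightarrow> ('a, 'p) cpx \<Rightarrow> ('a, 'y) gmod \<Rightarrow> ('k, 'p \<Rightarrow> 'y) cpx"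
where
  "Hom_cpx scale P Y =
     \<lparr>ob = (\<lambda>n. Hom_gmod scale (ob P (- n)) Y),
      df = (\<lambda>n f. \<lambda>x\<in>carrier (ob P (- n - 1)). f (df P (- n - 1) x))\<rparr>"

definition RHom ::
  "('k \<Rightarrow> 'a \<Rightarrow> 'a) \<Rightarrow> (nat \<Rightarrow> 'a::{ring,monoid_mult} set) \<Rightarrow> ('a, 'm) cpx \<Rightarrow> ('a, 'y) gmod \<Rightarrow>
     ('k, (nat \<Rightarrow> 'a) \<Rightarrow> 'y) cpx" where
  "RHom scale G X Y = Hom_cpx scale (resolution G X) Y"

definition Ext ::
  "('k \<Rightarrow> 'a \<Rightarrow> 'a) \<Rightarrow> (nat \<Rightarrow> 'a::{ring,monoid_mult} set) \<Rightarrow> int \<Rightarrow> ('a, 'm) cpx \<Rightarrow> ('a, 'y) gmod \<Rightarrow>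
     ('k, ((nat \<Rightarrow> 'a) \<Rightarrow> 'y) set) gmod" where
  "Ext scale G i X Y = cohomology (RHom scale G X Y) i"

text \<open>
  The supremum runs over the graded modules \<open>Y\<close> carried by subsets of \<open>nat \<Rightarrow> 'a\<close>.  These represent all
  finitely generated graded modules up to isomorphism (choose representatives in \<open>A\<^sup>n\<close> of a
  quotient), and for noetherian \<open>A\<close> and \<open>X\<close> in \<open>D\<^sup>b(gr A)\<close> these suffice, because \<open>Ext\<close> from \<open>X\<close>
  commutes with filtered colimits in \<open>Y\<close>.
\<close>

definition pdim ::
  "('k \<Rightarrow> 'a \<Rightarrow> 'a) \<Rightarrow> (nat \<Rightarrow> 'a::{ring,monoid_mult} set) \<Rightarrow> ('a, 'm) cpx \<Rightarrow> ereal" where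
  "pdim scale G X = Sup {ereal (real_of_int i) | i. \<exists>Y :: ('a, nat \<Rightarrow> 'a) gmod.
     graded_module G Y \<and> carrier (Ext scale G i X Y) \<noteq> {\<zero>\<^bsub>Ext scale G i X Y\<^esub>}}"

definition Extreg ::
  "('k \<Rightarrow> 'a \<Rightarrow> 'a) \<Rightarrow> (nat \<Rightarrow> 'a::{ring,monoid_mult} set) \<Rightarrow> ('a, 'm) cpx \<Rightarrow> ereal" where
  "Extreg scale G X = - inf_deg (RHom scale G X (mod_jacobson G))"

end

theory Submission
  imports Defs
begin

text \<open>
  Let \<open>P\<close> be a resolution of \<open>X\<close> by finitely generated graded free modules.  Suppose
  \<open>Ext\<^sup>i(X, S)\<^sub>j = 0\<close> whenever \<open>i + j < s\<close>.  For a maximal graded left ideal \<open>m\<close>, the simple module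
  \<open>A/m\<close> is a direct summand of \<open>S\<close>, so it inherits the vanishing; by half exactness, a subquotient of
  finite length of \<open>A\<^bsub>\<ge>d\<^esub>\<close> satisfies it for \<open>i + j < s + d\<close>.  Since \<open>P\<^bsup>-i\<^esup>\<close> is finitely generated, maps of
  fixed degree from it to \<open>A\<^bsub>\<ge>r\<^esub>\<close> are zero for large \<open>r\<close>, and the vanishing passes to \<open>A\<^bsub>\<ge>d\<^esub>\<close>.  The case
  \<open>d = 0\<close> is the inequality.

  If \<open>A\<^sub>0\<close> is semisimple, then \<open>J = A\<^bsub>\<ge>1\<^esub>\<close>.  Suppose \<open>Ext\<^sup>i(X, A)\<^sub>j = 0\<close> whenever \<open>i + j < s\<close>.
  The sequence \<open>0 \<rightarrow> A\<^bsub>\<ge>1\<^esub> \<rightarrow> A \<rightarrow> S \<rightarrow> 0\<close> reduces the vanishing of \<open>Ext\<^sup>i(X, S)\<^sub>j\<close> to that of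
  \<open>Ext\<^bsup>i+1\<^esup>(X, A\<^bsub>\<ge>1\<^esub>)\<^sub>j\<close>, which by the first part (with \<open>d = 1\<close>) follows from the vanishing of
  \<open>Ext\<^bsup>i+1\<^esup>(X, S)\<close>; descending induction on \<open>i\<close> starts above \<open>pdim X\<close>.

  A resolution is built by descending degree: \<open>P\<^sup>n\<close> is a free cover of the pullback of
  \<open>Z\<^bsup>n+1\<^esup>(P) \<rightarrow> X\<^bsup>n+1\<^esup> \<leftarrow> X\<^sup>n\<close>, which is finitely generated because \<open>A\<close> is noetherian.
\<close>

section \<open>Graded modules\<close>

text \<open>Every coefficient module in the comparison is a subquotient \<open>N'/N\<close> of
  \<open>A\<close>, with \<open>N\<close> and \<open>N'\<close> left ideals. As the modules of
  \<open>P\<close> are graded free, maps into \<open>N'/N\<close> lift to maps into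
  \<open>N'\<close>. So the vanishing of Ext can be stated for maps from \<open>P\<close> to
  \<open>A\<close> that are compared modulo \<open>N\<close>, and half exactness becomes the repair
  of such a map by two successive coboundaries. Cohomological degree \<open>i\<close> is position
  \<open>n = -i\<close> of \<open>P\<close>, so the bound \<open>i + j < s\<close> reads
  \<open>j - n < s\<close>.

  In the first part \<open>A\<^sub>0\<close> is arbitrary, so the simple modules have to be found by
  hand. Local finiteness does this: each component is finite-dimensional, and a choice of least
  dimension in one degree replaces the structure theory of \<open>A/J\<close>.

  The resolution behind Ext is a \<open>SOME\<close> choice, about which nothing is known until some
  resolution has been constructed. It has to live on the type \<open>nat \<Rightarrow> 'a\<close>,
  hence the concrete free modules of sequences.\<close>

lemma finsum_additive_map:
  assumes "abelian_monoid M" "abelian_monoid N" "h \<in> carrier M \<rightarrow> carrier N"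
    and "\<And>x y. x \<in> carrier M \<Longrightarrow> y \<in> carrier M \<Longrightarrow> h (x \<oplus>\<^bsub>M\<^esub> y) = h x \<oplus>\<^bsub>N\<^esub> h y"
    and "h \<zero>\<^bsub>M\<^esub> = \<zero>\<^bsub>N\<^esub>" and "f \<in> A \<rightarrow> carrier M"
  shows "h (finsum M f A) = finsum N (\<lambda>i. h (f i)) A"
proof -
  interpret M: abelian_monoid M by fact
  interpret N: abelian_monoid N by fact
  show ?thesis
    using assms(6)
  proof (induction A rule: infinite_finite_induct)
    case (infinite A)
    then show ?case using assms by (simp add: M.finsum_infinite N.finsum_infinite)
  next
    case empty
    then show ?case using assms by simp
  next
    case (insert x F)
    have "(\<lambda>i. h (f i)) \<in> F \<rightarrow> carrier N" "h (f x) \<in> carrier N"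
      using insert.prems assms(3) by auto
    moreover have "f \<in> F \<rightarrow> carrier M" "f x \<in> carrier M" using insert.prems by auto
    ultimately show ?case
      using insert assms(4) by (simp add: M.finsum_insert N.finsum_insert)
  qed
qed

lemma (in abelian_monoid) finsum_single:
  assumes "finite A" "i \<in> A" "x \<in> carrier G"
  shows "(\<Oplus>j\<in>A. if j = i then x else \<zero>) = x"
  using add.finprod_singleton[OF assms(2,1), of "\<lambda>_. x"] assms(3)
  by (simp add: eq_commute[of i] cong: if_cong)

lemma (in abelian_monoid) finsum_support:
  assumes "finite A" "f \<in> UNIV \<rightarrow> carrier G" "\<And>i. i \<notin> A \<Longrightarrow> f i = \<zero>"
  shows "finsum G f {i. f i \<noteq> \<zero>} = finsum G f A"
  by (rule add.finprod_mono_neutral_cong_left) (use assms in auto)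

lemma abelian_group_zero_map:
  assumes "abelian_group M" "abelian_group N" "h \<in> carrier M \<rightarrow> carrier N"
    and "\<And>x y. x \<in> carrier M \<Longrightarrow> y \<in> carrier M \<Longrightarrow> h (x \<oplus>\<^bsub>M\<^esub> y) = h x \<oplus>\<^bsub>N\<^esub> h y"
  shows "h \<zero>\<^bsub>M\<^esub> = \<zero>\<^bsub>N\<^esub>"
proof -
  interpret M: abelian_group M by fact
  interpret N: abelian_group N by fact
  have z: "h \<zero>\<^bsub>M\<^esub> \<in> carrier N" using assms(3) by auto
  have "h \<zero>\<^bsub>M\<^esub> \<oplus>\<^bsub>N\<^esub> h \<zero>\<^bsub>M\<^esub> = h \<zero>\<^bsub>M\<^esub>"
    using assms(4)[of "\<zero>\<^bsub>M\<^esub>" "\<zero>\<^bsub>M\<^esub>"] z by simp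
  then show ?thesis using z N.add.l_cancel_one by blast
qed

text \<open>This is how the unique decomposition demanded by \<open>graded_module\<close> is checked
  for shifts, quotients, embedded ideals and free modules. Additive projections that are orthogonal
  recover the summands: \<open>p k\<close> applied to any decomposition leaves only its
  \<open>k\<close>-th term.\<close>

lemma direct_sum_by_projections:
  fixes M (structure)
  assumes "abelian_group M" "\<And>i. V i \<subseteq> carrier M"
    and mem: "\<And>i x. x \<in> carrier M \<Longrightarrow> p i x \<in> V i"
    and add: "\<And>i x y. x \<in> carrier M \<Longrightarrow> y \<in> carrier M \<Longrightarrow> p i (x \<oplus> y) = p i x \<oplus> p i y"
    and proj: "\<And>i k x. x \<in> V i \<Longrightarrow> p k x = (if k = i then x else \<zero>)"
    and x: "x \<in> carrier M" "finite {i. p i x \<noteq> \<zero>}" "x = (\<Oplus>i\<in>{i. p i x \<noteq> \<zero>}. p i x)"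
  shows "\<exists>!f. (\<forall>i. f i \<in> V i) \<and> finite {i. f i \<noteq> \<zero>} \<and> x = (\<Oplus>i\<in>{i. f i \<noteq> \<zero>}. f i)"
proof (rule ex1I[of _ "\<lambda>i. p i x"])
  interpret abelian_group M by fact
  show "(\<forall>i. p i x \<in> V i) \<and> finite {i. p i x \<noteq> \<zero>} \<and> x = (\<Oplus>i\<in>{i. p i x \<noteq> \<zero>}. p i x)"
    using mem x by auto
  fix f assume f: "(\<forall>i. f i \<in> V i) \<and> finite {i. f i \<noteq> \<zero>} \<and> x = (\<Oplus>i\<in>{i. f i \<noteq> \<zero>}. f i)"
  have fc: "f i \<in> carrier M" for i using f assms(2) by auto
  show "f = (\<lambda>i. p i x)"
  proof
    fix k
    have pc: "p k \<in> carrier M \<rightarrow> carrier M" using mem assms(2) by auto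
    have "p k x = (\<Oplus>i\<in>{i. f i \<noteq> \<zero>}. p k (f i))"
      by (subst f[THEN conjunct2, THEN conjunct2], rule finsum_additive_map)
        (use assms(1) add pc fc abelian_group_zero_map[OF assms(1,1) pc add]
          in \<open>auto simp: abelian_group.axioms abelian_monoid_axioms\<close>)
    also have "\<dots> = (\<Oplus>i\<in>{i. f i \<noteq> \<zero>}. if i = k then f k else \<zero>)"
      using f fc proj[of "f i" i k for i] by (intro finsum_cong') auto
    also have "\<dots> = f k"
    proof (cases "f k = \<zero>")
      case True
      then show ?thesis by (simp add: add.finprod_one_eqI)
    next
      case False
      then show ?thesis using f fc by (intro finsum_single) auto
    qed
    finally show "f k = p k x" by simp
  qed
qed

section \<open>Homogeneous components, submodules and cosets\<close>

context graded_module
begin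

lemma gr_carrier: "x \<in> gr M i \<Longrightarrow> x \<in> carrier M"
  using additive_subgroup.a_subset[OF additive_subgroup_gr] by auto

lemma zero_gr: "\<zero> \<in> gr M i"
  by (rule additive_subgroup.zero_closed[OF additive_subgroup_gr])

lemma add_gr: "x \<in> gr M i \<Longrightarrow> y \<in> gr M i \<Longrightarrow> x \<oplus> y \<in> gr M i"
  by (rule additive_subgroup.a_closed[OF additive_subgroup_gr])

lemma smult_zero: "a \<odot> \<zero> = \<zero>"
  by (rule abelian_group_zero_map)
    (use abelian_group_axioms smult_closed smult_r_distr in auto)

lemma zero_smult:
  assumes "x \<in> carrier M" shows "0 \<odot> x = \<zero>"
proof -
  have "0 \<odot> x \<oplus> 0 \<odot> x = 0 \<odot> x"
    using smult_l_distr[OF assms, of 0 0] smult_closed[OF assms, of 0] by simp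
  then show ?thesis using smult_closed[OF assms, of 0] add.l_cancel_one by blast
qed

lemma minus_one_smult:
  assumes "x \<in> carrier M" shows "(- 1) \<odot> x = \<ominus> x"
proof -
  have "(- 1) \<odot> x \<oplus> x = (- 1 + 1) \<odot> x"
    using smult_l_distr[OF assms, of "- 1" 1] smult_one[OF assms] by simp
  also have "\<dots> = \<zero>" using zero_smult[OF assms] by simp
  finally show ?thesis
    using assms smult_closed by (metis minus_equality)
qed

lemma smult_finsum:
  "f \<in> A \<rightarrow> carrier M \<Longrightarrow> a \<odot> finsum M f A = (\<Oplus>i\<in>A. a \<odot> f i)"
  by (rule finsum_additive_map)
    (use abelian_monoid_axioms smult_closed smult_r_distr smult_zero in auto)

lemma finsum_gr: "(\<And>i. i \<in> A \<Longrightarrow> f i \<in> gr M k) \<Longrightarrow> finsum M f A \<in> gr M k"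
proof (induction A rule: infinite_finite_induct)
  case (infinite A)
  then show ?case using zero_gr by (simp add: finsum_infinite)
next
  case (insert x F)
  moreover have "f \<in> F \<rightarrow> carrier M" "f x \<in> carrier M" using insert.prems gr_carrier by auto
  ultimately show ?case by (simp add: finsum_insert add_gr)
qed (use zero_gr in auto)

definition component :: "int \<Rightarrow> 'm \<Rightarrow> 'm" where
  "component k x = (THE f. (\<forall>i. f i \<in> gr M i) \<and> finite {i. f i \<noteq> \<zero>} \<and>
     x = (\<Oplus>i\<in>{i. f i \<noteq> \<zero>}. f i)) k"

lemma component_props:
  assumes "x \<in> carrier M"
  shows "component k x \<in> gr M k" "finite {i. component i x \<noteq> \<zero>}"
    "(\<Oplus>i\<in>{i. component i x \<noteq> \<zero>}. component i x) = x"
  using theI'[OF direct_sum[OF assms]] unfolding component_def by auto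

lemma component_unique:
  assumes "finite A" "\<And>i. f i \<in> gr M i" "\<And>i. i \<notin> A \<Longrightarrow> f i = \<zero>"
  shows "component k (finsum M f A) = f k"
proof -
  have fc: "f \<in> UNIV \<rightarrow> carrier M" using assms(2) gr_carrier by blast
  then have "finsum M f A \<in> carrier M" by (intro finsum_closed) auto
  moreover have "finsum M f A = finsum M f {i. f i \<noteq> \<zero>}"
    using finsum_support[OF assms(1) fc assms(3)] by simp
  moreover have "finite {i. f i \<noteq> \<zero>}"
    by (rule finite_subset[OF _ assms(1)]) (use assms(3) in auto)
  ultimately show ?thesis
    unfolding component_def by (subst the1_equality[OF direct_sum, of _ f]) (use assms in auto)
qed

lemma component_sum_superset:
  assumes "x \<in> carrier M" "finite A" "{i. component i x \<noteq> \<zero>} \<subseteq> A"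
  shows "(\<Oplus>i\<in>A. component i x) = x"
proof -
  have "finsum M (\<lambda>i. component i x) {i. component i x \<noteq> \<zero>} = finsum M (\<lambda>i. component i x) A"
    by (rule finsum_support) (use assms component_props(1)[OF assms(1)] gr_carrier in blast)+
  then show ?thesis using component_props(3)[OF assms(1)] by simp
qed

lemma component_carrier: "x \<in> carrier M \<Longrightarrow> component k x \<in> carrier M"
  using component_props(1) gr_carrier by blast

lemma component_gr:
  assumes "x \<in> gr M i" shows "component k x = (if k = i then x else \<zero>)"
proof -
  have "component k (\<Oplus>j\<in>{i}. if j = i then x else \<zero>) = (if k = i then x else \<zero>)"
    by (rule component_unique) (use assms zero_gr in auto)
  then show ?thesis using finsum_single[of "{i}" i x] gr_carrier[OF assms] by simp
qed

lemma component_add: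
  assumes "x \<in> carrier M" "y \<in> carrier M"
  shows "component k (x \<oplus> y) = component k x \<oplus> component k y"
proof -
  let ?A = "{i. component i x \<noteq> \<zero>} \<union> {i. component i y \<noteq> \<zero>}"
  have A: "finite ?A" using component_props(2) assms by blast
  have "x \<oplus> y = (\<Oplus>i\<in>?A. component i x) \<oplus> (\<Oplus>i\<in>?A. component i y)"
    using component_sum_superset[OF assms(1) A] component_sum_superset[OF assms(2) A] by simp
  also have "\<dots> = (\<Oplus>i\<in>?A. component i x \<oplus> component i y)"
    by (rule finsum_addf[symmetric]) (use component_carrier assms in auto)
  finally show ?thesis
    using component_unique[OF A, of "\<lambda>i. component i x \<oplus> component i y"]
      component_props(1) assms add_gr by auto
qed

lemma component_zero: "component k \<zero> = \<zero>"
  using component_gr[OF zero_gr, of k 0] by auto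

lemma component_finsum:
  "f \<in> A \<rightarrow> carrier M \<Longrightarrow> component k (finsum M f A) = (\<Oplus>i\<in>A. component k (f i))"
  by (rule finsum_additive_map)
    (use abelian_monoid_axioms component_carrier component_add component_zero in auto)

text \<open>Closure under negatives is automatic, because the negative of \<open>x\<close> is its
  multiple by \<open>- 1\<close>.\<close>

lemma left_submodule_iff:
  "left_submodule M N \<longleftrightarrow> N \<subseteq> carrier M \<and> \<zero> \<in> N \<and> (\<forall>x\<in>N. \<forall>y\<in>N. x \<oplus> y \<in> N) \<and>
     (\<forall>a. \<forall>x\<in>N. a \<odot> x \<in> N)"
proof
  assume "left_submodule M N"
  then interpret additive_subgroup N M unfolding left_submodule_def by simp
  show "N \<subseteq> carrier M \<and> \<zero> \<in> N \<and> (\<forall>x\<in>N. \<forall>y\<in>N. x \<oplus> y \<in> N) \<and> (\<forall>a. \<forall>x\<in>N. a \<odot> x \<in> N)"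
    using \<open>left_submodule M N\<close> a_subset zero_closed a_closed unfolding left_submodule_def by auto
next
  assume N: "N \<subseteq> carrier M \<and> \<zero> \<in> N \<and> (\<forall>x\<in>N. \<forall>y\<in>N. x \<oplus> y \<in> N) \<and> (\<forall>a. \<forall>x\<in>N. a \<odot> x \<in> N)"
  have "additive_subgroup N M"
  proof (rule additive_subgroupI, rule add.subgroupI)
    fix x assume x: "x \<in> N"
    then have "(- 1) \<odot> x \<in> N" using N by blast
    moreover have "x \<in> carrier M" using x N by blast
    ultimately show "\<ominus> x \<in> N" using minus_one_smult by simp
  qed (use N in auto)
  then show "left_submodule M N" using N unfolding left_submodule_def by auto
qed

lemma left_submoduleD:
  assumes "left_submodule M N"
  shows "x \<in> N \<Longrightarrow> x \<in> carrier M" "\<zero> \<in> N" "x \<in> N \<Longrightarrow> y \<in> N \<Longrightarrow> x \<oplus> y \<in> N"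
    "x \<in> N \<Longrightarrow> a \<odot> x \<in> N"
  using assms unfolding left_submodule_iff by auto

lemma left_submoduleI:
  assumes "N \<subseteq> carrier M" "\<zero> \<in> N" "\<And>x y. x \<in> N \<Longrightarrow> y \<in> N \<Longrightarrow> x \<oplus> y \<in> N"
    "\<And>a x. x \<in> N \<Longrightarrow> a \<odot> x \<in> N"
  shows "left_submodule M N"
  using assms unfolding left_submodule_iff by auto

lemma left_submodule_finsum:
  assumes "left_submodule M N" "\<And>i. i \<in> A \<Longrightarrow> f i \<in> N"
  shows "finsum M f A \<in> N"
  using assms(2)
proof (induction A rule: infinite_finite_induct)
  case (insert x F)
  then have "f \<in> F \<rightarrow> carrier M" "f x \<in> carrier M" using left_submoduleD(1)[OF assms(1)] by auto
  then show ?case using insert left_submoduleD(3)[OF assms(1)] by (simp add: finsum_insert)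
qed (use left_submoduleD(2)[OF assms(1)] in \<open>auto simp: finsum_infinite\<close>)

lemma left_submodule_Int:
  "left_submodule M N \<Longrightarrow> left_submodule M N' \<Longrightarrow> left_submodule M (N \<inter> N')"
  unfolding left_submodule_iff by auto

lemma left_submodule_carrier: "left_submodule M (carrier M)"
  by (rule left_submoduleI) (use smult_closed in auto)

lemma left_submodule_minus:
  assumes "left_submodule M N" "x \<in> N" "y \<in> N" shows "x \<ominus> y \<in> N"
  using assms minus_one_smult unfolding left_submodule_iff a_minus_def by (metis subsetD)

lemma coset_eq_iff:
  assumes N: "left_submodule M N" and xy: "x \<in> carrier M" "y \<in> carrier M"
  shows "N +> x = N +> y \<longleftrightarrow> x \<ominus> y \<in> N"
proof -
  note D = left_submoduleD[OF N]
  have coset: "N +> u = (\<lambda>h. h \<oplus> u) ` N" for u unfolding a_r_coset_def' by auto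
  have sub: "(\<lambda>h. h \<oplus> u) ` N \<subseteq> (\<lambda>h. h \<oplus> v) ` N"
    if uv: "u \<ominus> v \<in> N" "u \<in> carrier M" "v \<in> carrier M" for u v
  proof (rule image_subsetI)
    fix h assume h: "h \<in> N"
    have "h \<oplus> u = (h \<oplus> (u \<ominus> v)) \<oplus> v"
      using D(1)[OF h] uv(2,3) by (simp add: a_minus_def a_assoc l_neg)
    then show "h \<oplus> u \<in> (\<lambda>h. h \<oplus> v) ` N" using D(3)[OF h uv(1)] by (rule image_eqI)
  qed
  show ?thesis
  proof
    assume "N +> x = N +> y"
    moreover have "\<zero> \<oplus> x \<in> (\<lambda>h. h \<oplus> x) ` N" by (rule imageI) (rule D(2))
    ultimately obtain h where h: "h \<in> N" "x = h \<oplus> y" using xy unfolding coset by auto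
    have "x \<ominus> y = h"
      using D(1)[OF h(1)] xy(2) unfolding h(2) a_minus_def by (simp add: a_assoc r_neg)
    then show "x \<ominus> y \<in> N" using h(1) by simp
  next
    assume d: "x \<ominus> y \<in> N"
    have "\<ominus> (x \<ominus> y) \<in> N" using D(4)[OF d, of "- 1"] D(1)[OF d] minus_one_smult by simp
    moreover have "\<ominus> (x \<ominus> y) = y \<ominus> x" using xy by (simp add: a_minus_def minus_add a_comm)
    ultimately have "y \<ominus> x \<in> N" by simp
    then show "N +> x = N +> y" unfolding coset using d xy by (intro equalityI sub)
  qed
qed

lemma left_submodule_hull:
  assumes "F \<subseteq> carrier M" shows "left_submodule M (left_submodule M hull F)"
proof -
  have "left_submodule M (carrier M)" unfolding left_submodule_iff using smult_closed by auto
  then have "left_submodule M hull F \<subseteq> carrier M" using assms by (rule hull_minimal[rotated])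
  then show ?thesis
    unfolding left_submodule_iff by (auto simp: hull_def left_submodule_iff)
qed

lemma left_submodule_hull_insert:
  assumes "F \<subseteq> carrier M" "x \<in> carrier M"
  shows "left_submodule M hull (insert x F) = {a \<odot> x \<oplus> w | a w. w \<in> left_submodule M hull F}"
    (is "_ = ?R")
proof (rule hull_unique)
  let ?H = "left_submodule M hull F"
  have H: "?H \<subseteq> carrier M" "\<zero> \<in> ?H" "\<And>u v. u \<in> ?H \<Longrightarrow> v \<in> ?H \<Longrightarrow> u \<oplus> v \<in> ?H"
    "\<And>a u. u \<in> ?H \<Longrightarrow> a \<odot> u \<in> ?H"
    using left_submodule_hull[OF assms(1)] unfolding left_submodule_iff by auto
  have "x = 1 \<odot> x \<oplus> \<zero>" using smult_one assms by simp
  moreover have "w = 0 \<odot> x \<oplus> w" if "w \<in> F" for w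
    using that assms zero_smult by auto
  ultimately show "insert x F \<subseteq> ?R" using H(2) hull_inc[of _ F "left_submodule M"] by blast
  show "left_submodule M ?R"
  proof (intro left_submodule_iff[THEN iffD2] conjI ballI allI)
    show "?R \<subseteq> carrier M" using H(1) smult_closed assms by auto
    have "\<zero> = 0 \<odot> x \<oplus> \<zero>" using zero_smult assms by simp
    then show "\<zero> \<in> ?R" using H(2) by blast
    fix u assume "u \<in> ?R"
    then obtain a w where u: "u = a \<odot> x \<oplus> w" and w: "w \<in> ?H" by auto
    note wc = subsetD[OF H(1) w]
    have "b \<odot> u = (b * a) \<odot> x \<oplus> b \<odot> w" for b
      unfolding u using wc assms smult_closed by (simp add: smult_r_distr smult_assoc)
    then show "b \<odot> u \<in> ?R" for b using H(4)[OF w] by blast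
    fix v assume "v \<in> ?R"
    then obtain a' w' where v: "v = a' \<odot> x \<oplus> w'" and w': "w' \<in> ?H" by auto
    note wc' = subsetD[OF H(1) w']
    have "u \<oplus> v = (a + a') \<odot> x \<oplus> (w \<oplus> w')"
      unfolding u v using wc wc' assms smult_closed by (simp add: smult_l_distr a_ac)
    then show "u \<oplus> v \<in> ?R" using H(3)[OF w w'] by blast
  qed
  fix T assume T: "insert x F \<subseteq> T" "left_submodule M T"
  then have "?H \<subseteq> T" by (intro hull_minimal) auto
  then show "?R \<subseteq> T" using T unfolding left_submodule_iff by blast
qed

end

lemma (in graded_module) shift_graded_module: "graded_module G (shift M j)"
proof -
  have eq: "carrier (shift M j) = carrier M" "add (shift M j) = add M" "zero (shift M j) = zero M"
    "smult (shift M j) = smult M" "gr (shift M j) i = gr M (i + j)" for i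
    unfolding shift_def by auto
  have ab: "abelian_group (shift M j)"
    using abelian_group_axioms
    unfolding abelian_group_def abelian_monoid_def abelian_group_axioms_def eq by simp
  have fs: "finsum (shift M j) f A = finsum M f A" for f :: "'c \<Rightarrow> 'm" and A
    unfolding finsum_def eq ..
  show ?thesis
  proof (intro graded_module.intro graded_module_axioms.intro ab)
    fix x assume "x \<in> carrier (shift M j)"
    then have x: "x \<in> carrier M" using eq by simp
    let ?c = "\<lambda>i. component (i + j) x"
    have inj: "inj_on (\<lambda>i. i + j) A" for A by (auto simp: inj_on_def)
    have im: "(\<lambda>i. i + j) ` {i. ?c i \<noteq> \<zero>} = {i. component i x \<noteq> \<zero>}"
      by (auto simp: image_iff) (metis diff_add_cancel)
    have fin: "finite {i. ?c i \<noteq> \<zero>}"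
      using component_props(2)[OF x] im finite_imageD[OF _ inj] by metis
    have "(\<Oplus>i\<in>{i. ?c i \<noteq> \<zero>}. ?c i) = (\<Oplus>i\<in>(\<lambda>i. i + j) ` {i. ?c i \<noteq> \<zero>}. component i x)"
      by (rule finsum_reindex[symmetric]) (use inj component_carrier x in auto)
    then have sum: "x = (\<Oplus>i\<in>{i. ?c i \<noteq> \<zero>}. ?c i)"
      unfolding im using component_props(3)[OF x] by simp
    have "\<exists>!f. (\<forall>i. f i \<in> gr M (i + j)) \<and> finite {i. f i \<noteq> \<zero>} \<and> x = (\<Oplus>i\<in>{i. f i \<noteq> \<zero>}. f i)"
      by (rule direct_sum_by_projections[where p = "\<lambda>i. component (i + j)"])
        (use fin sum x gr_carrier component_props(1) component_add component_gr abelian_group_axioms in auto)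
    then show "\<exists>!f. (\<forall>i. f i \<in> gr (shift M j) i) \<and> finite {i. f i \<noteq> \<zero>\<^bsub>shift M j\<^esub>} \<and>
       x = (\<Oplus>\<^bsub>shift M j\<^esub>i\<in>{i. f i \<noteq> \<zero>\<^bsub>shift M j\<^esub>}. f i)"
      unfolding eq fs .
  next
    fix i
    show "additive_subgroup (gr (shift M j) i) (shift M j)"
      using additive_subgroup_gr[of "i + j"] unfolding additive_subgroup_def eq .
  next
    fix a n x i
    assume "a \<in> G n" "x \<in> gr (shift M j) i"
    then show "a \<odot>\<^bsub>shift M j\<^esub> x \<in> gr (shift M j) (int n + i)"
      using smult_gr[of a n x "i + j"] unfolding eq by (simp add: add.assoc)
  qed (auto simp: eq smult_closed smult_l_distr smult_r_distr smult_assoc smult_one)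
qed

section \<open>Graded left ideals and the graded Jacobson radical\<close>

text \<open>The whole space may be infinite-dimensional; finiteness comes from \<open>B\<close>, in
  the applications a finite spanning set of one component of \<open>A\<close>. A basis of
  \<open>U\<close> together with a vector of \<open>W\<close> outside \<open>U\<close> is
  independent, hence no larger than a basis of \<open>W\<close>.\<close>

lemma (in vector_space) dim_strict_mono:
  assumes "subspace U" "U \<subset> W" "W \<subseteq> span B" "finite B"
  shows "dim U < dim W"
proof -
  obtain C where C: "C \<subseteq> U" "independent C" "U \<subseteq> span C" "card C = dim U"
    by (rule basis_exists)
  have "span C = U" using C assms(1) by (simp add: span_subspace)
  then obtain x where x: "x \<in> W" "x \<notin> span C" using assms(2) by auto
  have fin: "finite C" using independent_span_bound[OF assms(4) C(2)] C(1) assms by blast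
  obtain D where D: "D \<subseteq> W" "independent D" "W \<subseteq> span D" "card D = dim W"
    by (rule basis_exists)
  have "finite D" using independent_span_bound[OF assms(4) D(2)] D(1) assms by blast
  moreover have "independent (insert x C)" using x C independent_insertI by blast
  moreover have "insert x C \<subseteq> span D" using x C D assms(2) by auto
  ultimately have "card (insert x C) \<le> card D" using independent_span_bound by blast
  moreover have "x \<notin> C" using x span_base by blast
  ultimately show ?thesis using fin C D by simp
qed

section \<open>\<open>A\<close> as a graded module over itself\<close>

lemma regular_simps [simp]:
  "carrier (regular G) = UNIV" "add (regular G) = (+)" "zero (regular G) = 0"
  "smult (regular G) = (*)"
  unfolding regular_def by auto

lemma gr_regular: "gr (regular G) i = (if i \<ge> 0 then G (nat i) else {0})"
  unfolding regular_def by simp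

lemma abelian_group_regular: "abelian_group (regular G)"
  by (rule abelian_groupI) (auto simp: algebra_simps intro: exI[of _ "- _"])

lemma finsum_regular [simp]: "finsum (regular G) f A = sum f A"
proof -
  interpret abelian_group "regular G" by (rule abelian_group_regular)
  show ?thesis
    by (induction A rule: infinite_finite_induct) (simp_all add: finsum_infinite finsum_insert)
qed

lemma minus_regular [simp]: "x \<ominus>\<^bsub>regular G\<^esub> y = x - y"
proof -
  interpret abelian_group "regular G" by (rule abelian_group_regular)
  have "\<ominus>\<^bsub>regular G\<^esub> y = - y" by (rule minus_equality) auto
  then show ?thesis by (simp only: a_minus_def regular_simps) simp
qed

context graded_algebra
begin

text \<open>The decomposition in \<open>graded_algebra\<close> is indexed by \<open>nat\<close>, the
  one in \<open>graded_module\<close> by \<open>int\<close>. They correspond because the components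
  of \<open>regular G\<close> in negative degrees are zero.\<close>

lemma regular_direct_sum:
  "\<exists>!f. (\<forall>i. f i \<in> gr (regular G) i) \<and> finite {i. f i \<noteq> 0} \<and> x = (\<Sum>i\<in>{i. f i \<noteq> 0}. f i)"
proof -
  from direct_sum[of x] obtain f
    where f: "(\<forall>i. f i \<in> G i) \<and> finite {i. f i \<noteq> 0} \<and> x = (\<Sum>i | f i \<noteq> 0. f i)"
      and uniq: "\<forall>f'. (\<forall>i. f' i \<in> G i) \<and> finite {i. f' i \<noteq> 0} \<and> x = (\<Sum>i | f' i \<noteq> 0. f' i) \<longrightarrow> f' = f"
    by (rule ex1E)
  let ?f = "\<lambda>k. if k \<ge> 0 then f (nat k) else 0"
  have eq: "{k. ?f k \<noteq> 0} = int ` {i. f i \<noteq> 0}"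
  proof (intro equalityI subsetI)
    fix k assume "k \<in> {k. ?f k \<noteq> 0}"
    then have "k = int (nat k)" "nat k \<in> {i. f i \<noteq> 0}" by (auto split: if_splits)
    then show "k \<in> int ` {i. f i \<noteq> 0}" by (rule image_eqI)
  qed auto
  show ?thesis
  proof (rule ex1I[of _ ?f])
    show "(\<forall>i. ?f i \<in> gr (regular G) i) \<and> finite {i. ?f i \<noteq> 0} \<and> x = (\<Sum>i\<in>{i. ?f i \<noteq> 0}. ?f i)"
      unfolding eq using f by (simp add: gr_regular sum.reindex)
    fix g assume g: "(\<forall>i. g i \<in> gr (regular G) i) \<and> finite {i. g i \<noteq> 0} \<and> x = (\<Sum>i\<in>{i. g i \<noteq> 0}. g i)"
    have neg: "g k = 0" if "k < 0" for k
      using g that by (auto simp: gr_regular dest!: spec[of _ k])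
    have eq: "{k. g k \<noteq> 0} = int ` {i. g (int i) \<noteq> 0}"
    proof (intro equalityI subsetI)
      fix k assume "k \<in> {k. g k \<noteq> 0}"
      then have "k = int (nat k)" "nat k \<in> {i. g (int i) \<noteq> 0}" using neg[of k] by (cases "k < 0"; auto)+
      then show "k \<in> int ` {i. g (int i) \<noteq> 0}" by (rule image_eqI)
    qed auto
    have "finite {i. g (int i) \<noteq> 0}"
      using g unfolding eq by (metis finite_imageD inj_on_of_nat)
    moreover have "x = (\<Sum>i | g (int i) \<noteq> 0. g (int i))"
      using g unfolding eq by (simp add: sum.reindex)
    moreover have "g (int i) \<in> G i" for i
    proof -
      have "g (int i) \<in> gr (regular G) (int i)" using g by blast
      then show ?thesis by (simp add: gr_regular)
    qed
    ultimately have "(\<lambda>i. g (int i)) = f" using uniq[rule_format, of "\<lambda>i. g (int i)"] by blast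
    then have "f i = g (int i)" for i by metis
    then show "g = ?f" using neg by (intro ext) (simp add: not_le)
  qed
qed

lemma graded_module_regular: "graded_module G (regular G)"
proof (intro graded_module.intro graded_module_axioms.intro abelian_group_regular)
  interpret abelian_group "regular G" by (rule abelian_group_regular)
  fix i
  have "subspace (gr (regular G) i)"
    unfolding gr_regular using subspace_component subspace_single_0 by auto
  moreover have "\<ominus>\<^bsub>regular G\<^esub> x = - x" for x by (rule minus_equality) auto
  ultimately show "additive_subgroup (gr (regular G) i) (regular G)"
    using subspace_0[of "gr (regular G) i"]
    by (intro additive_subgroupI, intro add.subgroupI) (auto simp: subspace_add subspace_neg)
next
  fix a n x i assume "a \<in> G n" "x \<in> gr (regular G) i"
  then show "a \<odot>\<^bsub>regular G\<^esub> x \<in> gr (regular G) (int n + i)"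
    using mult_component[of a n x "nat i"] 
    by (auto simp: gr_regular nat_add_distrib subspace_0[OF subspace_component] split: if_splits)
qed (use regular_direct_sum in \<open>auto simp: algebra_simps\<close>)

sublocale A: graded_module G "regular G"
  rewrites "carrier (regular G) = UNIV" and "add (regular G) = (+)" and "zero (regular G) = 0"
    and "smult (regular G) = (*)"
  by (rule graded_module_regular) simp_all

lemma component_sum: "A.component k (sum f B) = (\<Sum>i\<in>B. A.component k (f i))"
  using A.component_finsum[of f B k] by simp

lemma component_neg: "k < 0 \<Longrightarrow> A.component k x = 0"
  using A.component_props(1)[of x k] by (simp add: gr_regular)

lemma component_diff: "A.component k (x - y) = A.component k x - A.component k y"
  using A.component_add[of "x - y" y k] by simp

lemma component_sum_eq: "(\<Sum>i | A.component i x \<noteq> 0. A.component i x) = x"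
  using A.component_props(3)[of x] by simp

lemma finite_component_support: "finite {i. A.component i x \<noteq> 0}"
  using A.component_props(2)[of x] by simp

lemma smult_gr_regular:
  assumes "graded_module G M" "a \<in> gr (regular G) l" "x \<in> gr M i"
  shows "a \<odot>\<^bsub>M\<^esub> x \<in> gr M (l + i)"
proof -
  interpret M: graded_module G M by fact
  show ?thesis
    using assms M.smult_gr[of a "nat l" x i] M.zero_smult[OF M.gr_carrier[OF assms(3)]] M.zero_gr
    by (auto simp: gr_regular split: if_splits)
qed

lemma component_smult:
  assumes "graded_module G M" "x \<in> gr M i"
  shows "graded_module.component M k (a \<odot>\<^bsub>M\<^esub> x) = A.component (k - i) a \<odot>\<^bsub>M\<^esub> x"
proof -
  interpret M: graded_module G M by fact
  have x: "x \<in> carrier M" using assms M.gr_carrier by blast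
  let ?h = "\<lambda>a. M.component k (a \<odot>\<^bsub>M\<^esub> x)"
  \<comment> \<open>The index \<open>k - i\<close> is inserted so that the one surviving summand is
    present even if that component of \<open>a\<close> is zero.\<close>
  let ?S = "insert (k - i) {l. A.component l a \<noteq> 0}"
  have S: "finite ?S" using finite_component_support by simp
  have "a = finsum (regular G) (\<lambda>l. A.component l a) ?S"
    using A.component_sum_superset[of a ?S, OF UNIV_I S subset_insertI] by simp
  then have "?h a = ?h (finsum (regular G) (\<lambda>l. A.component l a) ?S)" by simp
  also have "\<dots> = (\<Oplus>\<^bsub>M\<^esub>l\<in>?S. ?h (A.component l a))"
    by (rule finsum_additive_map)
      (use A.abelian_monoid_axioms M.abelian_monoid_axioms x in
        \<open>auto simp: M.component_carrier M.smult_closed M.smult_l_distr M.component_add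
          M.zero_smult M.component_zero\<close>)
  also have "\<dots> = (\<Oplus>\<^bsub>M\<^esub>l\<in>?S. if l = k - i then A.component (k - i) a \<odot>\<^bsub>M\<^esub> x else \<zero>\<^bsub>M\<^esub>)"
  proof (rule M.finsum_cong')
    fix l
    have "A.component l a \<odot>\<^bsub>M\<^esub> x \<in> gr M (l + i)"
      using smult_gr_regular[OF assms(1) A.component_props(1) assms(2)] by simp
    then show "?h (A.component l a) = (if l = k - i then A.component (k - i) a \<odot>\<^bsub>M\<^esub> x else \<zero>\<^bsub>M\<^esub>)"
      by (auto simp: M.component_gr)
  qed (use x M.smult_closed in auto)
  also have "\<dots> = A.component (k - i) a \<odot>\<^bsub>M\<^esub> x"
    by (rule M.finsum_single) (use S x M.smult_closed in auto)
  finally show ?thesis .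
qed

lemma component_mult_gr: "x \<in> gr (regular G) i \<Longrightarrow> A.component k (a * x) = A.component (k - i) a * x"
  using component_smult[OF graded_module_regular, of x i k a] by simp

lemma component_mult:
  "A.component k (a * x) = (\<Sum>l | A.component l x \<noteq> 0. A.component (k - l) a * A.component l x)"
proof -
  have "A.component k (a * x) = A.component k (\<Sum>l | A.component l x \<noteq> 0. a * A.component l x)"
    by (simp add: sum_distrib_left[symmetric] component_sum_eq)
  also have "\<dots> = (\<Sum>l | A.component l x \<noteq> 0. A.component k (a * A.component l x))"
    by (rule component_sum)
  also have "\<dots> = (\<Sum>l | A.component l x \<noteq> 0. A.component (k - l) a * A.component l x)"
    by (intro sum.cong refl component_mult_gr A.component_props(1)) simp
  finally show ?thesis .
qed

lemma component_one: "A.component k 1 = (if k = 0 then 1 else 0)"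
  using A.component_gr[of 1 0 k] one_component by (simp add: gr_regular)

lemma left_submodule_regular: "left_submodule (regular G) = left_ideal UNIV"
  using A.left_submodule_iff by (auto simp: fun_eq_iff left_ideal_def)

text \<open>Closure under homogeneous components is easier to verify than the generation by
  homogeneous elements in \<open>graded_submodule\<close>; \<open>graded_submodule_regular\<close>
  shows that the two conditions agree.\<close>

definition graded_left_ideal :: "'a set \<Rightarrow> bool" where
  "graded_left_ideal N \<longleftrightarrow> left_ideal UNIV N \<and> (\<forall>x\<in>N. \<forall>k. A.component k x \<in> N)"

lemma left_idealD:
  assumes "left_ideal UNIV N"
  shows "0 \<in> N" "x \<in> N \<Longrightarrow> y \<in> N \<Longrightarrow> x + y \<in> N" "x \<in> N \<Longrightarrow> a * x \<in> N"
    "x \<in> N \<Longrightarrow> y \<in> N \<Longrightarrow> x - y \<in> N"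
proof -
  show "0 \<in> N" "x \<in> N \<Longrightarrow> y \<in> N \<Longrightarrow> x + y \<in> N" "x \<in> N \<Longrightarrow> a * x \<in> N"
    using assms unfolding left_ideal_def by auto
  assume "x \<in> N" "y \<in> N"
  then have "x + - 1 * y \<in> N" using assms unfolding left_ideal_def by blast
  then show "x - y \<in> N" by simp
qed

lemma left_ideal_sum: "left_ideal UNIV N \<Longrightarrow> (\<And>i. i \<in> B \<Longrightarrow> f i \<in> N) \<Longrightarrow> sum f B \<in> N"
  by (induction B rule: infinite_finite_induct) (auto intro: left_idealD)

lemma graded_left_idealD:
  assumes "graded_left_ideal N"
  shows "left_ideal UNIV N" "x \<in> N \<Longrightarrow> A.component k x \<in> N"
  using assms unfolding graded_left_ideal_def by auto

lemma graded_submodule_regular: "graded_submodule (regular G) N \<longleftrightarrow> graded_left_ideal N"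
proof
  assume N: "graded_submodule (regular G) N"
  then have lN: "left_ideal UNIV N" and hull: "left_ideal UNIV hull (N \<inter> (\<Union>i. gr (regular G) i)) = N"
    unfolding graded_submodule_def left_submodule_regular by auto
  \<comment> \<open>By \<open>component_mult\<close> each component of \<open>a * x\<close> is a
    left combination of components of \<open>x\<close>, so \<open>?T\<close> is a left ideal. It
    contains the homogeneous elements of \<open>N\<close>, hence their hull.\<close>
  let ?T = "{x. \<forall>k. A.component k x \<in> N}"
  have "left_ideal UNIV ?T"
    unfolding left_ideal_def
    using left_idealD[OF lN]
    by (auto simp: A.component_zero A.component_add component_mult intro!: left_ideal_sum[OF lN])
  moreover have "N \<inter> (\<Union>i. gr (regular G) i) \<subseteq> ?T"
    using left_idealD(1)[OF lN] by (auto simp: A.component_gr)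
  ultimately have "N \<subseteq> ?T" using hull_minimal hull by metis
  then show "graded_left_ideal N" using lN unfolding graded_left_ideal_def by auto
next
  assume N: "graded_left_ideal N"
  note lN = graded_left_idealD(1)[OF N]
  have "N \<subseteq> T" if T: "N \<inter> (\<Union>i. gr (regular G) i) \<subseteq> T" "left_ideal UNIV T" for T
  proof
    fix x assume "x \<in> N"
    then have "A.component k x \<in> T" for k
      using T(1) graded_left_idealD(2)[OF N] A.component_props(1)[of x k] by auto
    then have "(\<Sum>i | A.component i x \<noteq> 0. A.component i x) \<in> T"
      by (intro left_ideal_sum[OF T(2)])
    then show "x \<in> T" by (simp add: component_sum_eq)
  qed
  then have "left_ideal UNIV hull (N \<inter> (\<Union>i. gr (regular G) i)) = N"
    by (intro hull_unique) (use lN in auto)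
  then show "graded_submodule (regular G) N"
    unfolding graded_submodule_def left_submodule_regular using lN by auto
qed

section \<open>Maximal graded left ideals and the radical\<close>

abbreviation maximal_graded_ideal :: "'a set \<Rightarrow> bool" where
  "maximal_graded_ideal \<equiv> maximal_graded_submodule (regular G)"

lemma maximal_graded_ideal_iff:
  "maximal_graded_ideal m \<longleftrightarrow> graded_left_ideal m \<and> m \<noteq> UNIV \<and>
     (\<forall>N. graded_left_ideal N \<and> m \<subseteq> N \<longrightarrow> N = m \<or> N = UNIV)"
  unfolding maximal_graded_submodule_def graded_submodule_regular by simp

lemma left_ideal_one: "left_ideal UNIV N \<Longrightarrow> 1 \<in> N \<Longrightarrow> N = UNIV"
  using left_idealD(3)[of N 1] by auto

definition degree_ge :: "int \<Rightarrow> 'a set" where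
  "degree_ge m = {a. \<forall>k<m. A.component k a = 0}"

lemma graded_left_ideal_degree_ge: "graded_left_ideal (degree_ge m)"
proof -
  have "A.component k (a * x) = 0" if "x \<in> degree_ge m" "k < m" for a x k
    unfolding component_mult
  proof (rule sum.neutral, rule ballI)
    fix l assume "l \<in> {l. A.component l x \<noteq> 0}"
    then have "k - l < 0" using that unfolding degree_ge_def by auto (meson linorder_not_less order_less_le_trans)
    then show "A.component (k - l) a * A.component l x = 0" by (simp add: component_neg)
  qed
  then have "left_ideal UNIV (degree_ge m)"
    unfolding left_ideal_def by (auto simp: degree_ge_def A.component_zero A.component_add)
  moreover have "A.component l (A.component k x) = (if l = k then A.component k x else 0)" for k l x
    using A.component_gr[OF A.component_props(1)] by simp
  ultimately show ?thesis unfolding graded_left_ideal_def by (auto simp: degree_ge_def)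
qed

lemmas left_ideal_degree_ge = graded_left_idealD(1)[OF graded_left_ideal_degree_ge]

lemma degree_ge_0: "degree_ge 0 = UNIV"
  unfolding degree_ge_def by (auto simp: component_neg)

lemma degree_ge_anti: "m \<le> n \<Longrightarrow> degree_ge n \<subseteq> degree_ge m"
  unfolding degree_ge_def by auto

lemma gr_subset_degree_ge: "m \<le> i \<Longrightarrow> gr (regular G) i \<subseteq> degree_ge m"
  unfolding degree_ge_def by (auto simp: A.component_gr)

lemma gr_degree_ge_disjoint: "x \<in> gr (regular G) i \<Longrightarrow> i < m \<Longrightarrow> x \<in> degree_ge m \<Longrightarrow> x = 0"
  unfolding degree_ge_def using A.component_gr[of x i i] by auto

lemma diff_component_degree_ge:
  "x \<in> degree_ge d \<Longrightarrow> x - A.component d x \<in> degree_ge (d + 1)"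
  unfolding degree_ge_def
  by (auto simp: component_diff A.component_gr[OF A.component_props(1)] less_le)

lemma graded_left_ideal_add:
  assumes "graded_left_ideal M" "graded_left_ideal N"
  shows "graded_left_ideal {x + y | x y. x \<in> M \<and> y \<in> N}"
proof -
  note D = left_idealD[OF graded_left_idealD(1)[OF assms(1)]] left_idealD[OF graded_left_idealD(1)[OF assms(2)]]
  have "left_ideal UNIV {x + y | x y. x \<in> M \<and> y \<in> N}" (is "left_ideal _ ?S")
    unfolding left_ideal_def
  proof (intro conjI ballI)
    show "0 \<in> ?S" using D(1,5) by (auto intro!: exI[of _ 0])
    fix u v a assume u: "u \<in> ?S" and v: "v \<in> ?S"
    then obtain x y x' y' where "x \<in> M" "y \<in> N" "u = x + y" "x' \<in> M" "y' \<in> N" "v = x' + y'"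
      by auto
    then have "u + v = (x + x') + (y + y')" "x + x' \<in> M" "y + y' \<in> N" using D by auto
    then show "u + v \<in> ?S" by blast
  next
    fix u a assume "u \<in> ?S"
    then show "a * u \<in> ?S" using D(3,7) by (auto simp: distrib_left) blast
  qed auto
  then show ?thesis
    unfolding graded_left_ideal_def
    using graded_left_idealD(2)[OF assms(1)] graded_left_idealD(2)[OF assms(2)]
    by (auto simp: A.component_add) blast
qed

lemma graded_left_ideal_principal:
  assumes "y \<in> gr (regular G) d" shows "graded_left_ideal {a * y | a. True}"
proof -
  have "left_ideal UNIV {a * y | a. True}" (is "left_ideal _ ?I")
    unfolding left_ideal_def
  proof (intro conjI ballI)
    show "0 \<in> ?I" by (auto intro: exI[of _ 0])
    fix u v assume "u \<in> ?I" "v \<in> ?I"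
    then show "u + v \<in> ?I" by (auto simp: distrib_right[symmetric])
  next
    fix a u assume "u \<in> ?I"
    then show "a * u \<in> ?I" by (auto simp: mult.assoc[symmetric])
  qed auto
  then show ?thesis
    unfolding graded_left_ideal_def using component_mult_gr[OF assms] by auto
qed

lemma maximal_comaximal:
  assumes "maximal_graded_ideal m" "graded_left_ideal I" "\<not> I \<subseteq> m"
  obtains y z where "y \<in> I" "z \<in> m" "y + z = 1"
proof -
  let ?S = "{x + y | x y. x \<in> I \<and> y \<in> m}"
  have m: "graded_left_ideal m" using assms(1) maximal_graded_ideal_iff by blast
  have z: "0 \<in> I" "0 \<in> m" using left_idealD(1) graded_left_idealD(1) assms(2) m by blast+
  have "0 + x \<in> ?S" if "x \<in> m" for x using that z(1) by blast
  then have "m \<subseteq> ?S" by auto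
  moreover have "x + 0 \<in> ?S" if "x \<in> I" for x using that z(2) by blast
  then have "I \<subseteq> ?S" by auto
  ultimately have "?S = UNIV"
    using graded_left_ideal_add[OF assms(2) m] assms(1)[unfolded maximal_graded_ideal_iff] assms(3) by (metis (no_types, lifting))
  then have "1 \<in> ?S" by blast
  then obtain y z where "1 = y + z" "y \<in> I" "z \<in> m" by blast
  then show ?thesis using that[of y z] by simp
qed

text \<open>Otherwise \<open>1 = y + z\<close> with \<open>y\<close> in positive degrees and
  \<open>z\<close> in \<open>m\<close>. Then the degree 0 component of \<open>z\<close> is 1, and it
  lies in \<open>m\<close> because \<open>m\<close> is graded.\<close>

lemma degree_ge_1_subset_maximal:
  assumes "maximal_graded_ideal m" shows "degree_ge 1 \<subseteq> m"
proof (rule ccontr)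
  assume "\<not> degree_ge 1 \<subseteq> m"
  then obtain y z where yz: "y \<in> degree_ge 1" "z \<in> m" "y + z = 1"
    using maximal_comaximal[OF assms graded_left_ideal_degree_ge] by blast
  have m: "graded_left_ideal m" "m \<noteq> UNIV" using assms maximal_graded_ideal_iff by blast+
  have "1 = A.component 0 y + A.component 0 z"
    using component_one[of 0] yz(3) A.component_add[of y z 0] by simp
  also have "A.component 0 y = 0" using yz(1) unfolding degree_ge_def by simp
  finally have "1 \<in> m" using graded_left_idealD(2)[OF m(1) yz(2), of 0] by simp
  then show False using left_ideal_one graded_left_idealD(1) m by blast
qed

lemma graded_jacobson_eq: "graded_jacobson G = \<Inter>{m. maximal_graded_ideal m}"
  unfolding graded_jacobson_def ..

lemma graded_left_ideal_jacobson: "graded_left_ideal (graded_jacobson G)"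
proof -
  have "graded_left_ideal m" if "maximal_graded_ideal m" for m
    using that maximal_graded_ideal_iff by blast
  then show ?thesis
    unfolding graded_jacobson_eq graded_left_ideal_def left_ideal_def by auto
qed

lemma degree_ge_1_subset_jacobson: "degree_ge 1 \<subseteq> graded_jacobson G"
  unfolding graded_jacobson_eq using degree_ge_1_subset_maximal by blast

lemma left_ideal_subspace:
  assumes "left_ideal UNIV N" shows "subspace N"
proof -
  have "scale c x = scale c 1 * x" for c x by (simp add: scale_mult_left)
  then show ?thesis using left_idealD[OF assms] unfolding subspace_def by metis
qed

text \<open>A graded left ideal \<open>K\<close> that is minimal in degree 0 among those not contained in \<open>m\<close> satisfies
  \<open>K \<inter> m \<subseteq> J\<close>, so \<open>A/m\<close> is a direct summand of \<open>A/J\<close>; the idempotent endomorphism of \<open>A/J\<close> is right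
  multiplication by \<open>e\<close>.\<close>

lemma maximal_complement:
  assumes "maximal_graded_ideal m"
  obtains e where "e \<in> G 0" "1 - e \<in> m" "\<And>a. a \<in> m \<Longrightarrow> a * e \<in> graded_jacobson G"
proof -
  have m: "graded_left_ideal m" "m \<noteq> UNIV" using assms maximal_graded_ideal_iff by blast+
  let ?P = "\<lambda>K. graded_left_ideal K \<and> \<not> K \<subseteq> m"
  have "?P UNIV" using m(2) graded_left_ideal_degree_ge[of 0] by (auto simp: degree_ge_0)
  then obtain K where K: "?P K" and min: "\<And>K'. ?P K' \<Longrightarrow> dim (K \<inter> G 0) \<le> dim (K' \<inter> G 0)"
    using ex_has_least_nat[of ?P UNIV "\<lambda>K. dim (K \<inter> G 0)"] by blast
  note lK = left_idealD[OF graded_left_idealD(1)[OF conjunct1[OF K]]]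
  note lm = left_idealD[OF graded_left_idealD(1)[OF m(1)]]
  obtain B where B: "finite B" "G 0 = span B" using locally_finite by blast
  \<comment> \<open>This puts \<open>K \<inter> m\<close> into every maximal \<open>m'\<close>. If
    \<open>K \<inter> m' \<subseteq> m\<close> and \<open>u + z = 1\<close> with \<open>u\<close> in
    \<open>K \<inter> m\<close> and \<open>z\<close> in \<open>m'\<close>, then
    \<open>k = k * u + k * z\<close> would place all of \<open>K\<close> in \<open>m\<close>. If
    not, \<open>K \<inter> m'\<close> competes with \<open>K\<close>; minimality makes them agree in
    degree 0, and \<open>m'\<close> contains all higher degrees anyway.\<close>
  have sub: "y \<in> m'" if m': "maximal_graded_ideal m'" and y: "y \<in> K" "y \<in> m" for m' y
  proof (cases "K \<inter> m' \<subseteq> m")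
    case True
    have gm': "graded_left_ideal m'" using m' maximal_graded_ideal_iff by blast
    have gKm: "graded_left_ideal (K \<inter> m)"
      using K m(1) unfolding graded_left_ideal_def left_ideal_def by auto
    have "K \<inter> m \<subseteq> m'"
    proof (rule ccontr)
      assume "\<not> K \<inter> m \<subseteq> m'"
      then obtain u z where uz: "u \<in> K \<inter> m" "z \<in> m'" "u + z = 1"
        by (rule maximal_comaximal[OF m' gKm])
      have "k \<in> m" if k: "k \<in> K" for k
      proof -
        have split: "k = k * u + k * z" using uz(3) by (metis distrib_left mult.right_neutral)
        then have "k * z = k - k * u" by (metis add_diff_cancel_left')
        then have "k * z \<in> K" using lK k uz by auto
        moreover have "k * z \<in> m'" using left_idealD(3)[OF graded_left_idealD(1)[OF gm'] uz(2)] .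
        ultimately have "k * z \<in> m" using True by blast
        moreover have "k * u \<in> m" using lm uz by blast
        ultimately show "k \<in> m" using split lm(2) by metis
      qed
      then show False using K by blast
    qed
    then show ?thesis using y by blast
  next
    case False
    have gm': "graded_left_ideal m'" using m' maximal_graded_ideal_iff by blast
    have gKm: "graded_left_ideal (K \<inter> m')"
      using K gm' unfolding graded_left_ideal_def left_ideal_def by auto
    have le: "dim (K \<inter> G 0) \<le> dim (K \<inter> m' \<inter> G 0)" using min[of "K \<inter> m'"] gKm False by blast
    have "K \<inter> m' \<inter> G 0 = K \<inter> G 0"
    proof (rule ccontr)
      assume "K \<inter> m' \<inter> G 0 \<noteq> K \<inter> G 0"
      then have "K \<inter> m' \<inter> G 0 \<subset> K \<inter> G 0" by blast
      moreover have "subspace (K \<inter> m' \<inter> G 0)"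
        using left_ideal_subspace graded_left_idealD(1)[OF gKm] subspace_component subspace_inter by blast
      ultimately show False using dim_strict_mono[of "K \<inter> m' \<inter> G 0" "K \<inter> G 0" B] le B by auto
    qed
    moreover have "A.component 0 y \<in> G 0" using A.component_props(1)[of y 0] by (simp add: gr_regular)
    moreover have "A.component 0 y \<in> K" using K graded_left_idealD(2) y by blast
    ultimately have "A.component 0 y \<in> m'" by blast
    moreover have "y - A.component 0 y \<in> m'"
      using diff_component_degree_ge[of y 0] degree_ge_0 degree_ge_1_subset_maximal[OF m'] by auto
    ultimately show ?thesis
      using left_idealD(2)[OF graded_left_idealD(1)[OF gm']] by (metis diff_add_cancel)
  qed
  obtain y z where yz: "y \<in> K" "z \<in> m" "y + z = 1"
    using maximal_comaximal[OF assms] K by blast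
  show ?thesis
  \<comment> \<open>The degree 0 part is taken so that right multiplication by it preserves degrees.
    For \<open>a\<close> in \<open>m\<close> the product \<open>a * e = a - a * (1 - e)\<close> lies
    in \<open>K \<inter> m\<close>, hence in the radical.\<close>
  proof (rule that[of "A.component 0 y"])
    show "A.component 0 y \<in> G 0" using A.component_props(1)[of y 0] by (simp add: gr_regular)
    have yK: "A.component 0 y \<in> K" using K graded_left_idealD(2) yz by blast
    have "1 = A.component 0 y + A.component 0 z"
      using component_one[of 0] yz(3) A.component_add[of y z 0] by simp
    then have eq: "1 - A.component 0 y = A.component 0 z" by (simp add: diff_eq_eq add.commute)
    then show ym: "1 - A.component 0 y \<in> m" using graded_left_idealD(2)[OF m(1) yz(2)] by simp
    fix a assume a: "a \<in> m"
    have "a * A.component 0 y = a - a * (1 - A.component 0 y)" by (simp add: algebra_simps)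
    then have "a * A.component 0 y \<in> m" using lm(3)[OF ym] lm(4)[OF a] by simp
    then show "a * A.component 0 y \<in> graded_jacobson G"
      unfolding graded_jacobson_eq using sub lK(3)[OF yK] by blast
  qed
qed

text \<open>Zorn's lemma applies because properness, written as \<open>1 \<notin> I\<close>, passes
  to unions of chains.\<close>

lemma maximal_graded_ideal_exists:
  assumes "graded_left_ideal N" "1 \<notin> N"
  obtains m where "maximal_graded_ideal m" "N \<subseteq> m"
proof -
  let ?S = "{I. graded_left_ideal I \<and> N \<subseteq> I \<and> 1 \<notin> I}"
  have "\<exists>m\<in>?S. \<forall>I\<in>?S. m \<subseteq> I \<longrightarrow> I = m"
  proof (rule subset_Zorn_nonempty)
    show "?S \<noteq> {}" using assms by blast
    fix C assume C: "C \<noteq> {}" "subset.chain ?S C"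
    then have CS: "C \<subseteq> ?S" unfolding subset_chain_def by blast
    have "left_ideal UNIV (\<Union>C)"
      unfolding left_ideal_def
    proof (intro conjI ballI)
      show "0 \<in> \<Union>C" using C(1) CS left_idealD(1) graded_left_idealD(1) by blast
      fix x y assume "x \<in> \<Union>C" "y \<in> \<Union>C"
      then obtain I I' where "I \<in> C" "I' \<in> C" "x \<in> I" "y \<in> I'" by blast
      moreover from this have "I \<subseteq> I' \<or> I' \<subseteq> I" using C(2) unfolding subset_chain_def by blast
      ultimately obtain I where I: "I \<in> C" "x \<in> I" "y \<in> I" by blast
      then have "left_ideal UNIV I" using CS graded_left_idealD(1) by auto
      then have "x + y \<in> I" using I(2,3) by (rule left_idealD(2))
      then show "x + y \<in> \<Union>C" using I(1) by (rule UnionI[rotated])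
    next
      fix a x assume "x \<in> \<Union>C"
      then obtain I where I: "I \<in> C" "x \<in> I" by blast
      then have "left_ideal UNIV I" using CS graded_left_idealD(1) by auto
      then have "a * x \<in> I" using I(2) by (rule left_idealD(3))
      then show "a * x \<in> \<Union>C" using I(1) by (rule UnionI[rotated])
    qed auto
    then have "graded_left_ideal (\<Union>C)"
      unfolding graded_left_ideal_def using CS by (auto dest: graded_left_idealD(2))
    moreover have "N \<subseteq> \<Union>C"
    proof -
      obtain I where "I \<in> C" using C(1) by (rule ex_in_conv[THEN iffD2, THEN exE])
      moreover from this have "N \<subseteq> I" using CS by auto
      ultimately show ?thesis by blast
    qed
    moreover have "1 \<notin> \<Union>C" using CS by auto
    ultimately show "\<Union>C \<in> ?S" by simp
  qed
  then obtain m where m: "m \<in> ?S" and max: "\<forall>I\<in>?S. m \<subseteq> I \<longrightarrow> I = m" by (rule bexE)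
  have gm: "graded_left_ideal m" "N \<subseteq> m" "1 \<notin> m" using m by auto
  have "I = m \<or> I = UNIV" if I: "graded_left_ideal I" "m \<subseteq> I" for I
  proof (cases "1 \<in> I")
    case True
    then show ?thesis using left_ideal_one[OF graded_left_idealD(1)[OF I(1)]] by simp
  next
    case False
    then show ?thesis using bspec[OF max, of I] I gm(2) by simp
  qed
  then have "maximal_graded_ideal m"
    unfolding maximal_graded_ideal_iff using gm by auto
  then show ?thesis using that gm(2) by simp
qed

text \<open>A Nakayama argument in degree 0. Let \<open>L\<close> be a complement of
  \<open>J \<inter> A\<^sub>0\<close> in \<open>A\<^sub>0\<close> and \<open>1 = x + y\<close>
  accordingly. A maximal ideal containing \<open>y\<close> would also contain \<open>x\<close>,
  hence 1. So \<open>A y\<close> and the positive degrees together generate \<open>A\<close>, and in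
  degree 0 this says that 1 is a multiple of \<open>y\<close>. Thus \<open>L\<close> is all of
  \<open>A\<^sub>0\<close>, and \<open>J \<inter> A\<^sub>0\<close> is zero.\<close>

lemma jacobson_semisimple:
  assumes "semisimple (G 0)" shows "graded_jacobson G = degree_ge 1"
proof
  show "degree_ge 1 \<subseteq> graded_jacobson G" by (rule degree_ge_1_subset_jacobson)
  let ?J = "graded_jacobson G \<inter> G 0"
  note J = graded_left_idealD[OF graded_left_ideal_jacobson]
  have G0: "x * y \<in> G 0" if "x \<in> G 0" "y \<in> G 0" for x y using mult_component[OF that] by simp
  have "left_ideal (G 0) ?J"
    unfolding left_ideal_def
    using left_idealD[OF J(1)] G0 subspace_0[OF subspace_component] subspace_add[OF subspace_component]
    by auto
  from assms[unfolded semisimple_def, rule_format, OF this] obtain L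
    where L: "left_ideal (G 0) L" "?J \<inter> L = {0}" "{x + y | x y. x \<in> ?J \<and> y \<in> L} = G 0"
    by (elim exE conjE)
  have "1 \<in> {x + y | x y. x \<in> ?J \<and> y \<in> L}" unfolding L(3) by (rule one_component)
  then obtain x y where xy: "x \<in> ?J" "y \<in> L" "1 = x + y" by auto
  have y0: "y \<in> G 0" using L(1) xy unfolding left_ideal_def by blast
  then have yr: "y \<in> gr (regular G) 0" by (simp add: gr_regular)
  let ?Ay = "{a * y | a. True}"
  have gAy: "graded_left_ideal ?Ay" by (rule graded_left_ideal_principal[OF yr])
  let ?N = "{u + v | u v. u \<in> ?Ay \<and> v \<in> degree_ge 1}"
  have gN: "graded_left_ideal ?N" by (rule graded_left_ideal_add[OF gAy graded_left_ideal_degree_ge])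
  have "1 \<in> ?N"
  proof (rule ccontr)
    assume "1 \<notin> ?N"
    then obtain m where m: "maximal_graded_ideal m" "?N \<subseteq> m"
      by (rule maximal_graded_ideal_exists[OF gN])
    have "y = 1 * y + 0" by simp
    then have "y \<in> ?N"
      using left_idealD(1)[OF left_ideal_degree_ge[of 1]] by blast
    then have "y \<in> m" using m(2) by (rule subsetD[rotated])
    moreover have "x \<in> m" using xy(1) m(1) unfolding graded_jacobson_eq by simp
    moreover have gm: "left_ideal UNIV m" "m \<noteq> UNIV"
      using m(1)[unfolded maximal_graded_ideal_iff] graded_left_idealD(1) by simp_all
    ultimately have "1 \<in> m" unfolding xy(3) by (intro left_idealD(2)[OF gm(1)])
    then show False using left_ideal_one[OF gm(1)] gm(2) by simp
  qed
  then obtain a z where "1 = a * y + z" "z \<in> degree_ge 1" by auto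
  then have one: "1 = A.component 0 a * y"
    using component_one[of 0] A.component_add[of "a * y" z 0] component_mult_gr[OF yr, of 0 a]
    by (simp add: degree_ge_def)
  moreover have a0: "A.component 0 a \<in> G 0" using A.component_props(1)[of a 0] by (simp add: gr_regular)
  ultimately have "A.component 0 a * y \<in> L" using L(1) xy(2) unfolding left_ideal_def by blast
  then have "1 \<in> L" by (simp add: one[symmetric])
  then have "z * 1 \<in> L" if "z \<in> G 0" for z
    using L(1) that unfolding left_ideal_def by blast
  then have J0: "z = 0" if "z \<in> ?J" for z using L(2) that by auto
  show "graded_jacobson G \<subseteq> degree_ge 1"
  proof
    fix z assume "z \<in> graded_jacobson G"
    then have "A.component 0 z \<in> ?J"
      using J(2) A.component_props(1)[of z 0] by (simp add: gr_regular)
    then have "A.component 0 z = 0" using J0 by blast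
    moreover have "k < 0 \<or> k = 0" if "k < 1" for k :: int using that by linarith
    ultimately show "z \<in> degree_ge 1"
      unfolding degree_ge_def using component_neg by fastforce
  qed
qed

end

section \<open>Homomorphisms and vanishing of Ext\<close>

lemma gr_hom_shift_regular_iff:
  "f \<in> gr_hom P (shift (regular G) j) \<longleftrightarrow>
     (\<forall>x\<in>carrier P. \<forall>y\<in>carrier P. f (x \<oplus>\<^bsub>P\<^esub> y) = f x + f y) \<and>
     (\<forall>a. \<forall>x\<in>carrier P. f (a \<odot>\<^bsub>P\<^esub> x) = a * f x) \<and>
     (\<forall>i. \<forall>x\<in>gr P i. f x \<in> gr (regular G) (i + j))"
  by (auto simp: gr_hom_def shift_def image_subset_iff)

lemma gr_homD:
  assumes "f \<in> gr_hom M N"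
  shows "x \<in> carrier M \<Longrightarrow> f x \<in> carrier N"
    "x \<in> carrier M \<Longrightarrow> y \<in> carrier M \<Longrightarrow> f (x \<oplus>\<^bsub>M\<^esub> y) = f x \<oplus>\<^bsub>N\<^esub> f y"
    "x \<in> carrier M \<Longrightarrow> f (a \<odot>\<^bsub>M\<^esub> x) = a \<odot>\<^bsub>N\<^esub> f x"
    "x \<in> gr M i \<Longrightarrow> f x \<in> gr N i"
  using assms unfolding gr_hom_def by (auto simp: image_subset_iff)

lemma gr_hom_zero:
  assumes "graded_module G M" "graded_module G' N" "f \<in> gr_hom M N"
  shows "f \<zero>\<^bsub>M\<^esub> = \<zero>\<^bsub>N\<^esub>"
proof (rule abelian_group_zero_map)
  interpret M: graded_module G M by fact
  interpret N: graded_module G' N by fact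
  show "abelian_group M" "abelian_group N"
    by (rule M.abelian_group_axioms, rule N.abelian_group_axioms)
qed (use gr_homD[OF assms(3)] in auto)

lemma gr_hom_finsum:
  assumes "graded_module G M" "graded_module G' N" "f \<in> gr_hom M N" "x \<in> A \<rightarrow> carrier M"
  shows "f (finsum M x A) = finsum N (\<lambda>i. f (x i)) A"
proof (rule finsum_additive_map)
  interpret M: graded_module G M by fact
  interpret N: graded_module G' N by fact
  show "abelian_monoid M" "abelian_monoid N"
    by (rule M.abelian_monoid_axioms, rule N.abelian_monoid_axioms)
qed (use gr_homD[OF assms(3)] gr_hom_zero[OF assms(1,2,3)] assms(4) in auto)

lemma gr_hom_eq_on_homogeneous:
  assumes "graded_module G M" "graded_module G' N" "f \<in> gr_hom M N" "g \<in> gr_hom M N"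
    and "\<And>i x. x \<in> gr M i \<Longrightarrow> f x = g x" and "x \<in> carrier M"
  shows "f x = g x"
proof -
  interpret M: graded_module G M by fact
  let ?S = "{i. M.component i x \<noteq> \<zero>\<^bsub>M\<^esub>}"
  have c: "(\<lambda>i. M.component i x) \<in> ?S \<rightarrow> carrier M" using M.component_carrier assms(6) by auto
  have "f (M.component i x) = g (M.component i x)" for i
    by (rule assms(5), rule M.component_props(1), rule assms(6))
  then have "f (finsum M (\<lambda>i. M.component i x) ?S) = g (finsum M (\<lambda>i. M.component i x) ?S)"
    using gr_hom_finsum[OF assms(1,2,3) c] gr_hom_finsum[OF assms(1,2,4) c] by simp
  then show ?thesis using M.component_props(3)[OF assms(6)] by simp
qed

lemma gr_hom_comp:
  assumes "f \<in> gr_hom L M" "g \<in> gr_hom M N" shows "(\<lambda>x. g (f x)) \<in> gr_hom L N"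
  using gr_homD[OF assms(1)] gr_homD[OF assms(2)]
  unfolding gr_hom_def by (simp add: image_subset_iff)

lemma gr_hom_restrict:
  assumes "graded_module G L" "f \<in> gr_hom L M"
  shows "restrict f (carrier L) \<in> gr_hom L M"
proof -
  interpret L: graded_module G L by fact
  show ?thesis
    using assms(2) L.gr_carrier unfolding gr_hom_def by (auto simp: image_subset_iff L.smult_closed)
qed

lemma gr_hom_component:
  assumes "graded_module G M" "graded_module G' N" "f \<in> gr_hom M N" "x \<in> carrier M"
  shows "graded_module.component N k (f x) = f (graded_module.component M k x)"
proof -
  interpret M: graded_module G M by fact
  interpret N: graded_module G' N by fact
  let ?S = "insert k {i. M.component i x \<noteq> \<zero>\<^bsub>M\<^esub>}"
  have S: "finite ?S" using M.component_props(2)[OF assms(4)] by simp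
  have c: "(\<lambda>i. M.component i x) \<in> ?S \<rightarrow> carrier M" using M.component_carrier[OF assms(4)] by auto
  have fg: "f (M.component i x) \<in> gr N i" for i
    by (rule gr_homD(4)[OF assms(3) M.component_props(1)[OF assms(4)]])
  have "f x = f (\<Oplus>\<^bsub>M\<^esub>i\<in>?S. M.component i x)"
    using M.component_sum_superset[OF assms(4) S subset_insertI] by simp
  also have "\<dots> = (\<Oplus>\<^bsub>N\<^esub>i\<in>?S. f (M.component i x))"
    by (rule gr_hom_finsum[OF assms(1-3) c])
  finally have "N.component k (f x) = N.component k (\<Oplus>\<^bsub>N\<^esub>i\<in>?S. f (M.component i x))" by simp
  also have "\<dots> = (\<Oplus>\<^bsub>N\<^esub>i\<in>?S. N.component k (f (M.component i x)))"
    by (rule N.component_finsum) (use N.gr_carrier[OF fg] in auto)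
  also have "\<dots> = (\<Oplus>\<^bsub>N\<^esub>i\<in>?S. if i = k then f (M.component k x) else \<zero>\<^bsub>N\<^esub>)"
    by (rule N.finsum_cong') (use N.gr_carrier[OF fg] N.component_gr[OF fg] in auto)
  also have "\<dots> = f (M.component k x)"
    by (rule N.finsum_single) (use S N.gr_carrier[OF fg] in auto)
  finally show ?thesis .
qed

lemma left_submodule_kernel:
  assumes "graded_module G M" "graded_module G N" "f \<in> gr_hom M N"
  shows "left_submodule M {x \<in> carrier M. f x = \<zero>\<^bsub>N\<^esub>}"
proof -
  interpret M: graded_module G M by fact
  interpret N: graded_module G N by fact
  show ?thesis
    by (rule M.left_submoduleI)
      (use gr_homD(2,3)[OF assms(3)] gr_hom_zero[OF assms] M.smult_closed N.smult_zero in auto)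
qed

lemma left_submodule_image:
  assumes "graded_module G M" "graded_module G N" "f \<in> gr_hom M N" "left_submodule M K"
  shows "left_submodule N (f ` K)"
proof -
  interpret M: graded_module G M by fact
  interpret N: graded_module G N by fact
  note K = M.left_submoduleD[OF assms(4)]
  show ?thesis
  proof (rule N.left_submoduleI)
    show "f ` K \<subseteq> carrier N" using gr_homD(1)[OF assms(3)] K(1) by auto
    show "\<zero>\<^bsub>N\<^esub> \<in> f ` K" using gr_hom_zero[OF assms(1-3)] K(2) by (metis imageI)
    fix a u v assume "u \<in> f ` K"
    then obtain x where x: "x \<in> K" "u = f x" by auto
    have "a \<odot>\<^bsub>N\<^esub> u = f (a \<odot>\<^bsub>M\<^esub> x)" unfolding x(2) using gr_homD(3)[OF assms(3) K(1)[OF x(1)]] by simp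
    then show "a \<odot>\<^bsub>N\<^esub> u \<in> f ` K" using K(4)[OF x(1)] by (rule image_eqI)
    assume "v \<in> f ` K"
    then obtain y where y: "y \<in> K" "v = f y" by auto
    have "u \<oplus>\<^bsub>N\<^esub> v = f (x \<oplus>\<^bsub>M\<^esub> y)"
      unfolding x(2) y(2) using gr_homD(2)[OF assms(3) K(1)[OF x(1)] K(1)[OF y(1)]] by simp
    then show "u \<oplus>\<^bsub>N\<^esub> v \<in> f ` K" using K(3)[OF x(1) y(1)] by (rule image_eqI)
  qed
qed

context graded_module
begin

lemma smult_minus: "x \<in> carrier M \<Longrightarrow> a \<odot> (\<ominus> x) = \<ominus> (a \<odot> x)"
  using smult_assoc[of x a "- 1"] smult_assoc[of x "- 1" a]
  by (simp add: minus_one_smult[symmetric] smult_closed)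

lemma minus_gr: "x \<in> gr M i \<Longrightarrow> \<ominus> x \<in> gr M i"
  using additive_subgroup.a_inv_closed[OF additive_subgroup_gr] .

lemma gr_hom_add:
  assumes "f \<in> gr_hom L M" "g \<in> gr_hom L M" "abelian_group L"
  shows "(\<lambda>x. f x \<oplus> g x) \<in> gr_hom L M"
proof -
  interpret L: abelian_group L by fact
  show ?thesis
    using gr_homD[OF assms(1)] gr_homD[OF assms(2)]
    unfolding gr_hom_def by (auto simp: add_gr smult_r_distr a_ac)
qed

lemma gr_hom_minus:
  assumes "f \<in> gr_hom L M" shows "(\<lambda>x. \<ominus> f x) \<in> gr_hom L M"
  using gr_homD[OF assms]
  unfolding gr_hom_def by (auto simp: minus_gr smult_minus minus_add)

lemma gr_hom_const_zero: "(\<lambda>x. \<zero>) \<in> gr_hom L M"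
  unfolding gr_hom_def by (auto simp: zero_gr smult_zero)

end

text \<open>Names the basis, its degrees and its coordinate functions, which
  \<open>fin_graded_free\<close> hides behind a bijection. Coordinates are prescribed on
  \<open>B\<close> only, since a family \<open>c\<close> may take any values elsewhere.\<close>

locale graded_basis = graded_module G M
  for G :: "nat \<Rightarrow> 'a::{ring,monoid_mult} set" and M :: "('a, 'm) gmod" (structure) +
  fixes B :: "'m set" and deg :: "'m \<Rightarrow> int" and coord :: "'m \<Rightarrow> 'm \<Rightarrow> 'a"
  assumes finite_basis: "finite B"
    and basis_gr: "b \<in> B \<Longrightarrow> b \<in> gr M (deg b)"
    and coord: "x \<in> carrier M \<Longrightarrow> (\<Oplus>b\<in>B. coord x b \<odot> b) = x"
    and coord_unique: "b \<in> B \<Longrightarrow> coord (\<Oplus>b\<in>B. c b \<odot> b) b = c b"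

lemma fin_graded_free_basis:
  fixes M :: "('a::{ring,monoid_mult}, 'm) gmod"
  assumes "graded_module G M" "fin_graded_free M"
  obtains B deg coord where "graded_basis G M B deg coord"
proof -
  interpret graded_module G M by fact
  from assms(2) obtain B where B: "finite B" "B \<subseteq> (\<Union>i. gr M i)"
    and bij: "bij_betw (\<lambda>c. \<Oplus>\<^bsub>M\<^esub>b\<in>B. c b \<odot>\<^bsub>M\<^esub> b) (B \<rightarrow>\<^sub>E UNIV) (carrier M)"
    unfolding fin_graded_free_def by (elim exE conjE)
  let ?S = "\<lambda>c. \<Oplus>\<^bsub>M\<^esub>b\<in>B. c b \<odot>\<^bsub>M\<^esub> b"
  define coord where "coord = the_inv_into (B \<rightarrow>\<^sub>E (UNIV :: 'a set)) ?S"
  \<comment> \<open>A choice is made because over the zero ring a basis vector is 0 and so lies in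
    every component.\<close>
  define deg where "deg b = (SOME i. b \<in> gr M i)" for b
  have gr: "b \<in> gr M (deg b)" if "b \<in> B" for b
    unfolding deg_def using B(2) that by (intro someI_ex[of "\<lambda>i. b \<in> gr M i"]) auto
  have Sc: "?S c \<in> carrier M" for c
    by (intro finsum_closed) (use gr_carrier[OF gr] smult_closed in auto)
  have "?S (coord x) = x" if "x \<in> carrier M" for x
    unfolding coord_def by (rule f_the_inv_into_f_bij_betw[OF bij]) (use that in auto)
  moreover have "coord (?S c) b = c b" if "b \<in> B" for b c
  proof -
    have "?S c = ?S (restrict c B)"
      by (rule finsum_cong') (use gr_carrier[OF gr] smult_closed in auto)
    moreover have "coord (?S (restrict c B)) = restrict c B"
      unfolding coord_def by (rule the_inv_into_f_f) (use bij in \<open>auto simp: bij_betw_def\<close>)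
    ultimately show ?thesis using that by simp
  qed
  ultimately have "graded_basis G M B deg coord"
    by unfold_locales (use B gr in auto)
  then show ?thesis by (rule that)
qed

context graded_basis
begin

lemma basis_carrier: "b \<in> B \<Longrightarrow> b \<in> carrier M"
  using basis_gr gr_carrier by blast

lemma coord_eqI:
  assumes "x = (\<Oplus>b\<in>B. c b \<odot> b)" "b \<in> B" shows "coord x b = c b"
  unfolding assms(1) by (rule coord_unique[OF assms(2)])

lemma finsum_basis_closed: "(\<lambda>b. c b \<odot> b) \<in> B \<rightarrow> carrier M"
  using basis_carrier smult_closed by auto

lemma coord_add:
  assumes "x \<in> carrier M" "y \<in> carrier M" "b \<in> B"
  shows "coord (x \<oplus> y) b = coord x b + coord y b"
proof (rule coord_eqI[OF _ assms(3)])
  have "x \<oplus> y = (\<Oplus>b\<in>B. coord x b \<odot> b) \<oplus> (\<Oplus>b\<in>B. coord y b \<odot> b)"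
    using coord assms by simp
  also have "\<dots> = (\<Oplus>b\<in>B. coord x b \<odot> b \<oplus> coord y b \<odot> b)"
    by (rule finsum_addf[symmetric]) (rule finsum_basis_closed)+
  also have "\<dots> = (\<Oplus>b\<in>B. (coord x b + coord y b) \<odot> b)"
    by (rule finsum_cong') (use basis_carrier smult_closed smult_l_distr in auto)
  finally show "x \<oplus> y = (\<Oplus>b\<in>B. (coord x b + coord y b) \<odot> b)" .
qed

lemma coord_smult:
  assumes "x \<in> carrier M" "b \<in> B" shows "coord (a \<odot> x) b = a * coord x b"
proof (rule coord_eqI[OF _ assms(2)])
  have "a \<odot> x = a \<odot> (\<Oplus>b\<in>B. coord x b \<odot> b)" using coord assms by simp
  also have "\<dots> = (\<Oplus>b\<in>B. a \<odot> (coord x b \<odot> b))"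
    by (rule smult_finsum) (rule finsum_basis_closed)
  also have "\<dots> = (\<Oplus>b\<in>B. (a * coord x b) \<odot> b)"
    by (rule finsum_cong') (use basis_carrier smult_closed smult_assoc in auto)
  finally show "a \<odot> x = (\<Oplus>b\<in>B. (a * coord x b) \<odot> b)" .
qed

lemma coord_basis:
  assumes "b \<in> B" "b' \<in> B" shows "coord b b' = (if b' = b then 1 else 0)"
proof (rule coord_eqI[OF _ assms(2)])
  have "(\<Oplus>b'\<in>B. (if b' = b then 1 else 0) \<odot> b') = (\<Oplus>b'\<in>B. if b' = b then b else \<zero>)"
    by (rule finsum_cong') (use assms basis_carrier smult_one zero_smult in auto)
  also have "\<dots> = b" by (rule finsum_single) (use assms finite_basis basis_carrier in auto)
  finally show "b = (\<Oplus>b'\<in>B. (if b' = b then 1 else 0) \<odot> b')" by simp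
qed

lemma gr_hom_eq_on_basis:
  assumes "graded_module G' N" "f \<in> gr_hom M N" "g \<in> gr_hom M N"
    and "\<And>b. b \<in> B \<Longrightarrow> f b = g b" and "x \<in> carrier M"
  shows "f x = g x"
proof -
  interpret N: graded_module G' N by fact
  have eq: "h x = (\<Oplus>\<^bsub>N\<^esub>b\<in>B. coord x b \<odot>\<^bsub>N\<^esub> h b)" if "h \<in> gr_hom M N" for h
  proof -
    have "h x = h (\<Oplus>b\<in>B. coord x b \<odot> b)" using coord assms(5) by simp
    also have "\<dots> = (\<Oplus>\<^bsub>N\<^esub>b\<in>B. h (coord x b \<odot> b))"
      by (rule gr_hom_finsum[OF graded_module_axioms assms(1) that finsum_basis_closed])
    also have "\<dots> = (\<Oplus>\<^bsub>N\<^esub>b\<in>B. coord x b \<odot>\<^bsub>N\<^esub> h b)"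
      by (rule N.finsum_cong')
        (use gr_homD(1,3)[OF that] basis_carrier N.smult_closed in auto)
    finally show ?thesis .
  qed
  show ?thesis
    unfolding eq[OF assms(2)] eq[OF assms(3)]
    by (rule N.finsum_cong') (use assms(4) gr_homD(1)[OF assms(3)] basis_carrier N.smult_closed in auto)
qed

end

lemma fin_graded_free_fin_gen:
  assumes "graded_module G M" "fin_graded_free M" shows "fin_gen M"
proof -
  obtain B deg coord where "graded_basis G M B deg coord"
    by (rule fin_graded_free_basis[OF assms])
  then interpret graded_basis G M B deg coord .
  have B: "B \<subseteq> carrier M" using basis_carrier by auto
  note sub = left_submodule_hull[OF B]
  have "x \<in> left_submodule M hull B" if "x \<in> carrier M" for x
  proof -
    have "(\<Oplus>\<^bsub>M\<^esub>b\<in>B. coord x b \<odot>\<^bsub>M\<^esub> b) \<in> left_submodule M hull B"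
      by (rule left_submodule_finsum[OF sub]) (use left_submoduleD(4)[OF sub] hull_inc in metis)
    then show ?thesis using coord[OF that] by simp
  qed
  then have "left_submodule M hull B = carrier M" using left_submoduleD(1)[OF sub] by auto
  then show ?thesis unfolding fin_gen_def using B finite_basis by auto
qed

section \<open>Simple layers of \<open>A\<close>, and maps from free modules to
  \<open>A\<close>\<close>

context graded_algebra
begin

lemma gr_regular_mult:
  "a \<in> gr (regular G) l \<Longrightarrow> x \<in> gr (regular G) i \<Longrightarrow> a * x \<in> gr (regular G) (l + i)"
  using smult_gr_regular[OF graded_module_regular] by simp

lemma graded_left_ideal_insert:
  assumes N: "graded_left_ideal N" and y: "y \<in> gr (regular G) d"
  shows "graded_left_ideal {u + a * y | u a. u \<in> N}"
proof -
  have "{u + a * y | u a. u \<in> N} = {u + v | u v. u \<in> N \<and> v \<in> {a * y | a. True}}" by blast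
  then show ?thesis using graded_left_ideal_add[OF N graded_left_ideal_principal[OF y]] by simp
qed

lemma gr_finite_dimensional: obtains B where "finite B" "gr (regular G) d = span B"
  using locally_finite span_empty finite.emptyI unfolding gr_regular by metis

text \<open>The module \<open>(N + A y)/N\<close> lives in degree \<open>d\<close> alone, and the
  minimal choice of \<open>y\<close> makes it simple; the ideal in question is the annihilator of
  its generator. Concretely, for \<open>a\<close> outside the annihilator and in a larger ideal
  \<open>I\<close>, put \<open>c = a\<^sub>0\<close>. The element \<open>c * y\<close> generates the
  same module as \<open>y\<close>, so \<open>y = u + b * c * y\<close> with \<open>u\<close> in
  \<open>N\<close>. Then \<open>1 - b * c\<close> annihilates \<open>y\<close> modulo
  \<open>N\<close>, and \<open>b * c\<close> lies in \<open>I\<close>, which gives 1 in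
  \<open>I\<close>.\<close>

lemma annihilator_maximal:
  assumes N: "graded_left_ideal N" "degree_ge (d + 1) \<subseteq> N"
    and y: "y \<in> gr (regular G) d" "y \<notin> N"
    and min: "\<And>z. z \<in> gr (regular G) d \<Longrightarrow> z \<notin> N \<Longrightarrow>
      dim ({u + a * y | u a. u \<in> N} \<inter> gr (regular G) d) \<le>
      dim ({u + a * z | u a. u \<in> N} \<inter> gr (regular G) d)"
  shows "maximal_graded_ideal {a. a * y \<in> N}"
proof -
  let ?m = "{a. a * y \<in> N}"
  note D = left_idealD[OF graded_left_idealD(1)[OF N(1)]]
  have gm: "graded_left_ideal ?m"
    unfolding graded_left_ideal_def left_ideal_def
    using D(1,2,3) by (auto simp: distrib_right mult.assoc component_mult_gr[OF y(1), of "_ + d", simplified, symmetric]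
        intro: graded_left_idealD(2)[OF N(1)])
  have ne: "?m \<noteq> UNIV"
  proof
    assume "?m = UNIV"
    then have "1 * y \<in> N" by blast
    then show False using y(2) by simp
  qed
  have "I = UNIV" if I: "graded_left_ideal I" "?m \<subseteq> I" "a \<in> I" "a \<notin> ?m" for I a
  proof -
    let ?c = "A.component 0 a"
    let ?z = "?c * y"
    \<comment> \<open>Only the degree 0 part of \<open>a\<close> matters: the rest moves
      \<open>y\<close> into degrees above \<open>d\<close>, which belong to \<open>N\<close>. So
      \<open>?z\<close> is again a homogeneous vector outside \<open>N\<close> and can be compared
      with \<open>y\<close> by \<open>min\<close>.\<close>
    have "a - ?c \<in> degree_ge 1"
      using diff_component_degree_ge[of a 0] degree_ge_0 by simp
    then have "(a - ?c) * y \<in> degree_ge (d + 1)"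
      unfolding degree_ge_def by (auto simp: component_mult_gr[OF y(1)])
    then have acN: "(a - ?c) * y \<in> N" using N(2) by (rule subsetD[rotated])
    have zN: "?z \<notin> N"
    proof
      assume "?z \<in> N"
      then have "?z + (a - ?c) * y \<in> N" using acN by (rule D(2))
      then show False using I(4) by (simp add: algebra_simps)
    qed
    have zg: "?z \<in> gr (regular G) d"
      using gr_regular_mult[OF A.component_props(1) y(1), of a 0] by simp
    let ?Y = "{u + b * y | u b. u \<in> N} \<inter> gr (regular G) d"
    let ?Z = "{u + b * ?z | u b. u \<in> N} \<inter> gr (regular G) d"
    have sub: "?Z \<subseteq> ?Y"
    proof
      fix w assume "w \<in> ?Z"
      then obtain u b where "w = u + (b * ?c) * y" "u \<in> N" "w \<in> gr (regular G) d"
        by (auto simp: mult.assoc)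
      then show "w \<in> ?Y" by blast
    qed
    obtain B where B: "finite B" "gr (regular G) d = span B" by (rule gr_finite_dimensional)
    have sZ: "subspace ?Z"
      using left_ideal_subspace[OF graded_left_idealD(1)[OF graded_left_ideal_insert[OF N(1) zg]]]
        subspace_span[of B] unfolding B(2) by (rule subspace_inter)
    have "?Z = ?Y"
    proof (rule ccontr)
      assume "?Z \<noteq> ?Y"
      with sub have "?Z \<subset> ?Y" by (rule psubsetI)
      then have "dim ?Z < dim ?Y"
        by (rule dim_strict_mono[OF sZ _ _ B(1)]) (simp add: B(2))
      then show False using min[OF zg zN] by simp
    qed
    moreover have "0 + 1 * y \<in> {u + b * y | u b. u \<in> N}" using D(1) by blast
    then have "y \<in> ?Y" using y(1) by simp
    ultimately have "y \<in> ?Z" by simp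
    then obtain u b where ub: "y = u + b * ?z" "u \<in> N" by auto
    have "(1 - b * ?c) * y = y - b * ?z" by (simp add: left_diff_distrib mult.assoc)
    also have "\<dots> = u" by (subst (1) ub(1)) simp
    finally have "1 - b * ?c \<in> ?m" using ub(2) by simp
    then have "1 - b * ?c \<in> I" using I(2) by (rule subsetD[rotated])
    moreover have "b * ?c \<in> I"
      by (intro left_idealD(3) graded_left_idealD I(1,3))
    ultimately have "(1 - b * ?c) + b * ?c \<in> I"
      by (rule left_idealD(2)[OF graded_left_idealD(1)[OF I(1)]])
    then show "I = UNIV" using left_ideal_one[OF graded_left_idealD(1)[OF I(1)]] by simp
  qed
  then have "I = ?m \<or> I = UNIV" if "graded_left_ideal I" "?m \<subseteq> I" for I
    using that by (meson subsetI subset_antisym)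
  then show ?thesis unfolding maximal_graded_ideal_iff using gm ne by simp
qed

lemma hom_in_left_ideal:
  assumes "graded_basis G M B deg coord" "f \<in> gr_hom M (shift (regular G) j)" "left_ideal UNIV N"
    and "\<And>b. b \<in> B \<Longrightarrow> f b \<in> N" and "x \<in> carrier M"
  shows "f x \<in> N"
proof -
  interpret graded_basis G M B deg coord by fact
  note f = assms(2)[unfolded gr_hom_shift_regular_iff]
  have "f x = f (\<Oplus>\<^bsub>M\<^esub>b\<in>B. coord x b \<odot>\<^bsub>M\<^esub> b)" using coord assms(5) by simp
  also have "\<dots> = finsum (shift (regular G) j) (\<lambda>b. f (coord x b \<odot>\<^bsub>M\<^esub> b)) B"
    by (rule gr_hom_finsum[OF graded_module_axioms A.shift_graded_module assms(2) finsum_basis_closed])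
  also have "\<dots> = (\<Sum>b\<in>B. coord x b * f b)"
  proof -
    have "finsum (shift (regular G) j) h B = sum h B" for h
      using finsum_regular[of G h B] unfolding finsum_def shift_def by simp
    then show ?thesis using f basis_carrier by (auto intro!: sum.cong)
  qed
  also have "\<dots> \<in> N"
    by (rule left_ideal_sum[OF assms(3)]) (use assms(4) left_idealD(3)[OF assms(3)] in auto)
  finally show ?thesis .
qed

text \<open>The degree \<open>i\<close> component of the expansion of \<open>x\<close> is again an
  expansion of \<open>x\<close>, and coordinates are unique.\<close>

lemma coord_gr:
  assumes "graded_basis G M B deg coord" "x \<in> gr M i" "b \<in> B"
  shows "coord x b \<in> gr (regular G) (i - deg b)"
proof -
  interpret graded_basis G M B deg coord by fact
  have x: "x \<in> carrier M" using assms(2) by (rule gr_carrier)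
  have "x = component i x" using component_gr[OF assms(2)] by simp
  also have "\<dots> = component i (\<Oplus>\<^bsub>M\<^esub>b\<in>B. coord x b \<odot>\<^bsub>M\<^esub> b)" using coord[OF x] by simp
  also have "\<dots> = (\<Oplus>\<^bsub>M\<^esub>b\<in>B. component i (coord x b \<odot>\<^bsub>M\<^esub> b))"
    by (rule component_finsum) (rule finsum_basis_closed)
  also have "\<dots> = (\<Oplus>\<^bsub>M\<^esub>b\<in>B. A.component (i - deg b) (coord x b) \<odot>\<^bsub>M\<^esub> b)"
    by (rule finsum_cong')
      (use basis_carrier smult_closed component_smult[OF graded_module_axioms basis_gr] in auto)
  finally have "coord x b = A.component (i - deg b) (coord x b)"
    by (rule coord_eqI) (rule assms(3))
  then show ?thesis using A.component_props(1)[of "coord x b" "i - deg b"] by simp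
qed

lemma hom_extension:
  assumes "graded_basis G M B deg coord"
    and y: "\<And>b. b \<in> B \<Longrightarrow> y b \<in> gr (regular G) (deg b + j)"
  obtains f where "f \<in> gr_hom M (shift (regular G) j)" "\<And>b. b \<in> B \<Longrightarrow> f b = y b"
proof -
  interpret graded_basis G M B deg coord by fact
  let ?f = "\<lambda>x. \<Sum>b\<in>B. coord x b * y b"
  show ?thesis
  proof (rule that[of ?f])
    show "?f \<in> gr_hom M (shift (regular G) j)"
      unfolding gr_hom_shift_regular_iff
    proof (intro conjI ballI allI)
      fix x z assume "x \<in> carrier M" "z \<in> carrier M"
      then show "?f (x \<oplus>\<^bsub>M\<^esub> z) = ?f x + ?f z"
        by (simp add: coord_add distrib_right sum.distrib)
    next
      fix a x assume "x \<in> carrier M"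
      then show "?f (a \<odot>\<^bsub>M\<^esub> x) = a * ?f x"
        by (simp add: coord_smult sum_distrib_left mult.assoc)
    next
      fix i x assume x: "x \<in> gr M i"
      have "coord x b * y b \<in> gr (regular G) (i + j)" if "b \<in> B" for b
        using smult_gr_regular[OF graded_module_regular coord_gr[OF assms(1) x that] y[OF that]]
        by (simp add: algebra_simps)
      then show "?f x \<in> gr (regular G) (i + j)"
        using A.finsum_gr[of B "\<lambda>b. coord x b * y b" "i + j"] by simp
    qed
    fix b assume b: "b \<in> B"
    have "?f b = (\<Sum>b'\<in>B. if b' = b then y b else 0)"
      by (rule sum.cong) (use b coord_basis in auto)
    then show "?f b = y b" using b finite_basis by simp
  qed
qed

end

section \<open>Vanishing of Ext with coefficients in subquotients of \<open>A\<close>\<close>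

locale free_complex = graded_algebra scale G
  for scale :: "'k::field \<Rightarrow> 'a::{ring,monoid_mult} \<Rightarrow> 'a" and G :: "nat \<Rightarrow> 'a set" +
  fixes P :: "('a, 'p) cpx"
  assumes complex: "complex_Gr G P"
    and free: "fin_graded_free (ob P n)"
begin

abbreviation Ob :: "int \<Rightarrow> 'p set" where
  "Ob n \<equiv> carrier (ob P n)"

lemma graded_module_ob: "graded_module G (ob P n)"
  using complex unfolding complex_Gr_def by blast

lemma df_hom: "df P n \<in> gr_hom (ob P n) (ob P (n + 1))"
  using complex unfolding complex_Gr_def by blast

lemma df_hom': "df P (n - 1) \<in> gr_hom (ob P (n - 1)) (ob P n)"
  using df_hom[of "n - 1"] by simp

lemma df_df: "x \<in> Ob (n - 1) \<Longrightarrow> df P n (df P (n - 1) x) = \<zero>\<^bsub>ob P (n + 1)\<^esub>"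
  using complex[unfolded complex_Gr_def, THEN spec, of "n - 1"] by (simp add: algebra_simps)

abbreviation Hom_deg :: "int \<Rightarrow> int \<Rightarrow> ('p \<Rightarrow> 'a) set" where
  "Hom_deg n j \<equiv> gr_hom (ob P n) (shift (regular G) j)"

lemma hom_zero: "f \<in> Hom_deg n j \<Longrightarrow> f \<zero>\<^bsub>ob P n\<^esub> = 0"
  using gr_hom_zero[OF graded_module_ob A.shift_graded_module] by (simp add: shift_def)

lemma hom_add: "f \<in> Hom_deg n j \<Longrightarrow> g \<in> Hom_deg n j \<Longrightarrow> (\<lambda>x. f x + g x) \<in> Hom_deg n j"
  unfolding gr_hom_shift_regular_iff using A.add_gr by (auto simp: algebra_simps)

text \<open>Right multiplication commutes with the left action. It carries both the idempotent
  endomorphism of \<open>A/J\<close> and the map from a shift of \<open>A\<close> onto the submodule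
  generated by \<open>y\<close>.\<close>

lemma hom_mult_right:
  assumes "f \<in> Hom_deg n j" "y \<in> gr (regular G) d"
  shows "(\<lambda>x. f x * y) \<in> Hom_deg n (j + d)"
proof -
  note f = assms(1)[unfolded gr_hom_shift_regular_iff]
  have "f x * y \<in> gr (regular G) (i + (j + d))" if "x \<in> gr (ob P n) i" for x i
    using gr_regular_mult[of "f x" "i + j" y d] f that assms(2) by (simp add: add.assoc)
  then show ?thesis
    using f unfolding gr_hom_shift_regular_iff by (simp add: distrib_right mult.assoc)
qed

lemma hom_diff:
  assumes "f \<in> Hom_deg n j" "g \<in> Hom_deg n j" shows "(\<lambda>x. f x - g x) \<in> Hom_deg n j"
proof -
  have "- 1 \<in> gr (regular G) 0"
    using one_component subspace_neg[OF subspace_component, of 1 0] by (simp add: gr_regular)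
  from hom_add[OF assms(1) hom_mult_right[OF assms(2) this, simplified]] show ?thesis by simp
qed

lemma hom_df: "g \<in> Hom_deg (n + 1) j \<Longrightarrow> (\<lambda>x. g (df P n x)) \<in> Hom_deg n j"
  using gr_homD[OF df_hom[of n]] unfolding gr_hom_shift_regular_iff by auto

lemma hom_df_df:
  "g \<in> Hom_deg (n + 1) j \<Longrightarrow> x \<in> Ob (n - 1) \<Longrightarrow> g (df P n (df P (n - 1) x)) = 0"
  using df_df hom_zero by simp

abbreviation cobounds :: "int \<Rightarrow> int \<Rightarrow> 'a set \<Rightarrow> 'a set \<Rightarrow> ('p \<Rightarrow> 'a) \<Rightarrow> bool" where
  "cobounds n j N' N f \<equiv> \<exists>g\<in>Hom_deg (n + 1) j. (\<forall>x\<in>Ob (n + 1). g x \<in> N') \<and>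
     (\<forall>x\<in>Ob n. f x - g (df P n x) \<in> N)"

text \<open>For graded left ideals \<open>N \<subseteq> N'\<close> this says \<open>Ext\<^bsup>-n\<^esup>(X, N'/N)\<^sub>j = 0\<close>; since \<open>P\<close> is free, maps to \<open>N'/N\<close> are
  represented by maps to \<open>N'\<close>.\<close>

definition ext_vanishes :: "int \<Rightarrow> int \<Rightarrow> 'a set \<Rightarrow> 'a set \<Rightarrow> bool" where
  "ext_vanishes n j N' N \<longleftrightarrow> (\<forall>f\<in>Hom_deg n j.
     (\<forall>x\<in>Ob n. f x \<in> N') \<and> (\<forall>x\<in>Ob (n - 1). f (df P (n - 1) x) \<in> N) \<longrightarrow>
     cobounds n j N' N f)"

lemma ext_vanishesI:
  assumes "\<And>f. f \<in> Hom_deg n j \<Longrightarrow> (\<And>x. x \<in> Ob n \<Longrightarrow> f x \<in> N') \<Longrightarrow>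
      (\<And>x. x \<in> Ob (n - 1) \<Longrightarrow> f (df P (n - 1) x) \<in> N) \<Longrightarrow>
      cobounds n j N' N f"
  shows "ext_vanishes n j N' N"
  unfolding ext_vanishes_def using assms by blast

lemma ext_vanishesE:
  assumes "ext_vanishes n j N' N" "f \<in> Hom_deg n j"
    and "\<And>x. x \<in> Ob n \<Longrightarrow> f x \<in> N'"
    and "\<And>x. x \<in> Ob (n - 1) \<Longrightarrow> f (df P (n - 1) x) \<in> N"
  obtains g where "g \<in> Hom_deg (n + 1) j" "\<forall>x\<in>Ob (n + 1). g x \<in> N'"
    "\<forall>x\<in>Ob n. f x - g (df P n x) \<in> N"
proof -
  have "cobounds n j N' N f"
    using assms(1)[unfolded ext_vanishes_def, rule_format, OF assms(2)] assms(3,4) by simp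
  then show ?thesis using that by blast
qed

lemma zero_hom: "(\<lambda>x. 0) \<in> Hom_deg n j"
  unfolding gr_hom_shift_regular_iff using A.zero_gr by simp

lemma ext_vanishes_refl:
  assumes "0 \<in> N" shows "ext_vanishes n j N N"
  by (rule ext_vanishesI, rule bexI[OF _ zero_hom]) (use assms in simp)

text \<open>Half exactness for \<open>N'/N \<rightarrow> N''/N \<rightarrow> N''/N'\<close>. A first
  coboundary brings the cocycle \<open>f\<close> into \<open>N'\<close>; as the differential squares
  to zero, the difference is still a cocycle modulo \<open>N\<close>, and a second coboundary
  finishes.\<close>

lemma ext_vanishes_trans:
  assumes "ext_vanishes n j N'' N'" "ext_vanishes n j N' N" "N \<subseteq> N'" "N' \<subseteq> N''" "left_ideal UNIV N''"
  shows "ext_vanishes n j N'' N"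
proof (rule ext_vanishesI)
  fix f assume f: "f \<in> Hom_deg n j" "\<And>x. x \<in> Ob n \<Longrightarrow> f x \<in> N''"
    "\<And>x. x \<in> Ob (n - 1) \<Longrightarrow> f (df P (n - 1) x) \<in> N"
  have fN': "f (df P (n - 1) x) \<in> N'" if "x \<in> Ob (n - 1)" for x
    using f(3)[OF that] assms(3) by (rule subsetD[rotated])
  obtain g where g [rule_format]: "g \<in> Hom_deg (n + 1) j" "\<forall>x\<in>Ob (n + 1). g x \<in> N''"
    "\<forall>x\<in>Ob n. f x - g (df P n x) \<in> N'"
    by (rule ext_vanishesE[OF assms(1) f(1,2) fN'])
  let ?f = "\<lambda>x. f x - g (df P n x)"
  have h1: "?f \<in> Hom_deg n j" by (rule hom_diff[OF f(1) hom_df[OF g(1)]])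
  have h2: "?f (df P (n - 1) x) \<in> N" if "x \<in> Ob (n - 1)" for x
    using f(3)[OF that] hom_df_df[OF g(1) that] by simp
  obtain h where h [rule_format]: "h \<in> Hom_deg (n + 1) j"
    "\<forall>x\<in>Ob (n + 1). h x \<in> N'" "\<forall>x\<in>Ob n. ?f x - h (df P n x) \<in> N"
    by (rule ext_vanishesE[OF assms(2) h1 g(3) h2])
  show "cobounds n j N'' N f"
  proof (intro bexI[OF _ hom_add[OF g(1) h(1)]] conjI ballI)
    show "g x + h x \<in> N''" if "x \<in> Ob (n + 1)" for x
      using g(2)[OF that] h(2)[OF that] assms(4) by (intro left_idealD(2)[OF assms(5)]) auto
    show "f x - (g (df P n x) + h (df P n x)) \<in> N" if "x \<in> Ob n" for x
      using h(3)[OF that] by (simp add: diff_diff_eq)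
  qed
qed

text \<open>Here \<open>A/m\<close> is used as a retract of \<open>A/J\<close>. Multiplying by
  \<open>e\<close> turns a cocycle modulo \<open>m\<close> into one modulo the radical, and
  \<open>f\<close> differs from \<open>f * e\<close> by \<open>f * (1 - e)\<close>, which has values
  in \<open>m\<close>. So a \<open>g\<close> that works for \<open>f * e\<close> modulo the radical
  works for \<open>f\<close> modulo \<open>m\<close>.\<close>

lemma ext_vanishes_maximal:
  assumes "ext_vanishes n j UNIV (graded_jacobson G)" "maximal_graded_ideal m"
  shows "ext_vanishes n j UNIV m"
proof (rule ext_vanishesI)
  fix f assume f: "f \<in> Hom_deg n j" "\<And>x. x \<in> Ob (n - 1) \<Longrightarrow> f (df P (n - 1) x) \<in> m"
  obtain e where e: "e \<in> G 0" "1 - e \<in> m" "\<And>a. a \<in> m \<Longrightarrow> a * e \<in> graded_jacobson G"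
    by (rule maximal_complement[OF assms(2)]) simp
  have lm: "left_ideal UNIV m"
    using assms(2)[unfolded maximal_graded_ideal_iff] graded_left_idealD(1) by simp
  have eg: "e \<in> gr (regular G) 0" using e(1) by (simp add: gr_regular)
  have fe: "(\<lambda>x. f x * e) \<in> Hom_deg n j" using hom_mult_right[OF f(1) eg] by simp
  obtain g where g [rule_format]: "g \<in> Hom_deg (n + 1) j"
    "\<forall>x\<in>Ob n. f x * e - g (df P n x) \<in> graded_jacobson G"
    by (rule ext_vanishesE[OF assms(1) fe UNIV_I e(3)[OF f(2)]])
  have "f x - g (df P n x) \<in> m" if "x \<in> Ob n" for x
  proof -
    have "f x * e - g (df P n x) \<in> m"
      using g(2)[OF that] assms(2) unfolding graded_jacobson_eq by simp
    then have "f x * (1 - e) + (f x * e - g (df P n x)) \<in> m"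
      by (intro left_idealD(2)[OF lm] left_idealD(3)[OF lm e(2)])
    then show ?thesis by (simp add: algebra_simps)
  qed
  then show "cobounds n j UNIV m f"
    by (intro bexI[OF _ g(1)]) simp
qed

lemma obtain_basis:
  obtains B deg coord where "graded_basis G (ob P n) B deg coord"
  by (rule fin_graded_free_basis[OF graded_module_ob free])

text \<open>Multiplication by \<open>y\<close> identifies the quotient of \<open>A\<close> by
  \<open>{a. a * y \<in> N}\<close>, shifted by \<open>-d\<close>, with \<open>(N + A y)/N\<close>.
  A cocycle is divided by \<open>y\<close>, bounded there, and multiplied back.\<close>

lemma ext_vanishes_cyclic:
  assumes N: "graded_left_ideal N" and y: "y \<in> gr (regular G) d"
    and v: "ext_vanishes n (j - d) UNIV {a. a * y \<in> N}"
  shows "ext_vanishes n j {u + a * y | u a. u \<in> N} N"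
proof (rule ext_vanishesI)
  let ?N = "{u + a * y | u a. u \<in> N}"
  note lN = graded_left_idealD(1)[OF N]
  fix f assume f: "f \<in> Hom_deg n j" "\<And>x. x \<in> Ob n \<Longrightarrow> f x \<in> ?N"
    "\<And>x. x \<in> Ob (n - 1) \<Longrightarrow> f (df P (n - 1) x) \<in> N"
  obtain B deg coord where basis: "graded_basis G (ob P n) B deg coord" by (rule obtain_basis)
  interpret P: graded_basis G "ob P n" B deg coord by (rule basis)
  \<comment> \<open>The coefficient of \<open>y\<close> is replaced by its component of the right
    degree, so that the values on the basis extend to a map of degree \<open>j - d\<close>. The
    error is a component of \<open>u\<close>, which remains in \<open>N\<close> because
    \<open>N\<close> is graded.\<close>
  have "\<exists>a. a \<in> gr (regular G) (deg b + (j - d)) \<and> f b - a * y \<in> N" if b: "b \<in> B" for b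
  proof -
    from f(2)[OF P.basis_carrier[OF b]] obtain u a where ua: "f b = u + a * y" "u \<in> N" by auto
    have "f b \<in> gr (regular G) (deg b + j)"
      using f(1) P.basis_gr[OF b] unfolding gr_hom_shift_regular_iff by auto
    then have "f b = A.component (deg b + j) (u + a * y)"
      using A.component_gr ua(1) by simp
    also have "\<dots> = A.component (deg b + j) u + A.component (deg b + j - d) a * y"
      using A.component_add component_mult_gr[OF y] by simp
    finally have "f b - A.component (deg b + j - d) a * y = A.component (deg b + j) u" by simp
    then have "f b - A.component (deg b + j - d) a * y \<in> N"
      using graded_left_idealD(2)[OF N ua(2)] by simp
    moreover have "A.component (deg b + j - d) a \<in> gr (regular G) (deg b + (j - d))"
      using A.component_props(1)[of a "deg b + j - d"] by (simp add: algebra_simps)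
    ultimately show ?thesis by blast
  qed
  then obtain a where a: "\<And>b. b \<in> B \<Longrightarrow> a b \<in> gr (regular G) (deg b + (j - d))"
    "\<And>b. b \<in> B \<Longrightarrow> f b - a b * y \<in> N"
    by metis
  obtain f' where f': "f' \<in> Hom_deg n (j - d)" "\<And>b. b \<in> B \<Longrightarrow> f' b = a b"
    by (rule hom_extension[OF basis a(1)]) auto
  have f'y: "(\<lambda>x. f' x * y) \<in> Hom_deg n j" using hom_mult_right[OF f'(1) y] by simp
  have diff: "f x - f' x * y \<in> N" if "x \<in> Ob n" for x
    by (rule hom_in_left_ideal[OF basis hom_diff[OF f(1) f'y] lN _ that]) (use f'(2) a(2) in simp)
  have f'd: "f' (df P (n - 1) x) \<in> {a. a * y \<in> N}" if "x \<in> Ob (n - 1)" for x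
    using left_idealD(4)[OF lN f(3)[OF that] diff[OF gr_homD(1)[OF df_hom' that]]] by simp
  obtain g where g [rule_format]: "g \<in> Hom_deg (n + 1) (j - d)"
    "\<forall>x\<in>Ob n. f' x - g (df P n x) \<in> {a. a * y \<in> N}"
    by (rule ext_vanishesE[OF v f'(1) UNIV_I f'd])
  show "cobounds n j ?N N f"
  proof (rule bexI[where x = "\<lambda>x. g x * y"], intro conjI ballI)
    show "(\<lambda>x. g x * y) \<in> Hom_deg (n + 1) j" using hom_mult_right[OF g(1) y] by simp
    have "0 + g x * y \<in> ?N" for x using left_idealD(1)[OF lN] by blast
    then show "g x * y \<in> ?N" for x by simp
    fix x assume x: "x \<in> Ob n"
    have "(f x - f' x * y) + (f' x - g (df P n x)) * y \<in> N"
      using g(2)[OF x] diff[OF x] by (intro left_idealD(2)[OF lN]) auto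
    then show "f x - g (df P n x) * y \<in> N" by (simp add: algebra_simps)
  qed
qed

text \<open>Induction on the codimension of \<open>N\<close> in degree \<open>d\<close>. Unless
  \<open>N\<close> is everything, a suitable \<open>y\<close> makes \<open>(N + A y)/N\<close> a
  simple bottom layer, for which the vanishing comes from \<open>A/m\<close>. The remaining quotient
  has smaller codimension, and half exactness glues the two.\<close>

lemma ext_vanishes_layer:
  assumes v: "ext_vanishes n (j - d) UNIV (graded_jacobson G)"
    and N: "graded_left_ideal N" "degree_ge (d + 1) \<subseteq> N" "N \<subseteq> degree_ge d"
  shows "ext_vanishes n j (degree_ge d) N"
  using N
proof (induction "dim (gr (regular G) d) - dim (N \<inter> gr (regular G) d)" arbitrary: N rule: less_induct)
  case less
  note N = less.prems
  note D = left_idealD[OF graded_left_idealD(1)[OF N(1)]]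
  let ?V = "gr (regular G) d"
  obtain B where B: "finite B" "?V = span B" by (rule gr_finite_dimensional)
  show ?case
  proof (cases "?V \<subseteq> N")
    case True
    have "degree_ge d \<subseteq> N"
    proof
      fix x assume "x \<in> degree_ge d"
      then have "x - A.component d x \<in> N" using diff_component_degree_ge N(2) by blast
      moreover have "A.component d x \<in> N" using True A.component_props(1)[of x d] by auto
      ultimately show "x \<in> N" using D(2) by (metis diff_add_cancel)
    qed
    then have "N = degree_ge d" using N(3) by simp
    then show ?thesis using ext_vanishes_refl D(1) by simp
  next
    case False
    define cyc where "cyc y = {u + a * y | u a. u \<in> N}" for y
    from False obtain y0 where "y0 \<in> ?V \<and> y0 \<notin> N" by blast
    from ex_has_least_nat[of "\<lambda>y. y \<in> ?V \<and> y \<notin> N", OF this, of "\<lambda>y. dim (cyc y \<inter> ?V)"]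
    obtain y where y: "y \<in> ?V" "y \<notin> N"
      and min: "\<forall>z. z \<in> ?V \<and> z \<notin> N \<longrightarrow> dim (cyc y \<inter> ?V) \<le> dim (cyc z \<inter> ?V)"
      by (elim exE conjE)
    have "maximal_graded_ideal {a. a * y \<in> N}"
      by (rule annihilator_maximal[OF N(1,2) y], rule min[unfolded cyc_def, rule_format], rule conjI)
    from ext_vanishes_cyclic[OF N(1) y(1) ext_vanishes_maximal[OF v this]]
    have vN: "ext_vanishes n j (cyc y) N" unfolding cyc_def .
    have gcyc: "graded_left_ideal (cyc y)"
      unfolding cyc_def by (rule graded_left_ideal_insert[OF N(1) y(1)])
    have "u + 0 * y \<in> cyc y" if "u \<in> N" for u unfolding cyc_def using that by blast
    then have Ncyc: "N \<subseteq> cyc y" by auto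
    have "0 + 1 * y \<in> cyc y" unfolding cyc_def using D(1) by blast
    then have ycyc: "y \<in> cyc y" by simp
    note D' = left_idealD[OF left_ideal_degree_ge[of d]]
    have "y \<in> degree_ge d" using gr_subset_degree_ge[of d d] y(1) by auto
    then have cycd: "cyc y \<subseteq> degree_ge d"
      unfolding cyc_def using D'(2,3) N(3) by (auto simp: subset_iff)
    have "N \<inter> ?V \<subset> cyc y \<inter> ?V" using Ncyc ycyc y by auto
    moreover have "subspace (N \<inter> ?V)"
      using left_ideal_subspace[OF graded_left_idealD(1)[OF N(1)]] subspace_span[of B]
      unfolding B(2) by (rule subspace_inter)
    ultimately have lt: "dim (N \<inter> ?V) < dim (cyc y \<inter> ?V)"
      using B by (intro dim_strict_mono[of _ _ B]) auto
    \<comment> \<open>Extending a basis shows that the dimension of the larger ideal in degree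
      \<open>d\<close> is at most that of \<open>?V\<close>. Together with \<open>lt\<close> this
      makes the subtraction of naturals in the induction measure strictly decrease.\<close>
    obtain B' where B': "B' \<subseteq> cyc y \<inter> ?V" "independent B'" "card B' = dim (cyc y \<inter> ?V)"
      using basis_exists[of "cyc y \<inter> ?V"] by metis
    obtain C where C: "B' \<subseteq> C" "C \<subseteq> ?V" "independent C" "?V \<subseteq> span C"
      using maximal_independent_subset_extend[of B' ?V] B' by blast
    have "finite C" using independent_span_bound[OF B(1) C(3)] C(2) B(2) by simp
    then have "dim (cyc y \<inter> ?V) \<le> dim ?V"
      using card_mono[OF _ C(1)] basis_card_eq_dim[OF C(2,4,3)] B'(3) by simp
    then have "ext_vanishes n j (degree_ge d) (cyc y)"
      using lt Ncyc N(2) by (intro less.hyps gcyc cycd) auto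
    then show ?thesis
      using vN Ncyc cycd left_ideal_degree_ge
      by (rule ext_vanishes_trans)
  qed
qed

text \<open>The layer in degree \<open>m\<close> asks for the vanishing in internal degree
  \<open>j - m\<close>. All \<open>m \<ge> d\<close> occur, which is why the hypothesis covers every
  \<open>j' \<le> j - d\<close> and not just one value.\<close>

lemma ext_vanishes_truncation:
  assumes "\<And>j'. j' \<le> j - d \<Longrightarrow> ext_vanishes n j' UNIV (graded_jacobson G)" "d \<le> m"
  shows "ext_vanishes n j (degree_ge d) (degree_ge m)"
  using assms(2)
proof (induction m rule: int_ge_induct)
  case base
  then show ?case
    using ext_vanishes_refl left_idealD(1)[OF left_ideal_degree_ge] by blast
next
  case (step m)
  have "ext_vanishes n j (degree_ge m) (degree_ge (m + 1))"
    using assms(1)[of "j - m"] step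
    by (intro ext_vanishes_layer graded_left_ideal_degree_ge subset_refl degree_ge_anti) auto
  with step.IH show ?case
    by (rule ext_vanishes_trans)
      (use step degree_ge_anti left_ideal_degree_ge in auto)
qed

text \<open>A map of degree \<open>j\<close> from the finitely generated module \<open>P\<^sup>n\<close> into \<open>A\<^bsub>\<ge>m\<^esub>\<close> vanishes for large \<open>m\<close>.\<close>

lemma ext_vanishes_degree_ge:
  assumes "\<And>j'. j' \<le> j - d \<Longrightarrow> ext_vanishes n j' UNIV (graded_jacobson G)"
  shows "ext_vanishes n j (degree_ge d) {0}"
proof (rule ext_vanishesI)
  fix f assume f: "f \<in> Hom_deg n j" "\<And>x. x \<in> Ob n \<Longrightarrow> f x \<in> degree_ge d"
    "\<And>x. x \<in> Ob (n - 1) \<Longrightarrow> f (df P (n - 1) x) \<in> {0}"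
  obtain B deg coord where basis: "graded_basis G (ob P n) B deg coord" by (rule obtain_basis)
  interpret P: graded_basis G "ob P n" B deg coord by (rule basis)
  have l0: "left_ideal UNIV {0 :: 'a}" unfolding left_ideal_def by simp
  \<comment> \<open>A map of degree \<open>j\<close> sends the basis vector \<open>b\<close> to
    degree \<open>deg b + j\<close>. Beyond all these finitely many degrees, lying in
    \<open>degree_ge m\<close> means being zero.\<close>
  obtain m where m: "d \<le> m" "\<And>b. b \<in> B \<Longrightarrow> deg b + j < m"
  proof (rule that)
    let ?m = "Max (insert d ((\<lambda>b. deg b + j + 1) ` B))"
    show "d \<le> ?m" using P.finite_basis by simp
    fix b assume "b \<in> B"
    then have "deg b + j + 1 \<le> ?m" using P.finite_basis by (intro Max_ge) auto
    then show "deg b + j < ?m" by simp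
  qed
  have v: "ext_vanishes n j (degree_ge d) (degree_ge m)"
    by (rule ext_vanishes_truncation[OF assms m(1)])
  have fd: "f (df P (n - 1) x) \<in> degree_ge m" if "x \<in> Ob (n - 1)" for x
    using f(3)[OF that] left_idealD(1)[OF left_ideal_degree_ge[of m]]
    by simp
  obtain g where g [rule_format]: "g \<in> Hom_deg (n + 1) j"
    "\<forall>x\<in>Ob (n + 1). g x \<in> degree_ge d"
    "\<forall>x\<in>Ob n. f x - g (df P n x) \<in> degree_ge m"
    by (rule ext_vanishesE[OF v f(1,2) fd])
  have h: "(\<lambda>x. f x - g (df P n x)) \<in> Hom_deg n j" by (rule hom_diff[OF f(1) hom_df[OF g(1)]])
  have "f b - g (df P n b) \<in> {0}" if b: "b \<in> B" for b
  proof -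
    have "f b - g (df P n b) \<in> gr (regular G) (deg b + j)"
      using h P.basis_gr[OF b] unfolding gr_hom_shift_regular_iff by blast
    from gr_degree_ge_disjoint[OF this m(2)[OF b] g(3)[OF P.basis_carrier[OF b]]]
    show ?thesis unfolding singleton_iff .
  qed
  then have "f x - g (df P n x) \<in> {0}" if "x \<in> Ob n" for x
    using hom_in_left_ideal[OF basis h l0 _ that] by simp
  then show "cobounds n j (degree_ge d) {0} f"
    using g(1,2) by (intro bexI[of _ g]) auto
qed

text \<open>The part of the long exact sequence around the connecting map; position
  \<open>n - 1\<close> is one cohomological degree higher. A cocycle \<open>f\<close> modulo
  \<open>N\<close> gives the cocycle of its composite with the differential, with values in
  \<open>N\<close>. If that is bounded by some \<open>h\<close> into \<open>N\<close>, then
  \<open>f - h\<close> is a true cocycle into \<open>A\<close>, and \<open>h\<close> is invisible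
  modulo \<open>N\<close>.\<close>

lemma ext_vanishes_quotient:
  assumes "ext_vanishes (n - 1) j N {0}" "ext_vanishes n j UNIV {0}" "left_ideal UNIV N"
  shows "ext_vanishes n j UNIV N"
proof (rule ext_vanishesI)
  fix f assume f: "f \<in> Hom_deg n j" "\<And>x. x \<in> Ob (n - 1) \<Longrightarrow> f (df P (n - 1) x) \<in> N"
  have fd: "(\<lambda>x. f (df P (n - 1) x)) \<in> Hom_deg (n - 1) j"
    using hom_df[of f "n - 1" j] f(1) by simp
  have fdd: "f (df P (n - 1) (df P (n - 1 - 1) x)) \<in> {0}" if "x \<in> Ob (n - 1 - 1)" for x
    using hom_df_df[of f "n - 1" j x] f(1) that by simp
  obtain h where h [rule_format]: "h \<in> Hom_deg (n - 1 + 1) j"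
    "\<forall>x\<in>Ob (n - 1 + 1). h x \<in> N"
    "\<forall>x\<in>Ob (n - 1). f (df P (n - 1) x) - h (df P (n - 1) x) \<in> {0}"
    by (rule ext_vanishesE[OF assms(1) fd f(2) fdd])
  have h': "h \<in> Hom_deg n j" "\<And>x. x \<in> Ob n \<Longrightarrow> h x \<in> N" using h(1,2) by simp_all
  obtain g where g [rule_format]: "g \<in> Hom_deg (n + 1) j"
    "\<forall>x\<in>Ob n. (f x - h x) - g (df P n x) \<in> {0}"
    by (rule ext_vanishesE[OF assms(2) hom_diff[OF f(1) h'(1)] UNIV_I h(3)])
  have "f x - g (df P n x) \<in> N" if "x \<in> Ob n" for x
    using g(2)[OF that] h'(2)[OF that] by (simp add: algebra_simps)
  then show "cobounds n j UNIV N f"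
    by (intro bexI[OF _ g(1)]) simp
qed

end

section \<open>Cohomology of Hom complexes\<close>

lemma shift_simps [simp]:
  "carrier (shift M j) = carrier M" "add (shift M j) = add M" "zero (shift M j) = zero M"
  "smult (shift M j) = smult M" "gr (shift M j) i = gr M (i + j)"
  unfolding shift_def by auto

lemma coset_regular: "N +>\<^bsub>regular G\<^esub> x = (\<lambda>h. h + x) ` N"
  unfolding a_r_coset_def' by auto

context graded_algebra
begin

lemma coset_regular_eq_iff:
  assumes "left_ideal UNIV N"
  shows "N +>\<^bsub>regular G\<^esub> x = N +>\<^bsub>regular G\<^esub> y \<longleftrightarrow> x - y \<in> N"
  using A.coset_eq_iff[of N x y] assms by (simp add: left_submodule_regular)

lemma coset_zero: "N +>\<^bsub>regular G\<^esub> 0 = N"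
  unfolding coset_regular by simp

lemma quot_regular_simps:
  assumes "left_ideal UNIV N"
  shows "carrier (quot_gmod (regular G) N) = range (\<lambda>x. N +>\<^bsub>regular G\<^esub> x)"
    "zero (quot_gmod (regular G) N) = N +>\<^bsub>regular G\<^esub> 0"
    "(N +>\<^bsub>regular G\<^esub> x) \<oplus>\<^bsub>quot_gmod (regular G) N\<^esub> (N +>\<^bsub>regular G\<^esub> y) = N +>\<^bsub>regular G\<^esub> (x + y)"
    "a \<odot>\<^bsub>quot_gmod (regular G) N\<^esub> (N +>\<^bsub>regular G\<^esub> x) = N +>\<^bsub>regular G\<^esub> (a * x)"
    "gr (quot_gmod (regular G) N) i = (\<lambda>x. N +>\<^bsub>regular G\<^esub> x) ` gr (regular G) i"
proof -
  note D = left_idealD[OF assms]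
  show "carrier (quot_gmod (regular G) N) = range (\<lambda>x. N +>\<^bsub>regular G\<^esub> x)"
    unfolding quot_gmod_def A_RCOSETS_def' by auto
  show "zero (quot_gmod (regular G) N) = N +>\<^bsub>regular G\<^esub> 0"
    unfolding quot_gmod_def coset_zero by simp
  have "(\<Union>h\<in>(\<lambda>h. h + x) ` N. \<Union>k\<in>(\<lambda>h. h + y) ` N. {h + k}) = (\<lambda>h. h + (x + y)) ` N" (is "?L = ?R")
  proof (intro equalityI subsetI)
    fix z assume "z \<in> ?L"
    then obtain h k where hk: "h \<in> N" "k \<in> N" "z = (h + x) + (k + y)" by auto
    then have "z = (h + k) + (x + y)" by (simp add: algebra_simps)
    then show "z \<in> ?R" using D(2)[OF hk(1,2)] by (rule image_eqI)
  next
    fix z assume "z \<in> ?R"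
    then obtain h where h: "h \<in> N" "z = (h + x) + (0 + y)" by (auto simp: algebra_simps)
    have "h + x \<in> (\<lambda>h. h + x) ` N" "0 + y \<in> (\<lambda>h. h + y) ` N" by (rule imageI, rule h D)+
    then show "z \<in> ?L" unfolding h(2) by blast
  qed
  then show "(N +>\<^bsub>regular G\<^esub> x) \<oplus>\<^bsub>quot_gmod (regular G) N\<^esub> (N +>\<^bsub>regular G\<^esub> y) = N +>\<^bsub>regular G\<^esub> (x + y)"
    unfolding quot_gmod_def by (simp add: set_add_def' coset_regular)
  have "(\<Union>h\<in>N. \<Union>k\<in>(\<lambda>y. a * y) ` (\<lambda>h. h + x) ` N. {h + k}) = (\<lambda>h. h + a * x) ` N" (is "?L = ?R")
  proof (intro equalityI subsetI)
    fix z assume "z \<in> ?L"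
    then obtain h k where hk: "h \<in> N" "k \<in> N" "z = h + a * (k + x)" by auto
    then have "z = (h + a * k) + a * x" by (simp add: algebra_simps)
    then show "z \<in> ?R" using D(2)[OF hk(1) D(3)[OF hk(2)]] by (rule image_eqI)
  next
    fix z assume "z \<in> ?R"
    then obtain h where h: "h \<in> N" "z = h + a * (0 + x)" by auto
    have "a * (0 + x) \<in> (\<lambda>y. a * y) ` (\<lambda>h. h + x) ` N" by (intro imageI D)
    then show "z \<in> ?L" unfolding h(2) using h(1) by blast
  qed
  then show "a \<odot>\<^bsub>quot_gmod (regular G) N\<^esub> (N +>\<^bsub>regular G\<^esub> x) = N +>\<^bsub>regular G\<^esub> (a * x)"
    unfolding quot_gmod_def by (simp add: set_add_def' coset_regular)
  show "gr (quot_gmod (regular G) N) i = (\<lambda>x. N +>\<^bsub>regular G\<^esub> x) ` gr (regular G) i"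
    unfolding quot_gmod_def by simp
qed

text \<open>Since \<open>N\<close> contains all positive degrees, the quotient is concentrated in
  degree 0, and its decomposition is trivial.\<close>

lemma graded_module_quot:
  assumes "left_ideal UNIV N" "degree_ge 1 \<subseteq> N"
  shows "graded_module G (quot_gmod (regular G) N)"
proof -
  let ?Q = "quot_gmod (regular G) N"
  let ?p = "\<lambda>x. N +>\<^bsub>regular G\<^esub> x"
  note Q = quot_regular_simps[OF assms(1)]
  note D = left_idealD[OF assms(1)]
  have ab: "abelian_group ?Q"
  proof (rule abelian_groupI)
    show "\<zero>\<^bsub>?Q\<^esub> \<in> carrier ?Q" unfolding Q by (rule rangeI)
    fix C assume "C \<in> carrier ?Q"
    then obtain x where x: "C = ?p x" unfolding Q by auto
    show "\<zero>\<^bsub>?Q\<^esub> \<oplus>\<^bsub>?Q\<^esub> C = C" unfolding x Q by simp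
  next
    fix C assume "C \<in> carrier ?Q"
    then obtain x where x: "C = ?p x" unfolding Q by auto
    have "?p (- x) \<oplus>\<^bsub>?Q\<^esub> C = \<zero>\<^bsub>?Q\<^esub>" unfolding x Q by simp
    moreover have "?p (- x) \<in> carrier ?Q" unfolding Q by simp
    ultimately show "\<exists>C'\<in>carrier ?Q. C' \<oplus>\<^bsub>?Q\<^esub> C = \<zero>\<^bsub>?Q\<^esub>" by (rule bexI)
  qed (auto simp: Q(1) Q(2,3) algebra_simps)
  interpret Q: abelian_group ?Q by (rule ab)
  have gr0: "gr ?Q 0 = carrier ?Q"
  proof (intro equalityI subsetI)
    fix C assume "C \<in> carrier ?Q"
    then obtain x where x: "C = ?p x" unfolding Q by auto
    have "x - A.component 0 x \<in> N"
      using diff_component_degree_ge[of x 0] assms(2) by (auto simp: degree_ge_0)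
    then have "C = ?p (A.component 0 x)" unfolding x coset_regular_eq_iff[OF assms(1)] .
    then show "C \<in> gr ?Q 0" unfolding Q using A.component_props(1)[of x 0] by (intro image_eqI) simp_all
  qed (auto simp: Q)
  have gri: "gr ?Q i = {\<zero>\<^bsub>?Q\<^esub>}" if "i \<noteq> 0" for i
  proof -
    have "x \<in> N" if x: "x \<in> gr (regular G) i" for x
    proof (cases "i < 0")
      case True
      then show ?thesis using x D(1) by (simp add: gr_regular)
    next
      case False
      then show ?thesis using x \<open>i \<noteq> 0\<close> gr_subset_degree_ge[of 1 i] assms(2) by auto
    qed
    then have "?p x = ?p 0" if "x \<in> gr (regular G) i" for x
      unfolding coset_regular_eq_iff[OF assms(1)] using that by simp
    then have "?p ` gr (regular G) i = (\<lambda>_. ?p 0) ` gr (regular G) i" by (rule image_cong[OF refl])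
    also have "\<dots> = {?p 0}" using A.zero_gr[of i] by auto
    finally show ?thesis unfolding Q(2) Q(5) .
  qed
  show ?thesis
  proof (intro graded_module.intro graded_module_axioms.intro ab)
    fix i show "additive_subgroup (gr ?Q i) ?Q"
    proof (cases "i = 0")
      case True
      then show ?thesis unfolding True gr0
        by (intro additive_subgroupI) (auto intro!: Q.add.subgroup_self)
    next
      case False
      then show ?thesis unfolding gri[OF False]
        by (intro additive_subgroupI Q.add.triv_subgroup[simplified])
    qed
  next
    fix C assume C: "C \<in> carrier ?Q"
    let ?f = "\<lambda>i C. if i = 0 then C else \<zero>\<^bsub>?Q\<^esub>"
    show "\<exists>!f. (\<forall>i. f i \<in> gr ?Q i) \<and> finite {i. f i \<noteq> \<zero>\<^bsub>?Q\<^esub>} \<and> C = (\<Oplus>\<^bsub>?Q\<^esub>i\<in>{i. f i \<noteq> \<zero>\<^bsub>?Q\<^esub>}. f i)"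
    proof (rule direct_sum_by_projections[OF ab, where p = ?f])
      show "gr ?Q i \<subseteq> carrier ?Q" for i using gr0 gri by (cases "i = 0") auto
      show "finite {i::int. ?f i C \<noteq> \<zero>\<^bsub>?Q\<^esub>}" by (rule finite_subset[of _ "{0}"]) auto
      have "(\<Oplus>\<^bsub>?Q\<^esub>i\<in>{i::int. ?f i C \<noteq> \<zero>\<^bsub>?Q\<^esub>}. ?f i C) = (\<Oplus>\<^bsub>?Q\<^esub>i\<in>{0::int}. ?f i C)"
        by (rule Q.finsum_support) (use C in auto)
      also have "\<dots> = C" using C by (intro Q.finsum_single) auto
      finally show "C = (\<Oplus>\<^bsub>?Q\<^esub>i\<in>{i::int. ?f i C \<noteq> \<zero>\<^bsub>?Q\<^esub>}. ?f i C)" by simp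
      show "x \<in> gr ?Q i \<Longrightarrow> ?f k x = (if k = i then x else \<zero>\<^bsub>?Q\<^esub>)" for i k x
        using gri by (cases "i = 0") auto
    qed (use C gr0 gri in auto)
  next
    fix a n C i assume "a \<in> G n" "C \<in> gr ?Q i"
    then show "a \<odot>\<^bsub>?Q\<^esub> C \<in> gr ?Q (int n + i)"
      unfolding Q using A.smult_gr[of a n _ i] Q(4) by auto
  qed (auto simp: Q(1) Q(3,4) algebra_simps)
qed

end

section \<open>Elements of the graded Hom module\<close>

lemma Hom_gmod_carrierI:
  assumes "graded_module G L" "graded_module G M" "g \<in> gr_hom L (shift M j)"
  shows "restrict g (carrier L) \<in> carrier (Hom_gmod scale L M)"
proof -
  interpret M: graded_module G M by fact
  have "restrict g (carrier L) = (\<lambda>x\<in>carrier L. \<Oplus>\<^bsub>M\<^esub>j\<in>{j}. g x)"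
    using gr_homD(1)[OF assms(3)] by (auto simp: fun_eq_iff M.finsum_insert)
  moreover have "finite {j} \<and> (\<forall>j\<in>{j}. g \<in> gr_hom L (shift M j))" using assms(3) by simp
  ultimately show ?thesis
    unfolding Hom_gmod_def by (simp del: restrict_apply) (intro exI[of _ "{j}"] exI[of _ "\<lambda>_. g"] conjI; simp)
qed

lemma Hom_gmod_carrierE:
  assumes "h \<in> carrier (Hom_gmod scale L M)"
  obtains F g where "finite F" "\<forall>j\<in>F. g j \<in> gr_hom L (shift M j)"
    "h = (\<lambda>x\<in>carrier L. \<Oplus>\<^bsub>M\<^esub>j\<in>F. g j x)"
  using assms unfolding Hom_gmod_def by auto

text \<open>A family in \<open>Hom_gmod\<close> has at most one map in each degree, so
  \<open>f\<close> cannot simply be appended. The family is first extended by zero outside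
  \<open>F\<close>, and \<open>f\<close> is then merged with the member in degree
  \<open>j\<close>.\<close>

lemma Hom_gmod_add_homogeneous:
  assumes "graded_module G L" "graded_module G M"
    and h: "h \<in> carrier (Hom_gmod scale L M)" and f: "f \<in> gr_hom L (shift M j)"
  shows "(\<lambda>x\<in>carrier L. h x \<oplus>\<^bsub>M\<^esub> f x) \<in> carrier (Hom_gmod scale L M)"
proof -
  interpret L: graded_module G L by fact
  interpret M: graded_module G M by fact
  interpret Ms: graded_module G "shift M j" by (rule M.shift_graded_module)
  obtain F g where g [rule_format]: "finite F" "\<forall>k\<in>F. g k \<in> gr_hom L (shift M k)"
    "h = (\<lambda>x\<in>carrier L. \<Oplus>\<^bsub>M\<^esub>k\<in>F. g k x)"
    by (rule Hom_gmod_carrierE[OF h])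
  define g' where "g' k = (if k \<in> F then g k else (\<lambda>x. \<zero>\<^bsub>M\<^esub>))" for k
  define g'' where "g'' = g'(j := (\<lambda>x. g' j x \<oplus>\<^bsub>M\<^esub> f x))"
  have g': "g' k \<in> gr_hom L (shift M k)" for k
  proof -
    interpret Mk: graded_module G "shift M k" by (rule M.shift_graded_module)
    show ?thesis unfolding g'_def using g(2) Mk.gr_hom_const_zero[of L] by (simp add: shift_simps)
  qed
  have "(\<lambda>x. g' j x \<oplus>\<^bsub>M\<^esub> f x) \<in> gr_hom L (shift M j)"
    using Ms.gr_hom_add[OF g' f L.abelian_group_axioms] by simp
  then have g'': "g'' k \<in> gr_hom L (shift M k)" for k unfolding g''_def using g' by simp
  have c: "g' k x \<in> carrier M" "f x \<in> carrier M" "g'' k x \<in> carrier M" if "x \<in> carrier L" for x k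
    using gr_homD(1)[OF g' that] gr_homD(1)[OF f that] gr_homD(1)[OF g'' that] by simp_all
  let ?F = "F - {j}"
  have "h x \<oplus>\<^bsub>M\<^esub> f x = (\<Oplus>\<^bsub>M\<^esub>k\<in>insert j ?F. g'' k x)" if x: "x \<in> carrier L" for x
  proof -
    have "h x = (\<Oplus>\<^bsub>M\<^esub>k\<in>F. g' k x)"
      unfolding g(3) using x c(1)[OF x] by (auto intro!: M.finsum_cong' simp: g'_def)
    also have "\<dots> = (\<Oplus>\<^bsub>M\<^esub>k\<in>insert j ?F. g' k x)"
    proof (rule M.add.finprod_mono_neutral_cong_left)
      show "g' k x = \<zero>\<^bsub>M\<^esub>" if "k \<in> insert j ?F - F" for k using that by (simp add: g'_def)
    qed (use g(1) c(1)[OF x] in auto)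
    also have "\<dots> = g' j x \<oplus>\<^bsub>M\<^esub> (\<Oplus>\<^bsub>M\<^esub>k\<in>?F. g' k x)"
      by (rule M.finsum_insert) (use g(1) c(1)[OF x] in auto)
    finally have "h x \<oplus>\<^bsub>M\<^esub> f x = (g' j x \<oplus>\<^bsub>M\<^esub> f x) \<oplus>\<^bsub>M\<^esub> (\<Oplus>\<^bsub>M\<^esub>k\<in>?F. g' k x)"
      using c(1,2)[OF x] by (simp add: M.a_ac M.finsum_closed)
    moreover have "(\<Oplus>\<^bsub>M\<^esub>k\<in>?F. g' k x) = (\<Oplus>\<^bsub>M\<^esub>k\<in>?F. g'' k x)"
      by (rule M.finsum_cong') (use c(3)[OF x] in \<open>auto simp: g''_def\<close>)
    moreover have "(\<Oplus>\<^bsub>M\<^esub>k\<in>insert j ?F. g'' k x) = g'' j x \<oplus>\<^bsub>M\<^esub> (\<Oplus>\<^bsub>M\<^esub>k\<in>?F. g'' k x)"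
      by (rule M.finsum_insert) (use g(1) c(3)[OF x] in auto)
    ultimately show ?thesis by (simp add: g''_def)
  qed
  then have "(\<lambda>x\<in>carrier L. h x \<oplus>\<^bsub>M\<^esub> f x) = (\<lambda>x\<in>carrier L. \<Oplus>\<^bsub>M\<^esub>k\<in>insert j ?F. g'' k x)"
    by (rule restrict_ext)
  moreover have "finite (insert j ?F) \<and> (\<forall>k\<in>insert j ?F. g'' k \<in> gr_hom L (shift M k))"
    using g(1) g'' by simp
  ultimately show ?thesis
    unfolding Hom_gmod_def partial_object.simps mem_Collect_eq by blast
qed

section \<open>Cohomology of the Hom complex in one internal degree\<close>

context free_complex
begin

text \<open>Exactness of the degree \<open>j\<close> strand of the Hom complex, stated without
  cosets, extensional maps or finite families. The lemma \<open>cohomology_gr_eq_zero_iff\<close>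
  ties it to the cohomology.\<close>

definition homogeneous_exact :: "int \<Rightarrow> int \<Rightarrow> ('a, 'y) gmod \<Rightarrow> bool" where
  "homogeneous_exact n j Y \<longleftrightarrow> (\<forall>f\<in>gr_hom (ob P n) (shift Y j).
     (\<forall>x\<in>Ob (n - 1). f (df P (n - 1) x) = \<zero>\<^bsub>Y\<^esub>) \<longrightarrow>
     (\<exists>g\<in>gr_hom (ob P (n + 1)) (shift Y j). \<forall>x\<in>Ob n. f x = g (df P n x)))"

lemma df_closed: "x \<in> Ob n \<Longrightarrow> df P n x \<in> Ob (n + 1)"
  by (rule gr_homD(1)[OF df_hom])

lemma df_closed': "x \<in> Ob (n - 1) \<Longrightarrow> df P (n - 1) x \<in> Ob n"
  by (rule gr_homD(1)[OF df_hom'])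

lemma coboundaries_Hom_cpx:
  "coboundaries (Hom_cpx scale P Y) (- n) =
     (\<lambda>h. \<lambda>x\<in>Ob n. h (df P n x)) ` carrier (Hom_gmod scale (ob P (n + 1)) Y)"
proof -
  have eq: "- (- n - 1) = n + 1" "n + 1 - 1 = n" by simp_all
  show ?thesis unfolding coboundaries_def Hom_cpx_def cpx.simps eq
    by (simp add: Hom_gmod_def)
qed

lemma cocycles_Hom_cpx:
  "f \<in> cocycles (Hom_cpx scale P Y) (- n) \<longleftrightarrow> f \<in> carrier (Hom_gmod scale (ob P n) Y) \<and>
     (\<forall>x\<in>Ob (n - 1). f (df P (n - 1) x) = \<zero>\<^bsub>Y\<^esub>)"
proof -
  have eq: "- (- n + 1) = n - 1" "- (- n) - 1 = n - 1" by simp_all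
  have "(\<lambda>x\<in>Ob (n - 1). f (df P (n - 1) x)) = (\<lambda>x\<in>Ob (n - 1). \<zero>\<^bsub>Y\<^esub>) \<longleftrightarrow>
     (\<forall>x\<in>Ob (n - 1). f (df P (n - 1) x) = \<zero>\<^bsub>Y\<^esub>)"
    by (auto simp: fun_eq_iff)
  then show ?thesis unfolding cocycles_def Hom_cpx_def cpx.simps eq by (simp add: Hom_gmod_def)
qed

abbreviation Hom_add :: "int \<Rightarrow> ('a, 'y) gmod \<Rightarrow> ('p \<Rightarrow> 'y) \<Rightarrow> ('p \<Rightarrow> 'y) \<Rightarrow> 'p \<Rightarrow> 'y" where
  "Hom_add n Y \<equiv> \<lambda>h f. \<lambda>x\<in>Ob n. h x \<oplus>\<^bsub>Y\<^esub> f x"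

abbreviation hom_cocycles :: "int \<Rightarrow> int \<Rightarrow> ('a, 'y) gmod \<Rightarrow> ('p \<Rightarrow> 'y) set" where
  "hom_cocycles n j Y \<equiv> gr_hom (ob P n) (shift Y j) \<inter> extensional (Ob n) \<inter>
     cocycles (Hom_cpx scale P Y) (- n)"

lemma restrict_hom_cocycles:
  assumes "graded_module G Y" "f \<in> gr_hom (ob P n) (shift Y j)"
    and "\<forall>x\<in>Ob (n - 1). f (df P (n - 1) x) = \<zero>\<^bsub>Y\<^esub>"
  shows "restrict f (Ob n) \<in> hom_cocycles n j Y"
proof (intro IntI cocycles_Hom_cpx[THEN iffD2] conjI ballI)
  show "restrict f (Ob n) (df P (n - 1) x) = \<zero>\<^bsub>Y\<^esub>" if "x \<in> Ob (n - 1)" for x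
    using assms(3) that df_closed'[OF that] by simp
qed (rule gr_hom_restrict[OF graded_module_ob assms(2)] restrict_extensional
    Hom_gmod_carrierI[OF graded_module_ob assms(1,2)])+

text \<open>A graded piece of the cohomology is an image of this set; it must be inhabited for the
  piece to be the zero singleton instead of the empty set.\<close>

lemma hom_cocycles_nonempty:
  assumes "graded_module G Y" shows "hom_cocycles n j Y \<noteq> {}"
proof -
  interpret Y: graded_module G Y by fact
  interpret Ys: graded_module G "shift Y j" by (rule Y.shift_graded_module)
  have "(\<lambda>x. \<zero>\<^bsub>Y\<^esub>) \<in> gr_hom (ob P n) (shift Y j)" using Ys.gr_hom_const_zero by simp
  from restrict_hom_cocycles[OF assms this] show ?thesis by auto
qed

abbreviation Ext_cohomology :: "int \<Rightarrow> ('a, 'y) gmod \<Rightarrow> ('k, ('p \<Rightarrow> 'y) set) gmod" where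
  "Ext_cohomology n Y \<equiv> cohomology (Hom_cpx scale P Y) (- n)"

lemma cohomology_Hom_cpx:
  "zero (Ext_cohomology n Y) = coboundaries (Hom_cpx scale P Y) (- n)"
  "carrier (Ext_cohomology n Y) =
     (\<lambda>f. (\<lambda>h. Hom_add n Y h f) ` coboundaries (Hom_cpx scale P Y) (- n)) `
       cocycles (Hom_cpx scale P Y) (- n)"
  "gr (Ext_cohomology n Y) j =
     (\<lambda>f. (\<lambda>h. Hom_add n Y h f) ` coboundaries (Hom_cpx scale P Y) (- n)) `
       hom_cocycles n j Y"
proof -
  let ?H = "Hom_cpx scale P Y"
  have add: "add (sub_gmod (ob ?H (- n)) Z) = Hom_add n Y" for Z
    unfolding sub_gmod_def Hom_cpx_def Hom_gmod_def by simp
  have rcos: "a_r_coset (sub_gmod (ob ?H (- n)) Z) N = (\<lambda>f. (\<lambda>h. Hom_add n Y h f) ` N)" for Z N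
    unfolding a_r_coset_def' add by (auto simp: fun_eq_iff)
  show "zero (cohomology ?H (- n)) = coboundaries ?H (- n)"
    unfolding cohomology_def quot_gmod_def by simp
  show "carrier (cohomology ?H (- n)) =
     (\<lambda>f. (\<lambda>h. Hom_add n Y h f) ` coboundaries ?H (- n)) ` cocycles ?H (- n)"
    unfolding cohomology_def quot_gmod_def partial_object.simps A_RCOSETS_def' rcos
    by (auto simp: sub_gmod_def)
  show "gr (cohomology ?H (- n)) j =
     (\<lambda>f. (\<lambda>h. Hom_add n Y h f) ` coboundaries ?H (- n)) `
       hom_cocycles n j Y"
    unfolding cohomology_def quot_gmod_def gmod.simps rcos
    by (simp add: sub_gmod_def Hom_cpx_def Hom_gmod_def)
qed

lemma cohomology_gr_eq_zeroI:
  assumes Y: "graded_module G Y" and ex: "homogeneous_exact n j Y"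
  shows "gr (Ext_cohomology n Y) j = {\<zero>\<^bsub>Ext_cohomology n Y\<^esub>}"
proof -
  let ?B = "coboundaries (Hom_cpx scale P Y) (- n)"
  let ?d = "\<lambda>h. \<lambda>x\<in>Ob n. h (df P n x)"
  interpret Y: graded_module G Y by (rule Y)
  interpret Ys: graded_module G "shift Y j" by (rule Y.shift_graded_module)
  let ?Z = "hom_cocycles n j Y"
  \<comment> \<open>When \<open>f\<close> is the coboundary of \<open>g\<close>, translation by
    \<open>f\<close> sends the coboundary of \<open>h\<close> to that of \<open>h + g\<close>, and
    the coboundary of \<open>h - g\<close> to that of \<open>h\<close>. So it maps \<open>?B\<close>
    onto itself.\<close>
  have coset: "(\<lambda>h. Hom_add n Y h f) ` ?B = ?B" if f: "f \<in> ?Z" for f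
  proof -
    have "\<forall>x\<in>Ob (n - 1). f (df P (n - 1) x) = \<zero>\<^bsub>Y\<^esub>"
      using f by (simp add: cocycles_Hom_cpx)
    then obtain g where g: "g \<in> gr_hom (ob P (n + 1)) (shift Y j)" "\<forall>x\<in>Ob n. f x = g (df P n x)"
      using ex[unfolded homogeneous_exact_def] f by auto
    have g': "(\<lambda>x. \<ominus>\<^bsub>Y\<^esub> g x) \<in> gr_hom (ob P (n + 1)) (shift Y j)"
    proof -
      have "\<ominus>\<^bsub>shift Y j\<^esub> y = \<ominus>\<^bsub>Y\<^esub> y" for y unfolding a_inv_def m_inv_def by simp
      then show ?thesis using Ys.gr_hom_minus[OF g(1)] by simp
    qed
    have hc: "h y \<in> carrier Y" if hy: "h \<in> carrier (Hom_gmod scale (ob P (n + 1)) Y)" "y \<in> Ob (n + 1)" for h y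
    proof -
      obtain F k where k [rule_format]: "finite F" "\<forall>j\<in>F. k j \<in> gr_hom (ob P (n + 1)) (shift Y j)"
        "h = (\<lambda>x\<in>Ob (n + 1). \<Oplus>\<^bsub>Y\<^esub>j\<in>F. k j x)"
        by (rule Hom_gmod_carrierE[OF hy(1)])
      then show ?thesis using hy(2) gr_homD(1)[OF k(2)] by (auto intro!: Y.finsum_closed)
    qed
    show ?thesis
    proof (intro equalityI subsetI)
      fix u assume "u \<in> (\<lambda>h. Hom_add n Y h f) ` ?B"
      then obtain h where h: "h \<in> carrier (Hom_gmod scale (ob P (n + 1)) Y)" "u = Hom_add n Y (?d h) f"
        unfolding coboundaries_Hom_cpx by auto
      have "u = ?d (Hom_add (n + 1) Y h g)"
        unfolding h(2) using g(2) by (auto simp: fun_eq_iff df_closed)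
      then show "u \<in> ?B"
        unfolding coboundaries_Hom_cpx
        using Hom_gmod_add_homogeneous[OF graded_module_ob Y h(1) g(1)] by (rule image_eqI)
    next
      fix u assume "u \<in> ?B"
      then obtain h where h: "h \<in> carrier (Hom_gmod scale (ob P (n + 1)) Y)" "u = ?d h"
        unfolding coboundaries_Hom_cpx by auto
      have mem: "?d (Hom_add (n + 1) Y h (\<lambda>x. \<ominus>\<^bsub>Y\<^esub> g x)) \<in> ?B"
        unfolding coboundaries_Hom_cpx
        using Hom_gmod_add_homogeneous[OF graded_module_ob Y h(1) g'] by (rule imageI)
      have "u = Hom_add n Y (?d (Hom_add (n + 1) Y h (\<lambda>x. \<ominus>\<^bsub>Y\<^esub> g x))) f"
      proof
        fix x
        show "u x = Hom_add n Y (?d (Hom_add (n + 1) Y h (\<lambda>x. \<ominus>\<^bsub>Y\<^esub> g x))) f x"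
        proof (cases "x \<in> Ob n")
          case True
          then have "g (df P n x) \<in> carrier Y" "h (df P n x) \<in> carrier Y"
            using gr_homD(1)[OF g(1) df_closed[OF True]] hc[OF h(1) df_closed[OF True]] by simp_all
          then show ?thesis unfolding h(2) using True g(2)
            by (simp add: df_closed Y.a_assoc Y.l_neg)
        next
          case False
          then show ?thesis unfolding h(2) by simp
        qed
      qed
      then show "u \<in> (\<lambda>h. Hom_add n Y h f) ` ?B" using mem by (rule image_eqI)
    qed
  qed
  have "(\<lambda>f. (\<lambda>h. Hom_add n Y h f) ` ?B) ` ?Z = (\<lambda>_. ?B) ` ?Z" by (rule image_cong[OF refl coset])
  also have "\<dots> = {?B}" by (rule image_constant_conv[THEN trans]) (simp only: hom_cocycles_nonempty[OF Y] if_False)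
  finally have "(\<lambda>f. (\<lambda>h. Hom_add n Y h f) ` ?B) ` ?Z = {?B}" .
  then show ?thesis unfolding cohomology_Hom_cpx(1) cohomology_Hom_cpx(3) .
qed

text \<open>Vanishing of the class of \<open>f\<close> yields only a possibly inhomogeneous
  \<open>h\<close> whose coboundary is \<open>f\<close>. Comparing components on homogeneous
  elements shows that the degree \<open>j\<close> part of \<open>h\<close> already suffices.\<close>

lemma homogeneous_exactI:
  assumes Y: "graded_module G Y"
    and zero: "gr (Ext_cohomology n Y) j = {\<zero>\<^bsub>Ext_cohomology n Y\<^esub>}"
  shows "homogeneous_exact n j Y"
  unfolding homogeneous_exact_def
proof (intro ballI impI)
  let ?B = "coboundaries (Hom_cpx scale P Y) (- n)"
  let ?d = "\<lambda>h. \<lambda>x\<in>Ob n. h (df P n x)"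
  interpret Y: graded_module G Y by (rule Y)
  interpret Ys: graded_module G "shift Y j" by (rule Y.shift_graded_module)
  interpret P: graded_module G "ob P n" by (rule graded_module_ob)
  fix f assume f: "f \<in> gr_hom (ob P n) (shift Y j)" "\<forall>x\<in>Ob (n - 1). f (df P (n - 1) x) = \<zero>\<^bsub>Y\<^esub>"
  let ?f = "restrict f (Ob n)"
  have "(\<lambda>h. Hom_add n Y h ?f) ` ?B \<in> gr (Ext_cohomology n Y) j"
    unfolding cohomology_Hom_cpx(3) by (intro imageI restrict_hom_cocycles[OF Y f])
  then have eq: "(\<lambda>h. Hom_add n Y h ?f) ` ?B = ?B" unfolding zero cohomology_Hom_cpx(1) by (rule singletonD)
  have zY: "(\<lambda>x. \<zero>\<^bsub>Y\<^esub>) \<in> gr_hom (ob P (n + 1)) (shift Y j)" using Ys.gr_hom_const_zero by simp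
  \<comment> \<open>The coset of \<open>?f\<close> contains \<open>?f\<close> itself, as the
    translate of the zero coboundary. Since the coset equals \<open>?B\<close>, the map
    \<open>?f\<close> is a coboundary.\<close>
  have "?d (\<lambda>x\<in>Ob (n + 1). \<zero>\<^bsub>Y\<^esub>) \<in> ?B"
    unfolding coboundaries_Hom_cpx by (intro imageI Hom_gmod_carrierI[OF graded_module_ob Y zY])
  then have "Hom_add n Y (?d (\<lambda>x\<in>Ob (n + 1). \<zero>\<^bsub>Y\<^esub>)) ?f \<in> (\<lambda>h. Hom_add n Y h ?f) ` ?B"
    by (rule imageI)
  moreover have "Hom_add n Y (?d (\<lambda>x\<in>Ob (n + 1). \<zero>\<^bsub>Y\<^esub>)) ?f = ?f"
    using gr_homD(1)[OF f(1)] by (auto simp: fun_eq_iff df_closed)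
  ultimately have "?f \<in> ?B" unfolding eq by simp
  then obtain h where h: "h \<in> carrier (Hom_gmod scale (ob P (n + 1)) Y)" "?f = ?d h"
    unfolding coboundaries_Hom_cpx by (rule imageE)
  obtain F k where k [rule_format]: "finite F" "\<forall>i\<in>F. k i \<in> gr_hom (ob P (n + 1)) (shift Y i)"
    "h = (\<lambda>x\<in>Ob (n + 1). \<Oplus>\<^bsub>Y\<^esub>i\<in>F. k i x)"
    by (rule Hom_gmod_carrierE[OF h(1)])
  \<comment> \<open>If no member of the family has degree \<open>j\<close>, the degree
    \<open>j\<close> part of \<open>h\<close> is zero.\<close>
  let ?g = "if j \<in> F then k j else (\<lambda>x. \<zero>\<^bsub>Y\<^esub>)"
  have g: "?g \<in> gr_hom (ob P (n + 1)) (shift Y j)" using k(2) zY by simp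
  have gd: "(\<lambda>x. ?g (df P n x)) \<in> gr_hom (ob P n) (shift Y j)"
    by (rule gr_hom_comp[OF df_hom g])
  have hom: "f x = ?g (df P n x)" if x: "x \<in> gr (ob P n) i" for x i
  proof -
    have xc: "x \<in> Ob n" by (rule P.gr_carrier[OF x])
    have dx: "df P n x \<in> gr (ob P (n + 1)) i" by (rule gr_homD(4)[OF df_hom x])
    have kc: "k l (df P n x) \<in> gr Y (i + l)" if "l \<in> F" for l
      using gr_homD(4)[OF k(2)[OF that] dx] by simp
    have "f x = h (df P n x)" using fun_cong[OF h(2), of x] xc by simp
    also have "\<dots> = (\<Oplus>\<^bsub>Y\<^esub>l\<in>F. k l (df P n x))" unfolding k(3) using df_closed[OF xc] by simp
    finally have fx: "f x = (\<Oplus>\<^bsub>Y\<^esub>l\<in>F. k l (df P n x))" .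
    have "f x = Y.component (i + j) (f x)"
      using Y.component_gr[of "f x" "i + j"] gr_homD(4)[OF f(1) x] by simp
    also have "\<dots> = (\<Oplus>\<^bsub>Y\<^esub>l\<in>F. Y.component (i + j) (k l (df P n x)))"
      unfolding fx by (rule Y.component_finsum) (use kc Y.gr_carrier in blast)
    also have "\<dots> = (\<Oplus>\<^bsub>Y\<^esub>l\<in>F. if l = j then ?g (df P n x) else \<zero>\<^bsub>Y\<^esub>)"
      by (rule Y.finsum_cong') (use Y.gr_carrier[OF kc] Y.component_gr[OF kc] in auto)
    also have "\<dots> = ?g (df P n x)"
    proof (cases "j \<in> F")
      case True
      have "?g (df P n x) \<in> carrier Y" using gr_homD(1)[OF g df_closed[OF xc]] by simp
      then show ?thesis by (rule Y.finsum_single[OF k(1) True])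
    next
      case False
      then show ?thesis by (auto intro!: Y.add.finprod_one_eqI)
    qed
    finally show ?thesis .
  qed
  show "\<exists>g\<in>gr_hom (ob P (n + 1)) (shift Y j). \<forall>x\<in>Ob n. f x = g (df P n x)"
  proof (rule bexI[OF _ g], rule ballI)
    fix x assume x: "x \<in> Ob n"
    show "f x = ?g (df P n x)"
      by (rule gr_hom_eq_on_homogeneous[where g = "\<lambda>x. ?g (df P n x)",
            OF graded_module_ob Y.shift_graded_module f(1) gd _ x]) (rule hom)
  qed
qed

lemma cohomology_gr_eq_zero_iff:
  "graded_module G Y \<Longrightarrow>
    gr (Ext_cohomology n Y) j = {\<zero>\<^bsub>Ext_cohomology n Y\<^esub>} \<longleftrightarrow>
    homogeneous_exact n j Y"
  by (rule iffI; (rule homogeneous_exactI | rule cohomology_gr_eq_zeroI); assumption)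

lemma cohomology_zero_imp_exact:
  assumes Y: "graded_module G Y"
    and zero: "carrier (Ext_cohomology n Y) = {\<zero>\<^bsub>Ext_cohomology n Y\<^esub>}"
  shows "homogeneous_exact n j Y"
proof (rule homogeneous_exactI[OF Y])
  have "gr (Ext_cohomology n Y) j \<subseteq> carrier (Ext_cohomology n Y)"
    unfolding cohomology_Hom_cpx by (intro image_mono) simp
  moreover have "gr (Ext_cohomology n Y) j \<noteq> {}"
    unfolding cohomology_Hom_cpx(3) image_is_empty by (rule hom_cocycles_nonempty[OF Y])
  ultimately show "gr (Ext_cohomology n Y) j = {\<zero>\<^bsub>Ext_cohomology n Y\<^esub>}"
    unfolding zero by (simp only: subset_singleton_iff simp_thms)
qed

lemma homogeneous_exact_regular: "homogeneous_exact n j (regular G) \<longleftrightarrow> ext_vanishes n j UNIV {0}"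
  unfolding homogeneous_exact_def ext_vanishes_def by simp

lemma proj_hom:
  assumes N: "left_ideal UNIV N" "degree_ge 1 \<subseteq> N" and f: "f \<in> Hom_deg n j"
  shows "(\<lambda>x. N +>\<^bsub>regular G\<^esub> f x) \<in> gr_hom (ob P n) (shift (quot_gmod (regular G) N) j)"
proof -
  note Q = quot_regular_simps[OF N(1)]
  interpret Q: graded_module G "quot_gmod (regular G) N" by (rule graded_module_quot[OF N])
  show ?thesis
    using f unfolding gr_hom_shift_regular_iff gr_hom_def shift_simps by (auto simp: Q intro!: imageI)
qed

text \<open>Projectivity of a graded free module: the values on the basis are lifted to homogeneous
  elements of \<open>A\<close>, and two maps that agree on the basis are equal.\<close>

lemma lift_to_regular:
  assumes N: "left_ideal UNIV N" "degree_ge 1 \<subseteq> N"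
    and f: "f \<in> gr_hom (ob P n) (shift (quot_gmod (regular G) N) j)"
  obtains f' where "f' \<in> Hom_deg n j" "\<forall>x\<in>Ob n. N +>\<^bsub>regular G\<^esub> f' x = f x"
proof -
  note Q = quot_regular_simps[OF N(1)]
  interpret Q: graded_module G "quot_gmod (regular G) N" by (rule graded_module_quot[OF N])
  obtain B deg coord where basis: "graded_basis G (ob P n) B deg coord" by (rule obtain_basis)
  interpret B: graded_basis G "ob P n" B deg coord by (rule basis)
  have "\<exists>y. y \<in> gr (regular G) (deg b + j) \<and> N +>\<^bsub>regular G\<^esub> y = f b" if "b \<in> B" for b
    using gr_homD(4)[OF f B.basis_gr[OF that]] unfolding shift_simps Q by auto
  then obtain y where y: "\<And>b. b \<in> B \<Longrightarrow> y b \<in> gr (regular G) (deg b + j)"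
    "\<And>b. b \<in> B \<Longrightarrow> N +>\<^bsub>regular G\<^esub> y b = f b"
    by metis
  obtain f' where f': "f' \<in> Hom_deg n j" "\<And>b. b \<in> B \<Longrightarrow> f' b = y b"
    by (rule hom_extension[OF basis y(1)]) auto
  have "N +>\<^bsub>regular G\<^esub> f' x = f x" if "x \<in> Ob n" for x
    by (rule B.gr_hom_eq_on_basis[OF Q.shift_graded_module proj_hom[OF N f'(1)] f _ that])
      (use f'(2) y(2) in simp)
  then show ?thesis using that[OF f'(1)] by blast
qed

text \<open>Both cocycles and bounding maps lift along the projection of \<open>A\<close> onto the
  quotient, and an equality of cosets becomes membership of a difference in
  \<open>N\<close>.\<close>

lemma homogeneous_exact_quot:
  assumes N: "left_ideal UNIV N" "degree_ge 1 \<subseteq> N"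
  shows "homogeneous_exact n j (quot_gmod (regular G) N) \<longleftrightarrow> ext_vanishes n j UNIV N"
proof
  let ?Q = "quot_gmod (regular G) N"
  let ?p = "\<lambda>x. N +>\<^bsub>regular G\<^esub> x"
  note Q = quot_regular_simps[OF N(1)]
  interpret Q: graded_module G ?Q by (rule graded_module_quot[OF N])
  assume ex: "homogeneous_exact n j ?Q"
  show "ext_vanishes n j UNIV N"
  proof (rule ext_vanishesI)
    fix f assume f: "f \<in> Hom_deg n j" "\<And>x. x \<in> Ob (n - 1) \<Longrightarrow> f (df P (n - 1) x) \<in> N"
    have "?p (f (df P (n - 1) x)) = \<zero>\<^bsub>?Q\<^esub>" if "x \<in> Ob (n - 1)" for x
      unfolding Q coset_regular_eq_iff[OF N(1)] using f(2)[OF that] by simp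
    then obtain g' where g': "g' \<in> gr_hom (ob P (n + 1)) (shift ?Q j)"
      "\<forall>x\<in>Ob n. ?p (f x) = g' (df P n x)"
      using ex[unfolded homogeneous_exact_def, rule_format, OF proj_hom[OF N f(1)]] by blast
    obtain g where g: "g \<in> Hom_deg (n + 1) j" "\<forall>x\<in>Ob (n + 1). ?p (g x) = g' x"
      by (rule lift_to_regular[OF N g'(1)])
    have "f x - g (df P n x) \<in> N" if "x \<in> Ob n" for x
      unfolding coset_regular_eq_iff[OF N(1), symmetric] using g'(2) g(2) that df_closed[OF that] by simp
    then show "cobounds n j UNIV N f"
      by (intro bexI[OF _ g(1)]) simp
  qed
next
  let ?Q = "quot_gmod (regular G) N"
  let ?p = "\<lambda>x. N +>\<^bsub>regular G\<^esub> x"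
  note Q = quot_regular_simps[OF N(1)]
  assume v: "ext_vanishes n j UNIV N"
  show "homogeneous_exact n j ?Q"
    unfolding homogeneous_exact_def
  proof (intro ballI impI)
    fix f' assume f': "f' \<in> gr_hom (ob P n) (shift ?Q j)"
      "\<forall>x\<in>Ob (n - 1). f' (df P (n - 1) x) = \<zero>\<^bsub>?Q\<^esub>"
    obtain f where f: "f \<in> Hom_deg n j" "\<forall>x\<in>Ob n. ?p (f x) = f' x"
      by (rule lift_to_regular[OF N f'(1)])
    have fN: "f (df P (n - 1) x) \<in> N" if "x \<in> Ob (n - 1)" for x
    proof -
      have "?p (f (df P (n - 1) x)) = ?p 0" using f(2) f'(2) that df_closed'[OF that] Q(2) by simp
      then show ?thesis unfolding coset_regular_eq_iff[OF N(1)] by simp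
    qed
    obtain g where g: "g \<in> Hom_deg (n + 1) j" "\<forall>x\<in>Ob n. f x - g (df P n x) \<in> N"
      by (rule ext_vanishesE[OF v f(1) UNIV_I fN])
    have "f' x = ?p (g (df P n x))" if "x \<in> Ob n" for x
    proof -
      have "?p (f x) = ?p (g (df P n x))" unfolding coset_regular_eq_iff[OF N(1)] using g(2) that by simp
      then show ?thesis using f(2) that by simp
    qed
    then show "\<exists>g\<in>gr_hom (ob P (n + 1)) (shift ?Q j). \<forall>x\<in>Ob n. f' x = g (df P n x)"
      by (intro bexI[OF _ proj_hom[OF N g(1)]]) simp
  qed
qed

end

section \<open>Comparison of the coefficients \<open>A\<close> and \<open>S\<close>\<close>

text \<open>A left ideal of \<open>A\<close>, realised on the type over which \<open>pdim\<close> quantifies.\<close>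

definition embedded_ideal ::
  "(nat \<Rightarrow> 'a::{ring,monoid_mult} set) \<Rightarrow> 'a set \<Rightarrow> ('a, nat \<Rightarrow> 'a) gmod" where
  "embedded_ideal G N = \<lparr>carrier = {c. c 0 \<in> N \<and> (\<forall>i>0. c i = 0)}, mult = undefined, one = undefined,
     zero = (\<lambda>i. 0), add = (\<lambda>c c' i. c i + c' i), smult = (\<lambda>a c i. a * c i),
     gr = (\<lambda>k. {c. c 0 \<in> N \<inter> gr (regular G) k \<and> (\<forall>i>0. c i = 0)})\<rparr>"

lemma embedded_ideal_simps [simp]:
  "carrier (embedded_ideal G N) = {c. c 0 \<in> N \<and> (\<forall>i>0. c i = 0)}"
  "zero (embedded_ideal G N) = (\<lambda>i. 0)"
  "add (embedded_ideal G N) = (\<lambda>c c' i. c i + c' i)"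
  "smult (embedded_ideal G N) = (\<lambda>a c i. a * c i)"
  "gr (embedded_ideal G N) k = {c. c 0 \<in> N \<inter> gr (regular G) k \<and> (\<forall>i>0. c i = 0)}"
  unfolding embedded_ideal_def by simp_all

lemma (in graded_algebra) graded_module_embedded_ideal:
  assumes N: "graded_left_ideal N"
  shows "graded_module G (embedded_ideal G N)"
proof -
  let ?E = "embedded_ideal G N"
  note lN = graded_left_idealD(1)[OF N]
  note D = left_idealD[OF lN]
  have neg: "- x \<in> N" if "x \<in> N" for x using D(4)[OF D(1) that] by simp
  have ab: "abelian_group ?E"
  proof (rule abelian_groupI)
    fix c assume c: "c \<in> carrier ?E"
    show "\<exists>c'\<in>carrier ?E. c' \<oplus>\<^bsub>?E\<^esub> c = \<zero>\<^bsub>?E\<^esub>"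
      by (rule bexI[of _ "\<lambda>i. - c i"]) (use c neg in auto)
  qed (use D(1,2) in \<open>auto simp: algebra_simps\<close>)
  interpret E: abelian_group ?E by (rule ab)
  have inv: "\<ominus>\<^bsub>?E\<^esub> c = (\<lambda>i. - c i)" if "c \<in> carrier ?E" for c
    by (rule E.minus_equality) (use that neg in auto)
  show ?thesis
  proof (intro graded_module.intro graded_module_axioms.intro ab)
    fix k
    have "- x \<in> gr (regular G) k" if "x \<in> gr (regular G) k" for x
      using smult_gr_regular[OF graded_module_regular, of "- 1" 0 x k] that one_component
        subspace_neg[OF subspace_component, of 1 0] by (simp add: gr_regular)
    then show "additive_subgroup (gr ?E k) ?E"
      using D(1,2) neg A.zero_gr[of k] A.add_gr[of _ k] inv
      by (intro additive_subgroupI, intro E.add.subgroupI) auto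
  next
    fix c assume c: "c \<in> carrier ?E"
    let ?p = "\<lambda>k c i. if i = (0::nat) then A.component k (c 0) else (0::'a)"
    show "\<exists>!f. (\<forall>i. f i \<in> gr ?E i) \<and> finite {i. f i \<noteq> \<zero>\<^bsub>?E\<^esub>} \<and> c = (\<Oplus>\<^bsub>?E\<^esub>i\<in>{i. f i \<noteq> \<zero>\<^bsub>?E\<^esub>}. f i)"
    proof (rule direct_sum_by_projections[OF ab, where p = ?p])
      have supp: "{k. ?p k c \<noteq> \<zero>\<^bsub>?E\<^esub>} = {k. A.component k (c 0) \<noteq> 0}"
        by (auto simp: fun_eq_iff)
      show "finite {k. ?p k c \<noteq> \<zero>\<^bsub>?E\<^esub>}" unfolding supp by (rule finite_component_support)
      have mem: "?p k c \<in> carrier ?E" for k using c graded_left_idealD(2)[OF N] by simp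
      let ?S = "\<Oplus>\<^bsub>?E\<^esub>k\<in>{k. ?p k c \<noteq> \<zero>\<^bsub>?E\<^esub>}. ?p k c"
      have "?S 0 = finsum (regular G) (\<lambda>k. ?p k c 0) {k. ?p k c \<noteq> \<zero>\<^bsub>?E\<^esub>}"
        by (rule finsum_additive_map[of ?E "regular G" "\<lambda>c. c 0"])
          (use E.abelian_monoid_axioms A.abelian_monoid_axioms mem in auto)
      also have "\<dots> = c 0" unfolding supp by (simp add: component_sum_eq)
      finally have "?S 0 = c 0" .
      moreover have "?S \<in> carrier ?E" by (rule E.finsum_closed) (use mem in auto)
      ultimately have "c i = ?S i" for i using c by (cases "i = 0") auto
      then show "c = ?S" by (rule ext)
    qed (use c graded_left_idealD(2)[OF N] A.component_props(1) A.component_add A.component_gr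
        in \<open>auto simp: fun_eq_iff\<close>)
  next
    fix a n c k assume "a \<in> G n" "c \<in> gr ?E k"
    then show "a \<odot>\<^bsub>?E\<^esub> c \<in> gr ?E (int n + k)" using D(3) A.smult_gr by simp
  qed (use D(3) in \<open>auto simp: algebra_simps\<close>)
qed

context free_complex
begin

lemma homogeneous_exact_embedded_ideal:
  assumes N: "graded_left_ideal N" and ex: "homogeneous_exact n j (embedded_ideal G N)"
  shows "ext_vanishes n j N {0}"
proof (rule ext_vanishesI)
  let ?E = "embedded_ideal G N"
  interpret E: graded_module G ?E by (rule graded_module_embedded_ideal[OF N])
  fix f assume f: "f \<in> Hom_deg n j" "\<And>x. x \<in> Ob n \<Longrightarrow> f x \<in> N"
    "\<And>x. x \<in> Ob (n - 1) \<Longrightarrow> f (df P (n - 1) x) \<in> {0}"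
  interpret P: graded_module G "ob P n" by (rule graded_module_ob)
  let ?f = "\<lambda>x i. if i = (0::nat) then f x else 0"
  have hf: "?f \<in> gr_hom (ob P n) (shift ?E j)"
    using f(1,2) P.gr_carrier unfolding gr_hom_shift_regular_iff gr_hom_def shift_simps
    by (auto simp: fun_eq_iff image_subset_iff)
  have "\<forall>x\<in>Ob (n - 1). ?f (df P (n - 1) x) = \<zero>\<^bsub>?E\<^esub>"
    using f(3) by auto
  from ex[unfolded homogeneous_exact_def, THEN bspec, OF hf, THEN mp, OF this]
  obtain g where g: "g \<in> gr_hom (ob P (n + 1)) (shift ?E j)"
    "\<forall>x\<in>Ob n. ?f x = g (df P n x)"
    by (rule bexE)
  let ?g = "\<lambda>x. g x 0"
  have gN: "?g x \<in> N" if "x \<in> Ob (n + 1)" for x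
    using gr_homD(1)[OF g(1) that] by (simp add: shift_simps)
  have "?g \<in> Hom_deg (n + 1) j"
    using gr_homD[OF g(1)] unfolding gr_hom_shift_regular_iff shift_simps by auto
  moreover have "f x - ?g (df P n x) \<in> {0}" if "x \<in> Ob n" for x
    using fun_cong[OF bspec[OF g(2) that], of 0] by simp
  ultimately show "cobounds n j N {0} f"
    using gN by (intro bexI[of _ ?g]) auto
qed

lemma inf_deg_regular:
  "inf_deg (Hom_cpx scale P (regular G)) =
     Inf {ereal (real_of_int (i + j)) | i j. \<not> ext_vanishes (- i) j UNIV {0}}"
  unfolding inf_deg_def
  using cohomology_gr_eq_zero_iff[OF graded_module_regular, of "- i" for i]
  by (simp add: homogeneous_exact_regular)

lemma inf_deg_mod_jacobson:
  "inf_deg (Hom_cpx scale P (mod_jacobson G)) =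
     Inf {ereal (real_of_int (i + j)) | i j. \<not> ext_vanishes (- i) j UNIV (graded_jacobson G)}"
proof -
  note J = graded_left_idealD(1)[OF graded_left_ideal_jacobson] degree_ge_1_subset_jacobson
  show ?thesis
    unfolding inf_deg_def mod_jacobson_def
    using cohomology_gr_eq_zero_iff[OF graded_module_quot[OF J], of "- i" for i]
    by (simp add: homogeneous_exact_quot[OF J])
qed

text \<open>The contrapositive of \<open>ext_vanishes_degree_ge\<close> at \<open>d = 0\<close>: if
  Ext with coefficients \<open>A\<close> is nonzero in internal degree \<open>j\<close>, then Ext
  with coefficients \<open>S\<close> is nonzero in the same cohomological degree and some internal
  degree \<open>j' \<le> j\<close>.\<close>

lemma inf_deg_mod_jacobson_le:
  "inf_deg (Hom_cpx scale P (mod_jacobson G)) \<le> inf_deg (Hom_cpx scale P (regular G))"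
  unfolding inf_deg_regular
proof (rule Inf_greatest)
  fix r assume "r \<in> {ereal (real_of_int (i + j)) | i j. \<not> ext_vanishes (- i) j UNIV {0}}"
  then obtain i j where r: "r = ereal (real_of_int (i + j))" "\<not> ext_vanishes (- i) j UNIV {0}"
    by auto
  have "\<exists>j'\<le>j. \<not> ext_vanishes (- i) j' UNIV (graded_jacobson G)"
  proof (rule ccontr)
    assume "\<not> ?thesis"
    then have "ext_vanishes (- i) j (degree_ge 0) {0}"
      by (intro ext_vanishes_degree_ge) simp
    then show False using r(2) by (simp add: degree_ge_0)
  qed
  then obtain j' where j': "j' \<le> j" "\<not> ext_vanishes (- i) j' UNIV (graded_jacobson G)" by blast
  have "inf_deg (Hom_cpx scale P (mod_jacobson G)) \<le> ereal (real_of_int (i + j'))"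
    unfolding inf_deg_mod_jacobson by (rule Inf_lower) (use j'(2) in blast)
  also have "\<dots> \<le> r" unfolding r(1) using j'(1) by simp
  finally show "inf_deg (Hom_cpx scale P (mod_jacobson G)) \<le> r" .
qed

text \<open>Dimension shifting along \<open>0 \<rightarrow> A\<^bsub>\<ge>1\<^esub> \<rightarrow> A \<rightarrow> A/J \<rightarrow> 0\<close>: the layers of \<open>A\<^bsub>\<ge>1\<^esub>\<close> are extensions of shifts
  \<open>(A/m)(-d)\<close> with \<open>d \<ge> 1\<close>, and the shift by \<open>d\<close> compensates for the rise of the cohomological degree.\<close>

lemma inf_deg_regular_le:
  assumes "semisimple (G 0)"
    and fin: "\<And>n j. n < n\<^sub>0 \<Longrightarrow> ext_vanishes n j (degree_ge 1) {0}"
  shows "inf_deg (Hom_cpx scale P (regular G)) \<le> inf_deg (Hom_cpx scale P (mod_jacobson G))"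
    (is "?s \<le> _")
proof -
  have J: "graded_jacobson G = degree_ge 1" by (rule jacobson_semisimple[OF assms(1)])
  \<comment> \<open>The comparison takes place in the extended reals, so an infinite
    \<open>?s\<close> needs no separate treatment: for \<open>-\<infinity>\<close> the premise never
    holds, for \<open>\<infinity>\<close> it always does.\<close>
  have regular: "ext_vanishes n j UNIV {0}" if "ereal (real_of_int (j - n)) < ?s" for n j
  proof (rule ccontr)
    assume "\<not> ext_vanishes n j UNIV {0}"
    then have "?s \<le> ereal (real_of_int (- n + j))"
      unfolding inf_deg_regular by (intro Inf_lower CollectI exI[of _ "- n"] exI[of _ j]) simp
    then show False using that by simp
  qed
  have dimension_shift: "ext_vanishes n j UNIV (degree_ge 1)"
    if "ereal (real_of_int (j - n)) < ?s" "ext_vanishes (n - 1) j (degree_ge 1) {0}" for n j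
    using ext_vanishes_quotient[OF that(2) regular[OF that(1)]]
      left_ideal_degree_ge by simp
  have claim: "\<forall>j. ereal (real_of_int (j - n)) < ?s \<longrightarrow> ext_vanishes n j UNIV (degree_ge 1)"
    if "n\<^sub>0 \<le> n" for n
    using that
  proof (induction n rule: int_ge_induct)
    \<comment> \<open>The shift consults position \<open>n\<^sub>0 - 1\<close>, the first one to
      which \<open>fin\<close> applies.\<close>
    case base
    then show ?case using dimension_shift fin by simp
  next
    case (step n)
    show ?case
    proof (intro allI impI)
      fix j assume j: "ereal (real_of_int (j - (n + 1))) < ?s"
      \<comment> \<open>Going from position \<open>n + 1\<close> to \<open>n\<close> costs one in
        \<open>j - n\<close>, and the bound \<open>j' \<le> j - 1\<close> regains it. Hence the same
        \<open>?s\<close> serves at every step of the induction.\<close>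
      have "ext_vanishes n j' UNIV (graded_jacobson G)" if "j' \<le> j - 1" for j'
      proof -
        have "ereal (real_of_int (j' - n)) \<le> ereal (real_of_int (j - (n + 1)))" using that by simp
        then have "ereal (real_of_int (j' - n)) < ?s" using j by (rule order_le_less_trans)
        then show ?thesis unfolding J using step.IH by blast
      qed
      then have "ext_vanishes (n + 1 - 1) j (degree_ge 1) {0}"
        by (simp add: ext_vanishes_degree_ge)
      then show "ext_vanishes (n + 1) j UNIV (degree_ge 1)" by (rule dimension_shift[OF j])
    qed
  qed
  show ?thesis
    unfolding inf_deg_mod_jacobson
  proof (rule Inf_greatest)
    fix r assume "r \<in> {ereal (real_of_int (i + j)) | i j. \<not> ext_vanishes (- i) j UNIV (graded_jacobson G)}"
    then obtain i j where r: "r = ereal (real_of_int (i + j))"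
      "\<not> ext_vanishes (- i) j UNIV (degree_ge 1)" unfolding J by auto
    show "?s \<le> r"
    proof (rule ccontr)
      assume "\<not> ?s \<le> r"
      then have lt: "ereal (real_of_int (j - (- i))) < ?s" unfolding r(1) by (simp add: add.commute)
      show False
      proof (cases "n\<^sub>0 \<le> - i")
        case True
        then show False using claim lt r(2) by blast
      next
        case False
        then have "ext_vanishes (- i - 1) j (degree_ge 1) {0}" by (intro fin) simp
        then show False using dimension_shift[OF lt] r(2) by blast
      qed
    qed
  qed
qed

end

section \<open>Noetherian modules and free modules\<close>

context graded_module
begin

text \<open>The coefficients at \<open>x\<close> of elements of \<open>N\<close>, taken modulo
  \<open>H\<close>. With \<open>H\<close> generated by the other generators, this is the left ideal
  of \<open>A\<close> to which the noetherian hypothesis is applied.\<close>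

lemma coefficient_left_ideal:
  assumes H: "left_submodule M H" and N: "left_submodule M N" and x: "x \<in> carrier M"
  shows "left_ideal UNIV {a. \<exists>w\<in>H. a \<odot> x \<oplus> w \<in> N}"
  unfolding left_ideal_def
proof (intro conjI ballI)
  note H = left_submoduleD[OF H] and N = left_submoduleD[OF N]
  have "0 \<odot> x \<oplus> \<zero> = \<zero>" using zero_smult[OF x] by simp
  then show "0 \<in> {a. \<exists>w\<in>H. a \<odot> x \<oplus> w \<in> N}" using H(2) N(2) by (auto intro!: bexI[of _ \<zero>])
  fix a b assume "a \<in> {a. \<exists>w\<in>H. a \<odot> x \<oplus> w \<in> N}" "b \<in> {a. \<exists>w\<in>H. a \<odot> x \<oplus> w \<in> N}"
  then obtain w w' where w: "w \<in> H" "a \<odot> x \<oplus> w \<in> N" "w' \<in> H" "b \<odot> x \<oplus> w' \<in> N" by auto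
  have "(a \<odot> x \<oplus> w) \<oplus> (b \<odot> x \<oplus> w') = (a + b) \<odot> x \<oplus> (w \<oplus> w')"
    using H(1) w x smult_closed by (simp add: smult_l_distr a_ac)
  then have "(a + b) \<odot> x \<oplus> (w \<oplus> w') \<in> N" using N(3)[OF w(2,4)] by simp
  then show "a + b \<in> {a. \<exists>w\<in>H. a \<odot> x \<oplus> w \<in> N}" using H(3)[OF w(1,3)] by blast
next
  note H = left_submoduleD[OF H] and N = left_submoduleD[OF N]
  fix c a assume "a \<in> {a. \<exists>w\<in>H. a \<odot> x \<oplus> w \<in> N}"
  then obtain w where w: "w \<in> H" "a \<odot> x \<oplus> w \<in> N" by auto
  have "c \<odot> (a \<odot> x \<oplus> w) = (c * a) \<odot> x \<oplus> c \<odot> w"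
    using H(1)[OF w(1)] x smult_closed by (simp add: smult_r_distr smult_assoc)
  then have "(c * a) \<odot> x \<oplus> c \<odot> w \<in> N" using N(4)[OF w(2), of c] by simp
  then show "c * a \<in> {a. \<exists>w\<in>H. a \<odot> x \<oplus> w \<in> N}" using H(4)[OF w(1)] by blast
qed simp

text \<open>Induction on the number of generators. The part of \<open>N\<close> inside the span
  \<open>?H\<close> of the old generators is finitely generated by induction. The rest of
  \<open>N\<close> is governed by its coefficients at \<open>x\<close>, and a finite generating set
  of those lifts to \<open>N\<close>.\<close>

lemma noetherian_submodule:
  assumes noeth: "noetherian (UNIV :: 'a set)"
    and "finite F" "F \<subseteq> carrier M" "left_submodule M N" "N \<subseteq> left_submodule M hull F"
  shows "\<exists>F'. finite F' \<and> F' \<subseteq> N \<and> left_submodule M hull F' = N"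
  using assms(2-)
proof (induction F arbitrary: N rule: finite_induct)
  case empty
  then have "left_submodule M hull {} = N" by (intro equalityI hull_minimal) auto
  then show ?case by (intro exI[of _ "{}"]) simp
next
  case (insert x F)
  have x: "x \<in> carrier M" and F: "F \<subseteq> carrier M" using insert.prems by auto
  let ?H = "left_submodule M hull F"
  note subH = left_submodule_hull[OF F]
  note H = left_submoduleD[OF subH] and N = left_submoduleD[OF insert.prems(2)]
  obtain F\<^sub>1 where F\<^sub>1: "finite F\<^sub>1" "F\<^sub>1 \<subseteq> N \<inter> ?H" "left_submodule M hull F\<^sub>1 = N \<inter> ?H"
    using insert.IH[OF F left_submodule_Int[OF insert.prems(2) subH] Int_lower2] by (elim exE conjE)
  let ?I = "{a. \<exists>w\<in>?H. a \<odot> x \<oplus> w \<in> N}"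
  obtain A where A: "finite A" "left_ideal UNIV hull A = ?I"
    using noeth[unfolded noetherian_def, THEN conjunct1, rule_format,
        OF coefficient_left_ideal[OF subH insert.prems(2) x]]
    by (elim exE conjE)
  have "\<exists>w. w \<in> ?H \<and> a \<odot> x \<oplus> w \<in> N" if "a \<in> A" for a
    using hull_inc[OF that, of "left_ideal UNIV"] unfolding A(2) by auto
  then obtain w where w: "\<And>a. a \<in> A \<Longrightarrow> w a \<in> ?H" "\<And>a. a \<in> A \<Longrightarrow> a \<odot> x \<oplus> w a \<in> N"
    by metis
  let ?F' = "F\<^sub>1 \<union> (\<lambda>a. a \<odot> x \<oplus> w a) ` A"
  have sub: "?F' \<subseteq> N" using F\<^sub>1(2) w(2) by auto
  then have F'c: "?F' \<subseteq> carrier M" using N(1) by auto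
  let ?K = "left_submodule M hull ?F'"
  note subK = left_submodule_hull[OF F'c]
  note K = left_submoduleD[OF subK]
  have KN: "?K \<subseteq> N" using sub insert.prems(2) by (rule hull_minimal)
  \<comment> \<open>The coefficients realised inside \<open>?K\<close> form a left ideal containing
    the generators \<open>A\<close>, so every coefficient of an element of \<open>N\<close> is
    realised in \<open>?K\<close>.\<close>
  have "A \<subseteq> {a. \<exists>w\<in>?H. a \<odot> x \<oplus> w \<in> ?K}"
  proof
    fix a assume a: "a \<in> A"
    then have "a \<odot> x \<oplus> w a \<in> ?K" by (intro hull_inc) simp
    then show "a \<in> {a. \<exists>w\<in>?H. a \<odot> x \<oplus> w \<in> ?K}" using w(1)[OF a] by blast
  qed
  from hull_minimal[of _ _ "left_ideal UNIV", OF this coefficient_left_ideal[OF subH subK x]]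
  have IK: "?I \<subseteq> {a. \<exists>w\<in>?H. a \<odot> x \<oplus> w \<in> ?K}" unfolding A(2) .
  have "N \<subseteq> ?K"
  proof
    fix y assume y: "y \<in> N"
    then have "y \<in> left_submodule M hull (insert x F)" using insert.prems(3) by (rule subsetD[rotated])
    then obtain a v where v: "y = a \<odot> x \<oplus> v" "v \<in> ?H"
      unfolding left_submodule_hull_insert[OF F x] by auto
    then have "a \<in> ?I" using y by auto
    then obtain v' where v': "v' \<in> ?H" "a \<odot> x \<oplus> v' \<in> ?K" using IK by auto
    let ?m = "a \<odot> x \<oplus> v'"
    have mN: "?m \<in> N" using v'(2) KN by (rule subsetD[rotated])
    have c: "v \<in> carrier M" "v' \<in> carrier M" "a \<odot> x \<in> carrier M"
      using H(1) v(2) v'(1) x smult_closed by auto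
    \<comment> \<open>Equal coefficients at \<open>x\<close> cancel, so the difference falls into
      \<open>N \<inter> ?H\<close>, which \<open>F\<^sub>1\<close> generates.\<close>
    have diff: "y \<ominus> ?m = v \<ominus> v'"
      unfolding v(1) a_minus_def using c by (simp add: minus_add a_ac) (simp add: a_assoc[symmetric] r_neg)
    have "y \<ominus> ?m \<in> N \<inter> ?H"
      using left_submodule_minus[OF insert.prems(2) y mN]
        left_submodule_minus[OF subH v(2) v'(1)] diff by simp
    then have "y \<ominus> ?m \<in> ?K"
      unfolding F\<^sub>1(3)[symmetric] using hull_mono[of F\<^sub>1 ?F' "left_submodule M"] by auto
    then have "(y \<ominus> ?m) \<oplus> ?m \<in> ?K" using v'(2) by (rule K(3))
    then show "y \<in> ?K" using N(1)[OF y] N(1)[OF mN] by (simp add: a_minus_def a_assoc l_neg)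
  qed
  then have "?K = N" using KN by (intro equalityI)
  moreover have "finite ?F'" using F\<^sub>1(1) A(1) by simp
  ultimately show ?case using sub by blast
qed

text \<open>A graded submodule contains the components of its generators, and each generator is the
  sum of its finitely many nonzero components. So these components form a finite generating
  set.\<close>

lemma noetherian_homogeneous_generators:
  assumes "noetherian (UNIV :: 'a set)" "fin_gen M" "left_submodule M N"
    and graded: "\<And>x i. x \<in> N \<Longrightarrow> component i x \<in> N"
  obtains F where "finite F" "F \<subseteq> N" "\<forall>x\<in>F. \<exists>i. x \<in> gr M i" "left_submodule M hull F = N"
proof -
  note N = left_submoduleD[OF assms(3)]
  obtain E where E: "finite E" "E \<subseteq> carrier M" "left_submodule M hull E = carrier M"
    using assms(2) unfolding fin_gen_def by auto
  obtain F where F: "finite F" "F \<subseteq> N" "left_submodule M hull F = N"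
    using noetherian_submodule[OF assms(1) E(1,2) assms(3)] N(1) unfolding E(3) by auto
  let ?F = "\<Union>x\<in>F. (\<lambda>i. component i x) ` {i. component i x \<noteq> \<zero>}"
  have Fc: "x \<in> carrier M" if "x \<in> F" for x using that F(2) N(1) by auto
  have sub: "?F \<subseteq> N" using graded F(2) by auto
  have "?F \<subseteq> carrier M" using sub N(1) by auto
  note subK = left_submodule_hull[OF this]
  have "F \<subseteq> left_submodule M hull ?F"
  proof
    fix x assume x: "x \<in> F"
    have "(\<Oplus>i\<in>{i. component i x \<noteq> \<zero>}. component i x) \<in> left_submodule M hull ?F"
      by (rule left_submodule_finsum[OF subK]) (use x in \<open>auto intro: hull_inc\<close>)
    then show "x \<in> left_submodule M hull ?F" using component_props(3)[OF Fc[OF x]] by simp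
  qed
  from hull_minimal[of _ _ "left_submodule M", OF this subK]
  have "N \<subseteq> left_submodule M hull ?F" unfolding F(3) .
  moreover have "left_submodule M hull ?F \<subseteq> N" using sub assms(3) by (rule hull_minimal)
  ultimately have "left_submodule M hull ?F = N" by (intro equalityI)
  moreover have "finite ?F" using F(1) Fc component_props(2) by auto
  moreover have "\<forall>x\<in>?F. \<exists>i. x \<in> gr M i" using Fc component_props(1) by auto
  ultimately show ?thesis using that sub by simp
qed

end

text \<open>The sum of the modules \<open>A(- e i)\<close> over \<open>i < r\<close>: the
  \<open>i\<close>-th unit vector has degree \<open>e i\<close>. Finite tuples are padded with
  zeros, because \<open>resolution\<close> fixes the type
  \<open>nat \<Rightarrow> 'a\<close>.\<close>

definition free_gmod ::
  "(nat \<Rightarrow> 'a::{ring,monoid_mult} set) \<Rightarrow> nat \<Rightarrow> (nat \<Rightarrow> int) \<Rightarrow> ('a, nat \<Rightarrow> 'a) gmod" where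
  "free_gmod G r e = \<lparr>carrier = {c. \<forall>i\<ge>r. c i = 0}, mult = undefined, one = undefined,
     zero = (\<lambda>i. 0), add = (\<lambda>c c' i. c i + c' i), smult = (\<lambda>a c i. a * c i),
     gr = (\<lambda>k. {c. (\<forall>i<r. c i \<in> gr (regular G) (k - e i)) \<and> (\<forall>i\<ge>r. c i = 0)})\<rparr>"

lemma free_gmod_simps [simp]:
  "carrier (free_gmod G r e) = {c. \<forall>i\<ge>r. c i = 0}"
  "zero (free_gmod G r e) = (\<lambda>i. 0)"
  "add (free_gmod G r e) = (\<lambda>c c' i. c i + c' i)"
  "smult (free_gmod G r e) = (\<lambda>a c i. a * c i)"
  "gr (free_gmod G r e) k = {c. (\<forall>i<r. c i \<in> gr (regular G) (k - e i)) \<and> (\<forall>i\<ge>r. c i = 0)}"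
  unfolding free_gmod_def by simp_all

context graded_algebra
begin

lemma neg_gr_regular: "x \<in> gr (regular G) k \<Longrightarrow> - x \<in> gr (regular G) k"
  using A.minus_gr[of x k] A.minus_one_smult[of x] by simp

lemma abelian_group_free_gmod: "abelian_group (free_gmod G r e)"
proof (rule abelian_groupI)
  fix c assume c: "c \<in> carrier (free_gmod G r e)"
  show "\<exists>c'\<in>carrier (free_gmod G r e). c' \<oplus>\<^bsub>free_gmod G r e\<^esub> c = \<zero>\<^bsub>free_gmod G r e\<^esub>"
    by (rule bexI[of _ "\<lambda>i. - c i"]) (use c in auto)
qed (auto simp: algebra_simps)

lemma finsum_free_gmod:
  assumes "f \<in> A \<rightarrow> carrier (free_gmod G r e)"
  shows "finsum (free_gmod G r e) f A i = (\<Sum>a\<in>A. f a i)"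
proof -
  interpret abelian_group "free_gmod G r e" by (rule abelian_group_free_gmod)
  have "finsum (free_gmod G r e) f A i = finsum (regular G) (\<lambda>a. f a i) A"
    by (rule finsum_additive_map[of _ "regular G" "\<lambda>c. c i", OF abelian_monoid_axioms A.abelian_monoid_axioms _ _ _ assms])
      auto
  then show ?thesis by simp
qed

lemma graded_module_free_gmod: "graded_module G (free_gmod G r e)"
proof -
  let ?E = "free_gmod G r e"
  have ab: "abelian_group ?E" by (rule abelian_group_free_gmod)
  interpret E: abelian_group ?E by (rule ab)
  have inv: "\<ominus>\<^bsub>?E\<^esub> c = (\<lambda>i. - c i)" if "c \<in> carrier ?E" for c
    by (rule E.minus_equality) (use that in auto)
  show ?thesis
  proof (intro graded_module.intro graded_module_axioms.intro ab)
    fix k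
    show "additive_subgroup (gr ?E k) ?E"
      using neg_gr_regular A.zero_gr A.add_gr inv
      by (intro additive_subgroupI, intro E.add.subgroupI) (auto intro!: exI[of _ "\<lambda>i. 0"])
  next
    fix c assume c: "c \<in> carrier ?E"
    let ?p = "\<lambda>k c i. if i < r then A.component (k - e i) (c i) else (0::'a)"
    show "\<exists>!f. (\<forall>i. f i \<in> gr ?E i) \<and> finite {i. f i \<noteq> \<zero>\<^bsub>?E\<^esub>} \<and> c = (\<Oplus>\<^bsub>?E\<^esub>i\<in>{i. f i \<noteq> \<zero>\<^bsub>?E\<^esub>}. f i)"
    proof (rule direct_sum_by_projections[OF ab, where p = ?p])
      let ?S = "{k. ?p k c \<noteq> \<zero>\<^bsub>?E\<^esub>}"
      have "?S \<subseteq> (\<Union>i<r. (\<lambda>l. l + e i) ` {l. A.component l (c i) \<noteq> 0})"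
      proof
        fix k assume "k \<in> ?S"
        then obtain i where i: "i < r" "A.component (k - e i) (c i) \<noteq> 0"
          by (auto simp: fun_eq_iff split: if_splits)
        then have "k \<in> (\<lambda>l. l + e i) ` {l. A.component l (c i) \<noteq> 0}"
          by (intro image_eqI[of _ _ "k - e i"]) auto
        then show "k \<in> (\<Union>i<r. (\<lambda>l. l + e i) ` {l. A.component l (c i) \<noteq> 0})" using i(1) by blast
      qed
      then show fin: "finite ?S"
        by (rule finite_subset) (use finite_component_support in auto)
      have "(\<Oplus>\<^bsub>?E\<^esub>k\<in>?S. ?p k c) i = c i" for i
      proof (cases "i < r")
        case True
        have inj: "inj_on (\<lambda>k. k - e i) ?S" by (rule inj_onI) simp
        have "(\<Oplus>\<^bsub>?E\<^esub>k\<in>?S. ?p k c) i = (\<Sum>k\<in>?S. A.component (k - e i) (c i))"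
          using True by (subst finsum_free_gmod) auto
        also have "\<dots> = (\<Sum>l\<in>(\<lambda>k. k - e i) ` ?S. A.component l (c i))"
          by (rule sum.reindex[OF inj, unfolded comp_def, symmetric])
        also have "\<dots> = c i"
        proof -
          have "{l. A.component l (c i) \<noteq> 0} \<subseteq> (\<lambda>k. k - e i) ` ?S"
          proof
            fix l assume "l \<in> {l. A.component l (c i) \<noteq> 0}"
            then have nz: "?p (l + e i) c i \<noteq> \<zero>\<^bsub>?E\<^esub> i" using True by simp
            have "?p (l + e i) c \<noteq> \<zero>\<^bsub>?E\<^esub>"
            proof
              assume "?p (l + e i) c = \<zero>\<^bsub>?E\<^esub>"
              from fun_cong[OF this, of i] nz show False by (rule notE[rotated])
            qed
            then have "l + e i \<in> ?S" by (rule CollectI)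
            then show "l \<in> (\<lambda>k. k - e i) ` ?S" by (rule image_eqI[rotated]) simp
          qed
          from A.component_sum_superset[of "c i", OF UNIV_I finite_imageI[OF fin] this]
          show ?thesis by (simp only: finsum_regular)
        qed
        finally show ?thesis .
      next
        case False
        then show ?thesis using c by (subst finsum_free_gmod) auto
      qed
      then show "c = (\<Oplus>\<^bsub>?E\<^esub>k\<in>?S. ?p k c)" by (intro ext) simp
    qed (use c A.component_props(1) A.component_add A.component_gr in \<open>auto simp: fun_eq_iff\<close>)
  next
    fix a n c k assume "a \<in> G n" "c \<in> gr ?E k"
    then show "a \<odot>\<^bsub>?E\<^esub> c \<in> gr ?E (int n + k)"
      using A.smult_gr[of a n] by (auto simp: add_diff_eq[symmetric])
  qed (auto simp: algebra_simps)
qed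

lemma fin_graded_free_free_gmod: "fin_graded_free (free_gmod G r e)"
proof (cases "(1::'a) = 0")
  \<comment> \<open>Over the zero ring the unit vectors coincide and cannot be indexed injectively
    by \<open>i < r\<close>; the module is zero and the empty set is a basis.\<close>
  case True
  then have triv: "x = 0" for x :: 'a by (metis mult.right_neutral mult_zero_right)
  interpret graded_module G "free_gmod G r e" by (rule graded_module_free_gmod)
  have "carrier (free_gmod G r e) = {\<lambda>i. 0}" using triv by auto
  then show ?thesis
    unfolding fin_graded_free_def by (intro exI[of _ "{}"]) (simp add: bij_betw_def)
next
  case False
  let ?E = "free_gmod G r e"
  interpret graded_module G ?E by (rule graded_module_free_gmod)
  let ?u = "\<lambda>i k. if k = i then 1 else (0::'a)"
  let ?B = "?u ` {..<r}"
  let ?S = "\<lambda>d. \<Oplus>\<^bsub>?E\<^esub>b\<in>?B. d b \<odot>\<^bsub>?E\<^esub> b"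
  have inj: "inj_on ?u {..<r}" using False by (intro inj_onI) (metis (full_types))
  have gr: "?u i \<in> gr ?E (e i)" if "i < r" for i
    using that one_component A.zero_gr by (auto simp: gr_regular subspace_0[OF subspace_component])
  have S: "?S d i = (if i < r then d (?u i) else 0)" for d i
  proof -
    have "?S d i = (\<Sum>b\<in>?B. d b * b i)"
      by (subst finsum_free_gmod) auto
    also have "\<dots> = (\<Sum>k<r. d (?u k) * ?u k i)"
      by (subst sum.reindex[OF inj]) simp
    also have "\<dots> = (\<Sum>k<r. if i = k then d (?u i) else 0)"
      by (rule sum.cong) auto
    finally show ?thesis by simp
  qed
  have Sc: "?S d \<in> carrier ?E" for d using S by simp
  have "bij_betw ?S (?B \<rightarrow>\<^sub>E UNIV) (carrier ?E)"
  proof (rule bij_betw_imageI)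
    show "inj_on ?S (?B \<rightarrow>\<^sub>E UNIV)"
    proof (rule inj_onI)
      fix d d' assume d: "d \<in> ?B \<rightarrow>\<^sub>E UNIV" "d' \<in> ?B \<rightarrow>\<^sub>E UNIV" and eq: "?S d = ?S d'"
      have "d (?u i) = d' (?u i)" if "i < r" for i using fun_cong[OF eq, of i] S that by simp
      then show "d = d'" using d by (intro PiE_ext[OF d]) auto
    qed
    show "?S ` (?B \<rightarrow>\<^sub>E UNIV) = carrier ?E"
    proof (intro equalityI subsetI)
      fix c assume c: "c \<in> carrier ?E"
      let ?d = "\<lambda>b\<in>?B. c (the_inv_into {..<r} ?u b)"
      have "?S ?d i = c i" for i
        using c S[of ?d i] the_inv_into_f_f[OF inj, of i] by auto
      then have eq: "c = ?S ?d" by (intro ext) simp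
      show "c \<in> ?S ` (?B \<rightarrow>\<^sub>E UNIV)"
        by (rule image_eqI[where f = ?S and x = ?d, OF eq]) auto
    qed (use Sc in blast)
  qed
  moreover have "?B \<subseteq> (\<Union>i. gr ?E i)"
    by (rule image_subsetI, rule UN_I[OF UNIV_I], rule gr) (rule lessThan_iff[THEN iffD1])
  moreover have "finite ?B" by simp
  ultimately show ?thesis unfolding fin_graded_free_def by (intro exI[of _ ?B] conjI)
qed

lemma free_gmod_hom:
  assumes "graded_module G M" and z: "\<And>i. i < r \<Longrightarrow> z i \<in> gr M (e i)"
  shows "(\<lambda>c. \<Oplus>\<^bsub>M\<^esub>i\<in>{..<r}. c i \<odot>\<^bsub>M\<^esub> z i) \<in> gr_hom (free_gmod G r e) M"
proof -
  interpret M: graded_module G M by fact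
  have zc: "(\<lambda>i. c i \<odot>\<^bsub>M\<^esub> z i) \<in> {..<r} \<rightarrow> carrier M" for c
    using M.gr_carrier[OF z] M.smult_closed by auto
  show ?thesis
    unfolding gr_hom_def
  proof (intro CollectI conjI ballI allI)
    fix c c'
    have "(\<Oplus>\<^bsub>M\<^esub>i\<in>{..<r}. (c i + c' i) \<odot>\<^bsub>M\<^esub> z i) = (\<Oplus>\<^bsub>M\<^esub>i\<in>{..<r}. c i \<odot>\<^bsub>M\<^esub> z i \<oplus>\<^bsub>M\<^esub> c' i \<odot>\<^bsub>M\<^esub> z i)"
      by (rule M.finsum_cong') (use M.gr_carrier[OF z] M.smult_closed M.smult_l_distr in auto)
    then show "(\<Oplus>\<^bsub>M\<^esub>i\<in>{..<r}. (c \<oplus>\<^bsub>free_gmod G r e\<^esub> c') i \<odot>\<^bsub>M\<^esub> z i) =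
      (\<Oplus>\<^bsub>M\<^esub>i\<in>{..<r}. c i \<odot>\<^bsub>M\<^esub> z i) \<oplus>\<^bsub>M\<^esub> (\<Oplus>\<^bsub>M\<^esub>i\<in>{..<r}. c' i \<odot>\<^bsub>M\<^esub> z i)"
      using M.finsum_addf[OF zc zc] by simp
  next
    fix a c
    have "(\<Oplus>\<^bsub>M\<^esub>i\<in>{..<r}. (a * c i) \<odot>\<^bsub>M\<^esub> z i) = (\<Oplus>\<^bsub>M\<^esub>i\<in>{..<r}. a \<odot>\<^bsub>M\<^esub> (c i \<odot>\<^bsub>M\<^esub> z i))"
      by (rule M.finsum_cong') (use M.gr_carrier[OF z] M.smult_closed M.smult_assoc in auto)
    then show "(\<Oplus>\<^bsub>M\<^esub>i\<in>{..<r}. (a \<odot>\<^bsub>free_gmod G r e\<^esub> c) i \<odot>\<^bsub>M\<^esub> z i) =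
      a \<odot>\<^bsub>M\<^esub> (\<Oplus>\<^bsub>M\<^esub>i\<in>{..<r}. c i \<odot>\<^bsub>M\<^esub> z i)"
      using M.smult_finsum[OF zc] by simp
  next
    fix k
    show "(\<lambda>c. \<Oplus>\<^bsub>M\<^esub>i\<in>{..<r}. c i \<odot>\<^bsub>M\<^esub> z i) ` gr (free_gmod G r e) k \<subseteq> gr M k"
    proof (rule image_subsetI)
      fix c assume c: "c \<in> gr (free_gmod G r e) k"
      have "c i \<odot>\<^bsub>M\<^esub> z i \<in> gr M k" if "i < r" for i
        using smult_gr_regular[OF assms(1) _ z[OF that], of "c i" "k - e i"] c that by simp
      then show "(\<Oplus>\<^bsub>M\<^esub>i\<in>{..<r}. c i \<odot>\<^bsub>M\<^esub> z i) \<in> gr M k" by (intro M.finsum_gr) simp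
    qed
  qed (intro Pi_I M.finsum_closed zc)
qed

lemma gr_hom_linear_combination:
  assumes "graded_module G M" "graded_module G N" "h \<in> gr_hom M N" "\<And>i. i \<in> I \<Longrightarrow> z i \<in> carrier M"
  shows "h (\<Oplus>\<^bsub>M\<^esub>i\<in>I. c i \<odot>\<^bsub>M\<^esub> z i) = (\<Oplus>\<^bsub>N\<^esub>i\<in>I. c i \<odot>\<^bsub>N\<^esub> h (z i))"
proof -
  interpret M: graded_module G M by fact
  interpret N: graded_module G N by fact
  have "h (\<Oplus>\<^bsub>M\<^esub>i\<in>I. c i \<odot>\<^bsub>M\<^esub> z i) = (\<Oplus>\<^bsub>N\<^esub>i\<in>I. h (c i \<odot>\<^bsub>M\<^esub> z i))"
    by (rule gr_hom_finsum[OF assms(1-3)]) (use assms(4) M.smult_closed in auto)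
  also have "\<dots> = (\<Oplus>\<^bsub>N\<^esub>i\<in>I. c i \<odot>\<^bsub>N\<^esub> h (z i))"
    by (rule N.finsum_cong')
      (use assms(4) gr_homD(1)[OF assms(3)] gr_homD(3)[OF assms(3)] N.smult_closed in auto)
  finally show ?thesis .
qed

lemma linear_combination_unit:
  fixes r :: nat
  assumes "graded_module G M" "\<And>i. i < r \<Longrightarrow> z i \<in> carrier M" "k < r"
  shows "(\<Oplus>\<^bsub>M\<^esub>i\<in>{..<r}. (if i = k then 1 else 0) \<odot>\<^bsub>M\<^esub> z i) = z k"
proof -
  interpret M: graded_module G M by fact
  have "(\<Oplus>\<^bsub>M\<^esub>i\<in>{..<r}. (if i = k then 1 else 0) \<odot>\<^bsub>M\<^esub> z i) =
    (\<Oplus>\<^bsub>M\<^esub>i\<in>{..<r}. if i = k then z k else \<zero>\<^bsub>M\<^esub>)"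
    by (rule M.finsum_cong') (use assms(2) M.smult_one M.zero_smult assms(3) in auto)
  also have "\<dots> = z k" by (rule M.finsum_single) (use assms in auto)
  finally show ?thesis .
qed

end

section \<open>Free resolutions\<close>

lemma left_submodule_coboundaries:
  assumes "complex_Gr G X" shows "left_submodule (ob X n) (coboundaries X n)"
proof -
  have gm: "graded_module G (ob X k)" for k using assms unfolding complex_Gr_def by blast
  interpret graded_module G "ob X (n - 1)" by (rule gm)
  have "df X (n - 1) \<in> gr_hom (ob X (n - 1)) (ob X (n - 1 + 1))"
    using assms unfolding complex_Gr_def by blast
  then show ?thesis
    unfolding coboundaries_def
    by (intro left_submodule_image[OF gm gm _ left_submodule_carrier]) simp
qed

lemma carrier_cohomology:
  "carrier (cohomology X n) = (\<lambda>z. coboundaries X n +>\<^bsub>ob X n\<^esub> z) ` cocycles X n"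
proof -
  have "a_r_coset (sub_gmod (ob X n) (cocycles X n)) N = a_r_coset (ob X n) N" for N
    unfolding a_r_coset_def' sub_gmod_def by (simp add: fun_eq_iff)
  then show ?thesis
    unfolding cohomology_def quot_gmod_def partial_object.simps A_RCOSETS_def'
    by (auto simp: sub_gmod_def)
qed

text \<open>The hypothesis \<open>cover\<close> says that \<open>P\<^sup>n\<close> surjects onto the pullback of \<open>Z\<^bsup>n+1\<^esup>(P) \<rightarrow> X\<^bsup>n+1\<^esup> \<leftarrow> X\<^sup>n\<close>.
  Its case \<open>p = 0\<close> gives surjectivity in cohomology, the general case gives injectivity.\<close>

lemma quasi_isoI:
  assumes P: "complex_Gr G P" and X: "complex_Gr G X" and f: "chain_map P X f"
    and cover: "\<And>n p x. p \<in> carrier (ob P (n + 1)) \<Longrightarrow> x \<in> carrier (ob X n) \<Longrightarrow>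
      df P (n + 1) p = \<zero>\<^bsub>ob P (n + 2)\<^esub> \<Longrightarrow> f (n + 1) p = df X n x \<Longrightarrow>
      \<exists>q\<in>carrier (ob P n). df P n q = p \<and> f n q = x"
  shows "quasi_iso P X f"
  unfolding quasi_iso_def
proof (intro conjI allI f)
  fix n
  let ?BP = "coboundaries P n" and ?BX = "coboundaries X n"
  let ?cP = "\<lambda>z. ?BP +>\<^bsub>ob P n\<^esub> z" and ?cX = "\<lambda>z. ?BX +>\<^bsub>ob X n\<^esub> z"
  let ?\<Psi> = "\<lambda>C. ?BX <+>\<^bsub>ob X n\<^esub> f n ` C"
  have gP: "graded_module G (ob P k)" and gX: "graded_module G (ob X k)" for k
    using P X unfolding complex_Gr_def by blast+
  interpret P: graded_module G "ob P n" by (rule gP)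
  interpret X: graded_module G "ob X n" by (rule gX)
  have dP: "df P k \<in> gr_hom (ob P k) (ob P (k + 1))" and dX: "df X k \<in> gr_hom (ob X k) (ob X (k + 1))" for k
    using P X unfolding complex_Gr_def by blast+
  have fh: "f k \<in> gr_hom (ob P k) (ob X k)" for k using f unfolding chain_map_def by blast
  have fd: "f (k + 1) (df P k x) = df X k (f k x)" if "x \<in> carrier (ob P k)" for k x
    using f that unfolding chain_map_def by blast
  note sBP = left_submodule_coboundaries[OF P, of n] and sBX = left_submodule_coboundaries[OF X, of n]
  note BP = P.left_submoduleD[OF sBP] and BX = X.left_submoduleD[OF sBX]
  have ZP: "z \<in> carrier (ob P n)" "df P n z = \<zero>\<^bsub>ob P (n + 1)\<^esub>" if "z \<in> cocycles P n" for z
    using that unfolding cocycles_def by auto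
  have fB: "f n b \<in> ?BX" if b: "b \<in> ?BP" for b
  proof -
    obtain q where q: "q \<in> carrier (ob P (n - 1))" "b = df P (n - 1) q"
      using b unfolding coboundaries_def by auto
    have "f n b = df X (n - 1) (f (n - 1) q)" using fd[OF q(1)] unfolding q(2) by simp
    then show ?thesis unfolding coboundaries_def using gr_homD(1)[OF fh q(1)] by (rule image_eqI)
  qed
  have fZ: "f n z \<in> cocycles X n" if "z \<in> cocycles P n" for z
    using ZP[OF that] fd[OF ZP(1)[OF that]] gr_homD(1)[OF fh ZP(1)[OF that]]
      gr_hom_zero[OF gP gX fh, of "n + 1"] unfolding cocycles_def by simp
  \<comment> \<open>As \<open>f n\<close> maps coboundaries to coboundaries, the set-level map in
    \<open>quasi_iso\<close> is the expected map on classes of cocycles.\<close>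
  have \<Psi>: "?\<Psi> (?cP z) = ?cX (f n z)" if z: "z \<in> cocycles P n" for z
  proof -
    note zc = ZP(1)[OF z]
    have fz: "f n z \<in> carrier (ob X n)" by (rule gr_homD(1)[OF fh zc])
    show ?thesis
    proof (intro equalityI subsetI)
      fix u assume "u \<in> ?\<Psi> (?cP z)"
      then obtain h b where hb: "h \<in> ?BX" "b \<in> ?BP" "u = h \<oplus>\<^bsub>ob X n\<^esub> f n (b \<oplus>\<^bsub>ob P n\<^esub> z)"
        unfolding set_add_def' a_r_coset_def' by auto
      have "u = (h \<oplus>\<^bsub>ob X n\<^esub> f n b) \<oplus>\<^bsub>ob X n\<^esub> f n z"
        unfolding hb(3) gr_homD(2)[OF fh BP(1)[OF hb(2)] zc]
        using BX(1)[OF hb(1)] BX(1)[OF fB[OF hb(2)]] fz by (simp add: X.a_assoc)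
      then show "u \<in> ?cX (f n z)"
        unfolding a_r_coset_def' using BX(3)[OF hb(1) fB[OF hb(2)]] by auto
    next
      fix u assume "u \<in> ?cX (f n z)"
      then obtain h where h: "h \<in> ?BX" "u = h \<oplus>\<^bsub>ob X n\<^esub> f n z" unfolding a_r_coset_def' by auto
      have "z = \<zero>\<^bsub>ob P n\<^esub> \<oplus>\<^bsub>ob P n\<^esub> z" using zc by simp
      then have "z \<in> ?cP z" unfolding a_r_coset_def' using BP(2) by auto
      then show "u \<in> ?\<Psi> (?cP z)" unfolding set_add_def' h(2) using h(1) by blast
    qed
  qed
  show "bij_betw ?\<Psi> (carrier (cohomology P n)) (carrier (cohomology X n))"
    unfolding carrier_cohomology
  proof (rule bij_betw_imageI)
    show "inj_on ?\<Psi> (?cP ` cocycles P n)"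
    proof (rule inj_onI)
      fix C C' assume "C \<in> ?cP ` cocycles P n" "C' \<in> ?cP ` cocycles P n" and eq: "?\<Psi> C = ?\<Psi> C'"
      then obtain z z' where z: "z \<in> cocycles P n" "C = ?cP z" and z': "z' \<in> cocycles P n" "C' = ?cP z'"
        by auto
      note zc = ZP(1)[OF z(1)] and zc' = ZP(1)[OF z'(1)]
      have "?cX (f n z) = ?cX (f n z')" using eq unfolding z(2) z'(2) \<Psi>[OF z(1)] \<Psi>[OF z'(1)] .
      then have "f n z \<ominus>\<^bsub>ob X n\<^esub> f n z' \<in> ?BX"
        using X.coset_eq_iff[OF sBX gr_homD(1)[OF fh zc] gr_homD(1)[OF fh zc']] by simp
      moreover have "f n (z \<ominus>\<^bsub>ob P n\<^esub> z') = f n z \<ominus>\<^bsub>ob X n\<^esub> f n z'"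
      proof -
        have m: "\<ominus>\<^bsub>ob P n\<^esub> z' \<in> carrier (ob P n)" using zc' by simp
        have "f n (\<ominus>\<^bsub>ob P n\<^esub> z') = \<ominus>\<^bsub>ob X n\<^esub> f n z'"
          using gr_homD(3)[OF fh zc', of "- 1"] P.minus_one_smult[OF zc']
            X.minus_one_smult[OF gr_homD(1)[OF fh zc']] by simp
        then show ?thesis using gr_homD(2)[OF fh zc m] by (simp add: a_minus_def)
      qed
      ultimately obtain x where x: "x \<in> carrier (ob X (n - 1))"
        "f n (z \<ominus>\<^bsub>ob P n\<^esub> z') = df X (n - 1) x"
        unfolding coboundaries_def by auto
      have "left_submodule (ob P n) (cocycles P n)"
        unfolding cocycles_def by (rule left_submodule_kernel[OF gP gP dP])
      then have d: "z \<ominus>\<^bsub>ob P n\<^esub> z' \<in> cocycles P n" using z(1) z'(1) by (rule P.left_submodule_minus)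
      have "\<exists>q\<in>carrier (ob P (n - 1)). df P (n - 1) q = z \<ominus>\<^bsub>ob P n\<^esub> z' \<and> f (n - 1) q = x"
      proof -
        have "n - 1 + 1 = n" "n - 1 + 2 = n + 1" by simp_all
        then show ?thesis
          using cover[of "z \<ominus>\<^bsub>ob P n\<^esub> z'" "n - 1" x] ZP[OF d] x by (simp only: simp_thms)
      qed
      then have "z \<ominus>\<^bsub>ob P n\<^esub> z' \<in> ?BP"
        unfolding coboundaries_def by (elim bexE conjE) (rule image_eqI[OF sym])
      then show "C = C'" unfolding z(2) z'(2) P.coset_eq_iff[OF sBP zc zc'] .
    qed
    show "?\<Psi> ` ?cP ` cocycles P n = ?cX ` cocycles X n"
    proof (intro equalityI subsetI)
      fix D assume "D \<in> ?\<Psi> ` ?cP ` cocycles P n"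
      then obtain z where z: "z \<in> cocycles P n" "D = ?\<Psi> (?cP z)" by auto
      then show "D \<in> ?cX ` cocycles X n" unfolding z(2) \<Psi>[OF z(1)] using fZ by auto
    next
      fix D assume "D \<in> ?cX ` cocycles X n"
      then obtain w where w: "w \<in> cocycles X n" "D = ?cX w" by auto
      then have wc: "w \<in> carrier (ob X n)" "df X n w = \<zero>\<^bsub>ob X (n + 1)\<^esub>" unfolding cocycles_def by auto
      interpret P1: graded_module G "ob P (n + 1)" by (rule gP)
      have d0: "df P (n + 1) \<zero>\<^bsub>ob P (n + 1)\<^esub> = \<zero>\<^bsub>ob P (n + 2)\<^esub>"
        using gr_hom_zero[OF gP gP dP, of "n + 1"] by (simp add: add.assoc)
      have f0: "f (n + 1) \<zero>\<^bsub>ob P (n + 1)\<^esub> = df X n w"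
        unfolding wc(2) by (rule gr_hom_zero[OF gP gX fh])
      obtain q where q: "q \<in> carrier (ob P n)" "df P n q = \<zero>\<^bsub>ob P (n + 1)\<^esub>" "f n q = w"
        using cover[OF P1.zero_closed wc(1) d0 f0] by auto
      then have qZ: "q \<in> cocycles P n" unfolding cocycles_def by simp
      have "D = ?\<Psi> (?cP q)" unfolding \<Psi>[OF qZ] q(3) w(2) ..
      then show "D \<in> ?\<Psi> ` ?cP ` cocycles P n" using qZ by auto
    qed
  qed
qed

context graded_algebra
begin

text \<open>The pullback is never formed as a module. Its projection to \<open>M\<close> is
  \<open>?N\<close>, and the kernel of that projection is a copy of \<open>?K\<close>. Both are
  graded submodules of finitely generated modules, so each has finitely many homogeneous generators,
  and together they provide generators of the pullback.\<close>

lemma free_cover: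
  fixes M :: "('a, 'm) gmod" and X :: "('a, 'x) gmod"
  assumes noeth: "noetherian (UNIV :: 'a set)"
    and gm: "graded_module G M" "graded_module G M\<^sub>2" "graded_module G X" "graded_module G X\<^sub>2"
    and fg: "fin_gen M" "fin_gen X"
    and h: "d \<in> gr_hom M M\<^sub>2" "f \<in> gr_hom M X\<^sub>2" "dX \<in> gr_hom X X\<^sub>2"
  obtains r e d' f' where "d' \<in> gr_hom (free_gmod G r e) M" "f' \<in> gr_hom (free_gmod G r e) X"
    "\<forall>q\<in>carrier (free_gmod G r e). d (d' q) = \<zero>\<^bsub>M\<^sub>2\<^esub>"
    "\<forall>q\<in>carrier (free_gmod G r e). f (d' q) = dX (f' q)"
    "\<forall>p\<in>carrier M. \<forall>x\<in>carrier X. d p = \<zero>\<^bsub>M\<^sub>2\<^esub> \<and> f p = dX x \<longrightarrow>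
       (\<exists>q\<in>carrier (free_gmod G r e). d' q = p \<and> f' q = x)"
proof -
  interpret M: graded_module G M by (rule gm)
  interpret M2: graded_module G M\<^sub>2 by (rule gm)
  interpret X: graded_module G X by (rule gm)
  interpret X2: graded_module G X\<^sub>2 by (rule gm)
  let ?Z = "{p \<in> carrier M. d p = \<zero>\<^bsub>M\<^sub>2\<^esub>}"
  let ?K = "{x \<in> carrier X. dX x = \<zero>\<^bsub>X\<^sub>2\<^esub>}"
  let ?N = "{p \<in> ?Z. f p \<in> dX ` carrier X}"
  note sZ = left_submodule_kernel[OF gm(1,2) h(1)]
  note sK = left_submodule_kernel[OF gm(3,4) h(3)]
  note sI = left_submodule_image[OF gm(3,4) h(3) X.left_submodule_carrier]
  have sN: "left_submodule M ?N"
  proof (rule M.left_submoduleI)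
    note Z = M.left_submoduleD[OF sZ] and I = X2.left_submoduleD[OF sI]
    show "?N \<subseteq> carrier M" by auto
    show "\<zero>\<^bsub>M\<^esub> \<in> ?N" using Z(2) I(2) gr_hom_zero[OF gm(1,4) h(2)] by simp
    fix a x y assume x: "x \<in> ?N"
    then show "a \<odot>\<^bsub>M\<^esub> x \<in> ?N" using Z(4)[of x a] I(4)[of "f x" a] gr_homD(3)[OF h(2), of x a] by auto
    assume y: "y \<in> ?N"
    show "x \<oplus>\<^bsub>M\<^esub> y \<in> ?N"
      using x y Z(3)[of x y] I(3)[of "f x" "f y"] gr_homD(2)[OF h(2), of x y] by auto
  qed
  \<comment> \<open>Since all maps preserve degrees, a component of \<open>p\<close> is matched by
    the same component of any partner of \<open>p\<close> in \<open>X\<close>. This makes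
    \<open>?N\<close> graded and gives each homogeneous generator a partner of its own
    degree.\<close>
  have lift: "M.component k p \<in> ?Z \<and> (\<exists>x\<in>gr X k. f (M.component k p) = dX x)" if p: "p \<in> ?N" for p k
  proof -
    have pc: "p \<in> carrier M" "d p = \<zero>\<^bsub>M\<^sub>2\<^esub>" using p by auto
    obtain x where x: "x \<in> carrier X" "f p = dX x" using p by auto
    have "d (M.component k p) = \<zero>\<^bsub>M\<^sub>2\<^esub>"
      using gr_hom_component[OF gm(1,2) h(1) pc(1), of k] unfolding pc(2) M2.component_zero by simp
    moreover have "f (M.component k p) = dX (X.component k x)"
      using gr_hom_component[OF gm(1,4) h(2) pc(1), of k] gr_hom_component[OF gm(3,4) h(3) x(1), of k]
      unfolding x(2) by simp
    moreover have "X.component k x \<in> gr X k" by (rule X.component_props(1)[OF x(1)])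
    ultimately show ?thesis using M.component_carrier[OF pc(1), of k] by auto
  qed
  have "M.component k p \<in> ?N" if "p \<in> ?N" for p k
    using lift[OF that, of k] X.gr_carrier by auto
  then obtain F where F: "finite F" "F \<subseteq> ?N" "\<forall>p\<in>F. \<exists>k. p \<in> gr M k" "left_submodule M hull F = ?N"
    by (rule M.noetherian_homogeneous_generators[OF noeth fg(1) sN])
  have "X.component k x \<in> ?K" if x: "x \<in> ?K" for x k
    using gr_hom_component[OF gm(3,4) h(3), of x k] x X2.component_zero X.component_carrier by simp
  then obtain E where E: "finite E" "E \<subseteq> ?K" "\<forall>x\<in>E. \<exists>k. x \<in> gr X k" "left_submodule X hull E = ?K"
    by (rule X.noetherian_homogeneous_generators[OF noeth fg(2) sK])
  have "\<exists>k x. p \<in> gr M k \<and> x \<in> gr X k \<and> f p = dX x" if p: "p \<in> F" for p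
  proof -
    obtain k where k: "p \<in> gr M k" using F(3) p by blast
    have "p \<in> ?N" using p F(2) by (rule subsetD[rotated])
    from lift[OF this, of k] k show ?thesis using M.component_gr[OF k, of k] by auto
  qed
  then obtain \<kappa> \<xi> where \<kappa>: "\<And>p. p \<in> F \<Longrightarrow> p \<in> gr M (\<kappa> p)" "\<And>p. p \<in> F \<Longrightarrow> \<xi> p \<in> gr X (\<kappa> p)"
    "\<And>p. p \<in> F \<Longrightarrow> f p = dX (\<xi> p)"
    by metis
  obtain \<mu> where \<mu>: "\<And>x. x \<in> E \<Longrightarrow> x \<in> gr X (\<mu> x)" using E(3) by metis
  \<comment> \<open>Each triple is a generator of the pullback: its degree and its two coordinates.
    Generators of \<open>?N\<close> come with their partner, those of \<open>?K\<close> with zero in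
    \<open>M\<close>. A list of these triples supplies the indices \<open>i < r\<close> of
    \<open>free_gmod\<close>.\<close>
  define T where "T = (\<lambda>p. (\<kappa> p, p, \<xi> p)) ` F \<union> (\<lambda>x. (\<mu> x, \<zero>\<^bsub>M\<^esub>, x)) ` E"
  have T: "p \<in> gr M k \<and> x \<in> gr X k \<and> d p = \<zero>\<^bsub>M\<^sub>2\<^esub> \<and> f p = dX x" if "(k, p, x) \<in> T" for k p x
  proof -
    have "\<zero>\<^bsub>M\<^esub> \<in> gr M k" for k by (rule M.zero_gr)
    moreover have "d p = \<zero>\<^bsub>M\<^sub>2\<^esub>" if "p \<in> F" for p using F(2) that by auto
    moreover have "dX x = \<zero>\<^bsub>X\<^sub>2\<^esub>" if "x \<in> E" for x using E(2) that by auto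
    ultimately show ?thesis
      using that \<kappa> \<mu> gr_hom_zero[OF gm(1,2) h(1)] gr_hom_zero[OF gm(1,4) h(2)]
      unfolding T_def by auto
  qed
  have "finite T" unfolding T_def using F(1) E(1) by simp
  then obtain ts where ts: "set ts = T" using finite_list by blast
  define r where "r = length ts"
  define e where "e i = fst (ts ! i)" for i
  define y where "y i = fst (snd (ts ! i))" for i
  define z where "z i = snd (snd (ts ! i))" for i
  have yz: "y i \<in> gr M (e i)" "z i \<in> gr X (e i)" "d (y i) = \<zero>\<^bsub>M\<^sub>2\<^esub>" "f (y i) = dX (z i)" if "i < r" for i
  proof -
    have "(e i, y i, z i) \<in> T"
      using that nth_mem[of i ts] ts unfolding r_def e_def y_def z_def by simp
    from T[OF this] show "y i \<in> gr M (e i)" "z i \<in> gr X (e i)" "d (y i) = \<zero>\<^bsub>M\<^sub>2\<^esub>" "f (y i) = dX (z i)"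
      by auto
  qed
  have yc: "y i \<in> carrier M" and zc: "z i \<in> carrier X" if "i < r" for i
    using M.gr_carrier[OF yz(1)[OF that]] X.gr_carrier[OF yz(2)[OF that]] .
  let ?E = "free_gmod G r e"
  let ?d = "\<lambda>c. \<Oplus>\<^bsub>M\<^esub>i\<in>{..<r}. c i \<odot>\<^bsub>M\<^esub> y i"
  let ?f = "\<lambda>c. \<Oplus>\<^bsub>X\<^esub>i\<in>{..<r}. c i \<odot>\<^bsub>X\<^esub> z i"
  have dh: "?d \<in> gr_hom ?E M" by (rule free_gmod_hom[OF gm(1) yz(1)])
  have fh: "?f \<in> gr_hom ?E X" by (rule free_gmod_hom[OF gm(3) yz(2)])
  note gE = graded_module_free_gmod[of r e]
  interpret E: graded_module G ?E by (rule gE)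
  have hit: "\<exists>q\<in>carrier ?E. ?d q = p \<and> ?f q = x" if kpx: "(k, p, x) \<in> T" for k p x
  proof -
    obtain i where i: "i < r" "ts ! i = (k, p, x)"
      using kpx unfolding ts[symmetric] r_def by (auto simp: in_set_conv_nth)
    have "?d (\<lambda>l. if l = i then 1 else 0) = p" "?f (\<lambda>l. if l = i then 1 else 0) = x"
      using linear_combination_unit[OF gm(1) yc i(1)] linear_combination_unit[OF gm(3) zc i(1)] i(2)
      unfolding y_def z_def by simp_all
    moreover have "(\<lambda>l. if l = i then 1 else 0) \<in> carrier ?E" using i(1) by simp
    ultimately show ?thesis by (intro bexI[of _ "\<lambda>l. if l = i then 1 else 0"] conjI)
  qed
  show ?thesis
  proof (rule that[OF dh fh])
    show "\<forall>q\<in>carrier ?E. d (?d q) = \<zero>\<^bsub>M\<^sub>2\<^esub>"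
    proof
      fix q
      have "d (?d q) = (\<Oplus>\<^bsub>M\<^sub>2\<^esub>i\<in>{..<r}. q i \<odot>\<^bsub>M\<^sub>2\<^esub> d (y i))"
        by (rule gr_hom_linear_combination[OF gm(1,2) h(1)]) (use yc in simp)
      also have "\<dots> = \<zero>\<^bsub>M\<^sub>2\<^esub>" by (rule M2.add.finprod_one_eqI) (use yz(3) M2.smult_zero in simp)
      finally show "d (?d q) = \<zero>\<^bsub>M\<^sub>2\<^esub>" .
    qed
    show "\<forall>q\<in>carrier ?E. f (?d q) = dX (?f q)"
    proof
      fix q
      have "f (?d q) = (\<Oplus>\<^bsub>X\<^sub>2\<^esub>i\<in>{..<r}. q i \<odot>\<^bsub>X\<^sub>2\<^esub> f (y i))"
        by (rule gr_hom_linear_combination[OF gm(1,4) h(2)]) (use yc in simp)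
      also have "\<dots> = (\<Oplus>\<^bsub>X\<^sub>2\<^esub>i\<in>{..<r}. q i \<odot>\<^bsub>X\<^sub>2\<^esub> dX (z i))"
        by (rule X2.finsum_cong') (use yz(4) gr_homD(1)[OF h(3) zc] X2.smult_closed in auto)
      also have "\<dots> = dX (?f q)"
        by (rule gr_hom_linear_combination[OF gm(3,4) h(3), symmetric]) (use zc in simp)
      finally show "f (?d q) = dX (?f q)" .
    qed
    have fd: "f (?d q) = dX (?f q)" if "q \<in> carrier ?E" for q
      using \<open>\<forall>q\<in>carrier ?E. f (?d q) = dX (?f q)\<close> that by (rule bspec)
    have "F \<subseteq> ?d ` carrier ?E"
    proof
      fix p assume "p \<in> F"
      then have "(\<kappa> p, p, \<xi> p) \<in> T" unfolding T_def by blast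
      from hit[OF this] show "p \<in> ?d ` carrier ?E" by (elim bexE conjE) (rule image_eqI, rule sym)
    qed
    from hull_minimal[of _ _ "left_submodule M", OF this left_submodule_image[OF gE gm(1) dh E.left_submodule_carrier]]
    have imd: "?N \<subseteq> ?d ` carrier ?E" unfolding F(4) .
    \<comment> \<open>It is essential that \<open>?K\<close> is reached by elements that
      \<open>?d\<close> kills: these can be added to a preimage of \<open>p\<close> without
      disturbing \<open>p\<close>.\<close>
    have "E \<subseteq> ?f ` {q \<in> carrier ?E. ?d q = \<zero>\<^bsub>M\<^esub>}"
    proof
      fix x assume "x \<in> E"
      then have "(\<mu> x, \<zero>\<^bsub>M\<^esub>, x) \<in> T" unfolding T_def by blast
      from hit[OF this] obtain q where "q \<in> carrier ?E" "?d q = \<zero>\<^bsub>M\<^esub>" "?f q = x" by (elim bexE conjE)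
      then have "q \<in> {q \<in> carrier ?E. ?d q = \<zero>\<^bsub>M\<^esub>}" "x = ?f q" by simp_all
      then show "x \<in> ?f ` {q \<in> carrier ?E. ?d q = \<zero>\<^bsub>M\<^esub>}" by (rule image_eqI[where f = ?f, rotated])
    qed
    from hull_minimal[of _ _ "left_submodule X", OF this
        left_submodule_image[OF gE gm(3) fh left_submodule_kernel[OF gE gm(1) dh]]]
    have imf: "?K \<subseteq> ?f ` {q \<in> carrier ?E. ?d q = \<zero>\<^bsub>M\<^esub>}" unfolding E(4) .
    show "\<forall>p\<in>carrier M. \<forall>x\<in>carrier X. d p = \<zero>\<^bsub>M\<^sub>2\<^esub> \<and> f p = dX x \<longrightarrow>
       (\<exists>q\<in>carrier ?E. ?d q = p \<and> ?f q = x)"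
    proof (intro ballI impI)
      fix p x assume p: "p \<in> carrier M" and x: "x \<in> carrier X" and px: "d p = \<zero>\<^bsub>M\<^sub>2\<^esub> \<and> f p = dX x"
      then have "p \<in> ?N" by auto
      then obtain q where q: "q \<in> carrier ?E" "p = ?d q" using imd by blast
      have fq: "?f q \<in> carrier X" by (rule gr_homD(1)[OF fh q(1)])
      have fqm: "(- 1) \<odot>\<^bsub>X\<^esub> ?f q \<in> carrier X" using fq by (rule X.smult_closed)
      \<comment> \<open>A preimage \<open>q\<close> of \<open>p\<close> may miss \<open>x\<close> in
        the second coordinate. The defect lies in \<open>?K\<close> and is corrected by some
        \<open>q'\<close> with \<open>?d q'\<close> zero.\<close>
      let ?x = "x \<oplus>\<^bsub>X\<^esub> (- 1) \<odot>\<^bsub>X\<^esub> ?f q"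
      have "dX x = dX (?f q)" using px fd[OF q(1)] unfolding q(2) by simp
      then have "dX ?x = dX (?f q) \<oplus>\<^bsub>X\<^sub>2\<^esub> (- 1) \<odot>\<^bsub>X\<^sub>2\<^esub> dX (?f q)"
        using gr_homD(2)[OF h(3) x fqm] gr_homD(3)[OF h(3) fq] by simp
      also have "\<dots> = \<zero>\<^bsub>X\<^sub>2\<^esub>"
        using X2.minus_one_smult gr_homD(1)[OF h(3) fq] by (simp add: X2.r_neg)
      finally have "?x \<in> ?K" using x fqm by simp
      then have "?x \<in> ?f ` {q \<in> carrier ?E. ?d q = \<zero>\<^bsub>M\<^esub>}" using imf by (rule subsetD[rotated])
      then obtain q' where q': "q' \<in> carrier ?E" "?d q' = \<zero>\<^bsub>M\<^esub>" "?x = ?f q'" by (elim imageE CollectE conjE)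
      have sum: "q \<oplus>\<^bsub>?E\<^esub> q' \<in> carrier ?E" using q(1) q'(1) by (rule E.a_closed)
      have "?d (q \<oplus>\<^bsub>?E\<^esub> q') = p"
        using gr_homD(2)[OF dh q(1) q'(1)] p unfolding q'(2) q(2)[symmetric] by simp
      moreover have "?f (q \<oplus>\<^bsub>?E\<^esub> q') = x"
        using gr_homD(2)[OF fh q(1) q'(1)] x fq unfolding q'(3)[symmetric]
        by (simp add: X.minus_one_smult X.a_lcomm X.r_neg)
      ultimately show "\<exists>q\<in>carrier ?E. ?d q = p \<and> ?f q = x" using sum by blast
    qed
  qed
qed

end

text \<open>One term of the resolution under construction: the module, its differential, and its
  component of the chain map to \<open>X\<close>.\<close>

type_synonym ('r, 'm) stage =
  "('r, nat \<Rightarrow> 'r) gmod \<times> ((nat \<Rightarrow> 'r) \<Rightarrow> nat \<Rightarrow> 'r) \<times> ((nat \<Rightarrow> 'r) \<Rightarrow> 'm)"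

lemma (in graded_algebra) free_resolution_exists:
  fixes X :: "('a, 'x) cpx"
  assumes noeth: "noetherian (UNIV :: 'a set)" and X: "X \<in> Db_gr G"
  obtains P :: "('a, nat \<Rightarrow> 'a) cpx" where "free_resolution G X P"
proof -
  have cX: "complex_Gr G X" and fgX: "fin_gen (ob X n)" for n using X unfolding Db_gr_def by auto
  then have gX: "graded_module G (ob X n)" and dX: "df X n \<in> gr_hom (ob X n) (ob X (n + 1))" for n
    unfolding complex_Gr_def by blast+
  from X obtain a b where b: "\<And>n. n \<notin> {a..b} \<Longrightarrow> carrier (ob X n) = {\<zero>\<^bsub>ob X n\<^esub>}"
    unfolding Db_gr_def by blast
  let ?zero = "free_gmod G 0 (\<lambda>_. 0)"
  \<comment> \<open>Stage 0 is the zero module in degree \<open>b + 1\<close>, just above the top of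
    \<open>X\<close>; it gives the first covering step something to map to.\<close>
  let ?deg = "\<lambda>t. b + 1 - int t"
  \<comment> \<open>The target of the stored differential is remembered only as some
    \<open>free_gmod\<close>. All of these share the zero \<open>\<lambda>_. 0\<close>, so
    \<open>?Step\<close> can say that two differentials compose to zero without naming the
    target.\<close>
  let ?Inv = "\<lambda>t (s :: ('a, 'x) stage).
    (\<exists>r e. fst s = free_gmod G r e) \<and> (\<exists>r e. fst (snd s) \<in> gr_hom (fst s) (free_gmod G r e)) \<and>
    snd (snd s) \<in> gr_hom (fst s) (ob X (?deg t)) \<and>
    (t = 0 \<longrightarrow> fst s = ?zero \<and> fst (snd s) = (\<lambda>_ _. 0))"
  let ?Step = "\<lambda>t (s :: ('a, 'x) stage)
      (s' :: ('a, 'x) stage).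
    fst (snd s') \<in> gr_hom (fst s') (fst s) \<and>
    (\<forall>q\<in>carrier (fst s'). fst (snd s) (fst (snd s') q) = (\<lambda>_. 0)) \<and>
    (\<forall>q\<in>carrier (fst s'). snd (snd s) (fst (snd s') q) = df X (?deg (Suc t)) (snd (snd s') q)) \<and>
    (\<forall>p\<in>carrier (fst s). \<forall>x\<in>carrier (ob X (?deg (Suc t))).
       fst (snd s) p = (\<lambda>_. 0) \<and> snd (snd s) p = df X (?deg (Suc t)) x \<longrightarrow>
       (\<exists>q\<in>carrier (fst s'). fst (snd s') q = p \<and> snd (snd s') q = x))"
  have "\<exists>s. \<forall>t. ?Inv t (s t) \<and> ?Step t (s t) (s (Suc t))"
  proof (rule dependent_nat_choice)
    interpret Z: graded_module G ?zero by (rule graded_module_free_gmod)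
    interpret X: graded_module G "ob X (?deg 0)" by (rule gX)
    have "?Inv 0 (?zero, \<lambda>_ _. 0, \<lambda>_. \<zero>\<^bsub>ob X (?deg 0)\<^esub>)"
      using Z.gr_hom_const_zero[of ?zero] X.gr_hom_const_zero[of ?zero] by auto
    then show "\<exists>s. ?Inv 0 s" by (rule exI)
  next
    fix s :: "('a, 'x) stage" and t
    assume Inv: "?Inv t s"
    then obtain r\<^sub>1 e\<^sub>1 r\<^sub>2 e\<^sub>2 where M: "fst s = free_gmod G r\<^sub>1 e\<^sub>1"
      and d: "fst (snd s) \<in> gr_hom (fst s) (free_gmod G r\<^sub>2 e\<^sub>2)"
      and f: "snd (snd s) \<in> gr_hom (fst s) (ob X (?deg t))" by (elim conjE exE)
    have "?deg (Suc t) + 1 = ?deg t" by simp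
    then have dXt: "df X (?deg (Suc t)) \<in> gr_hom (ob X (?deg (Suc t))) (ob X (?deg t))"
      using dX[of "?deg (Suc t)"] by (simp only:)
    have gM: "graded_module G (fst s)" unfolding M by (rule graded_module_free_gmod)
    have fgM: "fin_gen (fst s)"
      unfolding M by (rule fin_graded_free_fin_gen[OF graded_module_free_gmod fin_graded_free_free_gmod])
    obtain r e d' f' where s': "d' \<in> gr_hom (free_gmod G r e) (fst s)"
      "f' \<in> gr_hom (free_gmod G r e) (ob X (?deg (Suc t)))"
      "\<forall>q\<in>carrier (free_gmod G r e). fst (snd s) (d' q) = \<zero>\<^bsub>free_gmod G r\<^sub>2 e\<^sub>2\<^esub>"
      "\<forall>q\<in>carrier (free_gmod G r e). snd (snd s) (d' q) = df X (?deg (Suc t)) (f' q)"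
      "\<forall>p\<in>carrier (fst s). \<forall>x\<in>carrier (ob X (?deg (Suc t))).
         fst (snd s) p = \<zero>\<^bsub>free_gmod G r\<^sub>2 e\<^sub>2\<^esub> \<and> snd (snd s) p = df X (?deg (Suc t)) x \<longrightarrow>
         (\<exists>q\<in>carrier (free_gmod G r e). d' q = p \<and> f' q = x)"
      by (rule free_cover[OF noeth gM graded_module_free_gmod gX gX fgM fgX d f dXt])
    have "?Inv (Suc t) (free_gmod G r e, d', f')"
      using s'(1,2) M by (auto simp del: free_gmod_simps of_nat_Suc)
    moreover have "?Step t s (free_gmod G r e, d', f')"
      using s'(1,3,4,5) by (simp only: fst_conv snd_conv free_gmod_simps(2))
    ultimately have "?Inv (Suc t) (free_gmod G r e, d', f') \<and> ?Step t s (free_gmod G r e, d', f')"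
      by (rule conjI)
    then show "\<exists>s'. ?Inv (Suc t) s' \<and> ?Step t s s'"
      by (rule exI[of "\<lambda>s'. ?Inv (Suc t) s' \<and> ?Step t s s'"])
  qed
  then obtain s where s: "\<forall>t. ?Inv t (s t) \<and> ?Step t (s t) (s (Suc t))" by (rule exE)
  note Inv = s[THEN spec, THEN conjunct1] and Step = s[THEN spec, THEN conjunct2]
  define M where "M t = fst (s t)" for t
  define D where "D t = fst (snd (s t))" for t
  define F where "F t = snd (snd (s t))" for t
  have M: "\<exists>r e. M t = free_gmod G r e" and F: "F t \<in> gr_hom (M t) (ob X (?deg t))"
    and M0: "M 0 = ?zero" and D0: "D 0 = (\<lambda>_ _. 0)" for t
    using Inv[of t] Inv[of 0] unfolding M_def D_def F_def by simp_all
  note Step' = Step[folded M_def D_def F_def]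
  have D: "D (Suc t) \<in> gr_hom (M (Suc t)) (M t)"
    and DD: "q \<in> carrier (M (Suc t)) \<Longrightarrow> D t (D (Suc t) q) = (\<lambda>_. 0)"
    and FD: "q \<in> carrier (M (Suc t)) \<Longrightarrow> F t (D (Suc t) q) = df X (?deg (Suc t)) (F (Suc t) q)"
    and cover: "p \<in> carrier (M t) \<Longrightarrow> x \<in> carrier (ob X (?deg (Suc t))) \<Longrightarrow> D t p = (\<lambda>_. 0) \<Longrightarrow>
       F t p = df X (?deg (Suc t)) x \<Longrightarrow> \<exists>q\<in>carrier (M (Suc t)). D (Suc t) q = p \<and> F (Suc t) q = x"
    for t q p x
  proof -
    show "D (Suc t) \<in> gr_hom (M (Suc t)) (M t)" by (rule Step'[THEN conjunct1])
    show "D t (D (Suc t) q) = (\<lambda>_. 0)" if "q \<in> carrier (M (Suc t))"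
      using that by (rule Step'[THEN conjunct2, THEN conjunct1, THEN bspec])
    show "F t (D (Suc t) q) = df X (?deg (Suc t)) (F (Suc t) q)" if "q \<in> carrier (M (Suc t))"
      using that by (rule Step'[THEN conjunct2, THEN conjunct2, THEN conjunct1, THEN bspec])
    show "\<exists>q\<in>carrier (M (Suc t)). D (Suc t) q = p \<and> F (Suc t) q = x"
      if "p \<in> carrier (M t)" "x \<in> carrier (ob X (?deg (Suc t)))" "D t p = (\<lambda>_. 0)"
        "F t p = df X (?deg (Suc t)) x"
      by (rule Step'[THEN conjunct2, THEN conjunct2, THEN conjunct2, THEN bspec, THEN bspec, THEN mp,
            OF that(1,2) conjI[OF that(3,4)]])
  qed
  have gM: "graded_module G (M t)" and freeM: "fin_graded_free (M t)" and zM: "\<zero>\<^bsub>M t\<^esub> = (\<lambda>_. 0)" for t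
    using M[of t] graded_module_free_gmod fin_graded_free_free_gmod by auto
  \<comment> \<open>Truncation by \<open>nat\<close> sends every degree above \<open>b\<close> to
    stage 0, so the complex is zero there.\<close>
  let ?t = "\<lambda>n. nat (b + 1 - n)"
  define P :: "('a, nat \<Rightarrow> 'a) cpx" where "P = \<lparr>ob = (\<lambda>n. M (?t n)), df = (\<lambda>n. D (?t n))\<rparr>"
  \<comment> \<open>The stored map of stage 0 has its values in degree \<open>b + 1\<close> of
    \<open>X\<close>, so above that degree a zero map with the right target takes its place.\<close>
  define f where "f n = (if n \<le> b + 1 then F (?t n) else (\<lambda>_. \<zero>\<^bsub>ob X n\<^esub>))" for n
  have P: "ob P n = M (?t n)" "df P n = D (?t n)" for n unfolding P_def by simp_all
  have low: "?t n = Suc (?t (n + 1))" "?deg (Suc (?t (n + 1))) = n" if "n \<le> b" for n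
    using that by (simp_all add: nat_eq_iff Suc_nat_eq_nat_zadd1)
  have high: "?t n = 0" if "\<not> n \<le> b" for n using that by simp
  have zeroX: "carrier (ob X n) = {\<zero>\<^bsub>ob X n\<^esub>}" if "\<not> n \<le> b" for n using b[of n] that by simp
  have hom: "df P n \<in> gr_hom (ob P n) (ob P (n + 1))" for n
  proof (cases "n \<le> b")
    case True
    show ?thesis unfolding P low(1)[OF True] by (rule D)
  next
    case False
    interpret Z: graded_module G ?zero by (rule graded_module_free_gmod)
    have nb: "\<not> n + 1 \<le> b" using False by simp
    show ?thesis
      unfolding P high[OF False] high[OF nb] D0 M0 using Z.gr_hom_const_zero by simp
  qed
  have sq: "df P (n + 1) (df P n q) = \<zero>\<^bsub>ob P (n + 2)\<^esub>" if "q \<in> carrier (ob P n)" for n q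
  proof (cases "n \<le> b")
    case True
    show ?thesis using that unfolding P zM low(1)[OF True] by (rule DD)
  next
    case False
    then have nb: "\<not> n + 1 \<le> b" by simp
    show ?thesis unfolding P zM high[OF nb] D0 ..
  qed
  have cP: "complex_Gr G P"
    unfolding complex_Gr_def using hom sq gM by (auto simp: P)
  have fh: "f n \<in> gr_hom (ob P n) (ob X n)" for n
  proof (cases "n \<le> b + 1")
    case True
    then have "?deg (?t n) = n" by simp
    then show ?thesis using F[of "?t n"] True unfolding f_def P by simp
  next
    case False
    interpret X: graded_module G "ob X n" by (rule gX)
    show ?thesis unfolding f_def using False X.gr_hom_const_zero by simp
  qed
  have fdf: "f (n + 1) (df P n q) = df X n (f n q)" if q: "q \<in> carrier (ob P n)" for n q
  proof (cases "n \<le> b")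
    case True
    have "F (?t (n + 1)) (D (Suc (?t (n + 1))) q) = df X (?deg (Suc (?t (n + 1)))) (F (Suc (?t (n + 1))) q)"
      by (rule FD) (use q in \<open>simp only: P low(1)[OF True]\<close>)
    then show ?thesis unfolding f_def P using True by (simp only: low[OF True]) simp
  next
    case False
    have "f (n + 1) (df P n q) \<in> carrier (ob X (n + 1))"
      by (rule gr_homD(1)[OF fh gr_homD(1)[OF hom q]])
    moreover have "df X n (f n q) \<in> carrier (ob X (n + 1))"
      by (rule gr_homD(1)[OF dX gr_homD(1)[OF fh q]])
    ultimately show ?thesis using zeroX[of "n + 1"] False by simp
  qed
  have "quasi_iso P X f"
  proof (rule quasi_isoI[OF cP cX])
    show "chain_map P X f" unfolding chain_map_def using fh fdf by simp
    fix n p x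
    assume p: "p \<in> carrier (ob P (n + 1))" and x: "x \<in> carrier (ob X n)"
      and dp: "df P (n + 1) p = \<zero>\<^bsub>ob P (n + 2)\<^esub>" and fp: "f (n + 1) p = df X n x"
    show "\<exists>q\<in>carrier (ob P n). df P n q = p \<and> f n q = x"
    proof (cases "n \<le> b")
      case True
      have "\<exists>q\<in>carrier (M (Suc (?t (n + 1)))). D (Suc (?t (n + 1))) q = p \<and> F (Suc (?t (n + 1))) q = x"
      proof (rule cover)
        show "p \<in> carrier (M (?t (n + 1)))" using p unfolding P .
        show "x \<in> carrier (ob X (?deg (Suc (?t (n + 1)))))" unfolding low(2)[OF True] by (rule x)
        show "D (?t (n + 1)) p = (\<lambda>_. 0)" using dp unfolding P zM .
        show "F (?t (n + 1)) p = df X (?deg (Suc (?t (n + 1)))) x"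
          unfolding low(2)[OF True] using fp True by (simp add: f_def)
      qed
      then show ?thesis unfolding P f_def low(1)[OF True, symmetric] using True by simp
    next
      case False
      then have nb: "\<not> n + 1 \<le> b" by simp
      have p0: "p = (\<lambda>_. 0)" using p unfolding P high[OF nb] M0 by auto
      have q: "\<zero>\<^bsub>ob P n\<^esub> \<in> carrier (ob P n)" unfolding P high[OF False] M0 by simp
      have "df P n \<zero>\<^bsub>ob P n\<^esub> = p" unfolding P high[OF False] D0 p0 ..
      moreover have "f n \<zero>\<^bsub>ob P n\<^esub> = x" using gr_homD(1)[OF fh q] x zeroX[OF False] by simp
      ultimately show ?thesis using q by blast
    qed
  qed
  moreover have "carrier (ob P n) = {\<zero>\<^bsub>ob P n\<^esub>}" if "n > b" for n
    unfolding P zM using high[of n] that M0 by auto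
  moreover have "fin_graded_free (ob P n)" for n unfolding P by (rule freeM)
  ultimately have "free_resolution G X P" unfolding free_resolution_def using cP by blast
  then show ?thesis by (rule that)
qed

theorem theorem1p4:
  fixes scale :: "'k::field \<Rightarrow> 'a::{ring,monoid_mult} \<Rightarrow> 'a"
    and G :: "nat \<Rightarrow> 'a set"
    and X :: "('a, 'm) cpx"
  assumes "graded_algebra scale G"
    and "noetherian (UNIV :: 'a set)"
    and "X \<in> Db_gr G"
    and "\<not> acyclic_cpx X"
  shows "Extreg scale G X \<ge> - inf_deg (RHom scale G X (regular G)) \<and>
    (semisimple (G 0) \<and> pdim scale G X < \<infinity> \<longrightarrow>
      Extreg scale G X = - inf_deg (RHom scale G X (regular G)))"
proof -
  interpret graded_algebra scale G by fact
  obtain P\<^sub>0 where P\<^sub>0: "free_resolution G X (P\<^sub>0 :: ('a, nat \<Rightarrow> 'a) cpx)"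
    by (rule free_resolution_exists[OF assms(2,3)])
  define P where "P = resolution G X"
  \<comment> \<open>The constructed \<open>P\<^sub>0\<close> serves only as the witness that makes
    the \<open>SOME\<close> choice in \<open>resolution\<close> a genuine resolution.\<close>
  have "free_resolution G X P"
    unfolding P_def resolution_def using P\<^sub>0 by (rule someI[of "free_resolution G X"])
  then interpret free_complex scale G P
    by unfold_locales (auto simp: free_resolution_def)
  have RHom: "RHom scale G X = Hom_cpx scale P" unfolding RHom_def P_def ..
  have le: "inf_deg (RHom scale G X (mod_jacobson G)) \<le> inf_deg (RHom scale G X (regular G))"
    unfolding RHom by (rule inf_deg_mod_jacobson_le)
  have ge: "inf_deg (RHom scale G X (regular G)) \<le> inf_deg (RHom scale G X (mod_jacobson G))"
    if ss: "semisimple (G 0)" and pd: "pdim scale G X < \<infinity>"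
  proof -
    let ?Y = "embedded_ideal G (degree_ge 1)"
    have Y: "graded_module G ?Y"
      by (rule graded_module_embedded_ideal[OF graded_left_ideal_degree_ge])
    obtain m :: nat where m: "pdim scale G X < ereal (real m)"
      using less_PInf_Ex_of_nat pd by auto
    \<comment> \<open>Position \<open>n\<close> is cohomological degree \<open>- n\<close>, which
      exceeds \<open>m\<close> and therefore \<open>pdim\<close>. The copy \<open>?Y\<close> of the
      positive part of \<open>A\<close> is one of the modules over which \<open>pdim\<close> takes
      its supremum.\<close>
    have "ext_vanishes n j (degree_ge 1) {0}" if n: "n < - int m" for n j
    proof (rule homogeneous_exact_embedded_ideal[OF graded_left_ideal_degree_ge],
        rule cohomology_zero_imp_exact[OF Y], rule ccontr)
      assume "carrier (cohomology (Hom_cpx scale P ?Y) (- n)) \<noteq>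
        {\<zero>\<^bsub>cohomology (Hom_cpx scale P ?Y) (- n)\<^esub>}"
      then have "carrier (Ext scale G (- n) X ?Y) \<noteq> {\<zero>\<^bsub>Ext scale G (- n) X ?Y\<^esub>}"
        unfolding Ext_def RHom .
      then have "ereal (real_of_int (- n)) \<le> pdim scale G X"
        unfolding pdim_def using Y by (intro Sup_upper CollectI exI[of _ "- n"] conjI refl exI[of _ ?Y])
      also have "\<dots> < ereal (real m)" by (rule m)
      finally show False using n by simp
    qed
    then show ?thesis unfolding RHom by (rule inf_deg_regular_le[OF ss])
  qed
  show ?thesis
    unfolding Extreg_def
  proof (intro conjI impI)
    show "- inf_deg (RHom scale G X (regular G)) \<le> - inf_deg (RHom scale G X (mod_jacobson G))"
      unfolding ereal_minus_le_minus by (rule le)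
    assume "semisimple (G 0) \<and> pdim scale G X < \<infinity>"
    then show "- inf_deg (RHom scale G X (mod_jacobson G)) = - inf_deg (RHom scale G X (regular G))"
      using antisym[OF le ge] by simp
  qed
qed

end
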